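(* Let $n$ be a positive odd integer, and let $M=(n-1)/2$ or $M=n-1$. Then $$\sum_{k=0}^{M}[4k+1]\frac{(q;q^2)_k^3(q^2;q^4)_k}{(q^2;q^2)_k^3(q^4;q^4)_k}q^{k^2+k}\equiv[n]q^{(1-n)/2}\left\{1+[n]^2\frac{(n^2-1)(1-q)^2}{24}\right\}\sum_{k=0}^{(n-1)/2}\frac{(q;q^2)_k^3}{(q^2;q^2)_k(q^4;q^4)_k}q^{2k}\pmod{[n]\Phi_n(q)^3}.$$
   Context: For a nonnegative integer $k$, $(x;q)_0=1$ and $(x;q)_k=(1-x)(1-xq)\cdots(1-xq^{k-1})$ for $k\ge 1$; the same notation is used with base $q$ replaced by $q^2$ or $q^4$. $[m]=(1-q^m)/(1-q)$, and $\Phi_n(q)$ is the $n$-th cyclotomic polynomial in $q$. For rational functions $A,B\in\mathbb{Q}(q)$ and a polynomial $P\in\mathbb{Q}[q]$, $A\equiv B\pmod P$ means that $A-B$, written in lowest terms, has numerator divisible by $P$. *)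

theory Defs
  imports Complex_Main "HOL-Computational_Algebra.Computational_Algebra"
    "HOL-Computational_Algebra.Field_as_Ring"
begin

text \<open>
  The field of rational functions over the rationals is \<^typ>\<open>rat poly fract\<close>;
  \<^term>\<open>qvar\<close> is its indeterminate.
\<close>

definition qvar :: "rat poly fract" where
  "qvar = to_fract [:0, 1:]"

definition q_pochhammer :: "'a::comm_ring_1 \<Rightarrow> 'a \<Rightarrow> nat \<Rightarrow> 'a" where
  "q_pochhammer x q k = (\<Prod>i<k. 1 - x * q ^ i)"

text \<open>
  This is used both at the field element \<^term>\<open>qvar\<close> and at the polynomial indeterminate,
  where the division is exact; the two agree by \<open>to_fract_q_number\<close> below.
\<close>

definition q_number :: "'a::idom_divide \<Rightarrow> nat \<Rightarrow> 'a" where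
  "q_number q m = (1 - q ^ m) div (1 - q)"

definition primitive_root_unity :: "nat \<Rightarrow> complex \<Rightarrow> bool" where
  "primitive_root_unity n z \<longleftrightarrow> z ^ n = 1 \<and> (\<forall>m. 0 < m \<and> m < n \<longrightarrow> z ^ m \<noteq> 1)"

text \<open>
  The cyclotomic polynomial is the product of the linear factors at the primitive roots of unity;
  \<open>map_poly_cyclotomic\<close> below shows that it has rational coefficients, so that the
  description is satisfied by exactly one polynomial. Only \<^prop>\<open>n > 0\<close> is meaningful.
\<close>

definition cyclotomic :: "nat \<Rightarrow> rat poly" where
  "cyclotomic n =
     (THE p. map_poly of_rat p = (\<Prod>z | primitive_root_unity n z. [:- z, 1:]))"

text \<open>
  \<^const>\<open>quot_of_fract\<close> returns the coprime numerator and denominator, with monic denominator.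
\<close>

definition ratfun_cong :: "rat poly fract \<Rightarrow> rat poly fract \<Rightarrow> rat poly \<Rightarrow> bool" where
  "ratfun_cong A B P \<longleftrightarrow> P dvd fst (quot_of_fract (A - B))"


lemma q_number_eq_sum:
  assumes "q \<noteq> 1"
  shows "q_number q m = (\<Sum>i<m. q ^ i)"
proof -
  have "1 - q ^ m = (\<Sum>i<m. q ^ i) * (1 - q)"
    by (simp add: one_diff_power_eq mult.commute)
  then show ?thesis using assms by (simp add: q_number_def)
qed

lemma qvar_neq_1: "qvar \<noteq> 1"
proof
  assume "qvar = 1"
  then have "to_fract [:0, 1 :: rat:] = to_fract 1" by (simp add: qvar_def)
  then have "[:0, 1 :: rat:] = 1" by (simp only: to_fract_eq_iff)
  then show False by (simp add: one_pCons)
qed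

lemma to_fract_q_number: "to_fract (q_number [:0, 1:] m) = q_number qvar m"
proof -
  have sum: "to_fract (\<Sum>i<m. p ^ i) = (\<Sum>i<m. to_fract p ^ i)" for p :: "rat poly"
  proof (induction m)
    case (Suc m)
    have pow: "to_fract (p ^ i) = to_fract p ^ i" for i
      by (induction i) simp_all
    show ?case using Suc by (simp add: pow)
  qed simp
  have "[:0, 1 :: rat:] \<noteq> 1" by (simp add: one_pCons)
  then have "to_fract (q_number [:0, 1 :: rat:] m) = (\<Sum>i<m. qvar ^ i)"
    by (simp only: q_number_eq_sum sum qvar_def not_False_eq_True)
  then show ?thesis
    using q_number_eq_sum[OF qvar_neq_1, of m] by simp
qed

lemma roots_unity_eq_Union_primitive:
  assumes "n > 0"
  shows "{z :: complex. z ^ n = 1} = (\<Union>d\<in>{d. d dvd n}. {z. primitive_root_unity d z})"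
proof (intro equalityI subsetI)
  fix z :: complex assume "z \<in> {z. z ^ n = 1}"
  then have z: "z ^ n = 1" by simp
  define d where "d = (LEAST d. 0 < d \<and> z ^ d = 1)"
  have d: "0 < d \<and> z ^ d = 1"
    unfolding d_def by (rule LeastI[of _ n]) (use assms z in simp)
  have least: "z ^ m \<noteq> 1" if "0 < m" "m < d" for m
    using not_less_Least[of m "\<lambda>d. 0 < d \<and> z ^ d = 1"] that unfolding d_def by simp
  have "z ^ n = (z ^ d) ^ (n div d) * z ^ (n mod d)"
    by (simp flip: power_mult power_add)
  then have "z ^ (n mod d) = 1" using z d by simp
  moreover have "n mod d < d" using d by simp
  ultimately have "n mod d = 0" using least by blast
  then have "d dvd n" by auto
  then show "z \<in> (\<Union>d\<in>{d. d dvd n}. {z. primitive_root_unity d z})"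
    using d least by (auto simp: primitive_root_unity_def)
next
  fix z :: complex assume "z \<in> (\<Union>d\<in>{d. d dvd n}. {z. primitive_root_unity d z})"
  then obtain d where "d dvd n" "z ^ d = 1" by (auto simp: primitive_root_unity_def)
  then show "z \<in> {z. z ^ n = 1}" by (auto simp: power_mult elim!: dvdE)
qed

lemma finite_primitive_root_unity: "n > 0 \<Longrightarrow> finite {z. primitive_root_unity n z}"
  by (rule finite_subset[OF _ finite_roots_unity[of n]]) (auto simp: primitive_root_unity_def)

lemma prod_primitive_roots:
  assumes "n > 0"
  shows "(\<Prod>d | d dvd n. \<Prod>z | primitive_root_unity d z. [:- z, 1:]) = monom 1 n - 1"
proof -
  let ?p = "monom 1 n - 1 :: complex poly"
  have roots: "{z. poly ?p z = 0} = {z. z ^ n = 1}" by (simp add: poly_monom)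
  have deg: "degree ?p = n"
    using assms by (subst diff_conv_add_uminus, subst degree_add_eq_left) (auto simp: degree_monom_eq)
  have lc: "lead_coeff ?p = 1" using assms by (simp add: deg)
  have "rsquarefree ?p"
    unfolding rsquarefree_roots
  proof (intro allI notI)
    fix a assume a: "poly ?p a = 0 \<and> poly (pderiv ?p) a = 0"
    then have an: "a ^ n = 1" by (simp add: poly_monom)
    have "pderiv ?p = monom (of_nat n) (n - 1)" by (simp add: pderiv_diff pderiv_monom)
    with a assms have "a ^ (n - 1) = 0" by (simp add: poly_monom)
    then have "a = 0" by simp
    with an assms show False by (simp add: power_0_left)
  qed
  then have "smult (lead_coeff ?p) (\<Prod>z | poly ?p z = 0. [:- z, 1:]) = ?p"
    by (rule complex_poly_decompose_rsquarefree)
  then have "?p = (\<Prod>z | z ^ n = 1. [:- z, 1:])" unfolding lc roots by simp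
  also have "\<dots> = (\<Prod>d | d dvd n. \<Prod>z | primitive_root_unity d z. [:- z, 1:])"
    unfolding roots_unity_eq_Union_primitive[OF assms]
  proof (rule prod.UNION_disjoint)
    show "finite {d. d dvd n}" using assms by (simp add: finite_divisors_nat)
    show "\<forall>d\<in>{d. d dvd n}. finite {z. primitive_root_unity d z}"
      using assms by (auto intro: finite_primitive_root_unity dvd_pos_nat)
    have "False" if "d dvd n" "e dvd n" "d < e" "primitive_root_unity d z" "primitive_root_unity e z"
      for d e z
      using that assms dvd_pos_nat[of n d] by (auto simp: primitive_root_unity_def)
    note disj = this
    show "\<forall>d\<in>{d. d dvd n}. \<forall>e\<in>{d. d dvd n}. d \<noteq> e \<longrightarrow>
        {z. primitive_root_unity d z} \<inter> {z. primitive_root_unity e z} = {}"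
    proof (intro ballI impI equals0I)
      fix d e z
      assume "d \<in> {d. d dvd n}" "e \<in> {d. d dvd n}" "d \<noteq> e"
        and "z \<in> {z. primitive_root_unity d z} \<inter> {z. primitive_root_unity e z}"
      then show False using disj[of d e z] disj[of e d z] by (cases d e rule: linorder_cases) simp_all
    qed
  qed
  finally show ?thesis by simp
qed

lemma map_poly_of_rat_add:
  "map_poly (of_rat :: rat \<Rightarrow> complex) (p + q) = map_poly of_rat p + map_poly of_rat q"
  by (intro poly_eqI) (simp add: coeff_map_poly of_rat_add)

lemma map_poly_of_rat_mult:
  "map_poly (of_rat :: rat \<Rightarrow> complex) (p * q) = map_poly of_rat p * map_poly of_rat q"
  by (intro poly_eqI) (simp add: coeff_map_poly coeff_mult of_rat_sum of_rat_mult)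

lemma map_poly_of_rat_prod:
  "map_poly (of_rat :: rat \<Rightarrow> complex) (prod f A) = (\<Prod>x\<in>A. map_poly of_rat (f x))"
  by (induction A rule: infinite_finite_induct) (simp_all add: map_poly_of_rat_mult)

lemma map_poly_of_rat_inj:
  assumes "map_poly (of_rat :: rat \<Rightarrow> complex) p = map_poly of_rat q"
  shows "p = q"
proof (rule poly_eqI)
  fix i
  have "coeff (map_poly (of_rat :: rat \<Rightarrow> complex) p) i = coeff (map_poly of_rat q) i"
    using assms by simp
  then show "coeff p i = coeff q i" by (simp add: coeff_map_poly)
qed

lemma ex_cyclotomic:
  assumes "n > 0"
  shows "\<exists>p. map_poly of_rat p = (\<Prod>z | primitive_root_unity n z. [:- z, 1:])"
  using assms
proof (induction n rule: less_induct)
  case (less n)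
  let ?c = "\<lambda>d. \<Prod>z | primitive_root_unity d z. [:- z, 1:]"
  let ?m = "map_poly (of_rat :: rat \<Rightarrow> complex)"
  let ?D = "{d. d dvd n \<and> d \<noteq> n}"
  have fin: "finite {d. d dvd n}" using less.prems by (simp add: finite_divisors_nat)
  have "\<exists>p. ?m p = ?c d" if "d \<in> ?D" for d
    using that less.prems by (intro less.IH) (auto intro: dvd_pos_nat le_neq_trans dvd_imp_le)
  then obtain f where f: "\<And>d. d \<in> ?D \<Longrightarrow> ?m (f d) = ?c d" by metis
  define A where "A = prod f ?D"
  have mA: "?m A = (\<Prod>d\<in>?D. ?c d)"
    unfolding A_def map_poly_of_rat_prod by (rule prod.cong[OF refl f])
  have "{d. d dvd n} = insert n ?D" by auto
  then have "(\<Prod>d | d dvd n. ?c d) = ?c n * (\<Prod>d\<in>?D. ?c d)"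
    using fin by simp
  then have fact: "monom 1 n - 1 = ?c n * ?m A"
    using prod_primitive_roots[OF less.prems] mA by simp
  have "finite ?D" using fin by simp
  moreover have "finite {z. primitive_root_unity d z}" if "d \<in> ?D" for d
    using that less.prems by (auto intro: finite_primitive_root_unity dvd_pos_nat)
  ultimately have "?m A \<noteq> 0" unfolding mA by (auto simp: prod_zero_iff)
  define B :: "rat poly" where "B = monom 1 n - 1"
  have mB: "?m B = monom 1 n - 1"
    by (intro poly_eqI) (auto simp: B_def coeff_map_poly of_rat_diff)
  have "B = A * (B div A) + B mod A" by simp
  then have "?m B = ?m A * ?m (B div A) + ?m (B mod A)"
    by (metis map_poly_of_rat_add map_poly_of_rat_mult)
  then have eq: "?m A * (?c n - ?m (B div A)) = ?m (B mod A)"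
    using fact mB by (simp add: algebra_simps)
  have "A \<noteq> 0" using \<open>?m A \<noteq> 0\<close> by auto
  have deg: "degree (?m p) = degree p" for p
    by (rule degree_map_poly) simp
  have "?m (B mod A) = 0"
  proof (rule ccontr)
    assume nz: "?m (B mod A) \<noteq> 0"
    then have "B mod A \<noteq> 0" by auto
    then have "degree (B mod A) < degree A"
      using degree_mod_less[OF \<open>A \<noteq> 0\<close>, of B] by simp
    moreover have "?m A dvd ?m (B mod A)" using eq by (metis dvd_triv_left)
    then have "degree (?m A) \<le> degree (?m (B mod A))" using nz by (rule dvd_imp_degree_le)
    ultimately show False by (simp add: deg)
  qed
  with eq \<open>?m A \<noteq> 0\<close> have "?m (B div A) = ?c n" by simp
  then show ?case by blast
qed

lemma map_poly_cyclotomic: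
  assumes "n > 0"
  shows "map_poly of_rat (cyclotomic n) = (\<Prod>z | primitive_root_unity n z. [:- z, 1:])"
proof -
  have "\<exists>!p. map_poly of_rat p = (\<Prod>z | primitive_root_unity n z. [:- z, 1:])"
    using ex_cyclotomic[OF assms] map_poly_of_rat_inj by (metis (no_types))
  then show ?thesis unfolding cyclotomic_def by (rule theI')
qed

end

(*
  Put N = (n-1)/2 and x = q^n, and deform the left-hand sum to L(a,b) by replacing three of its
  factors (q;q^2)_k/(q^2;q^2)_k by (aq;q^2)_k/(q^2/a;q^2)_k, (q/a;q^2)_k/(aq^2;q^2)_k and
  (bq;q^2)_k/(q^2/b;q^2)_k b^(-k), and likewise the right-hand sum to T(a,b). A limit of Watson's
  transformation of a terminating very-well-poised 8phi7 expresses L(x,1), L(1,1/x) and L(x,1/x)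
  through the corresponding values of T. The remaining value L(1,1) is recovered because the mixed
  difference L(x,1/x) - L(1,1/x) - L(x,1) + L(1,1) vanishes to order 4 at a primitive n-th root of
  unity: L is symmetric in a and 1/a, so the difference in a contributes (1-x)^2, the difference
  in b contributes 1-x, and the coefficient vanishes because its summands change sign under
  k -> N-k. The constant (n^2-1)/24 is minus the sum of z^(2j)/(1-z^(2j))^2 over j = 1..N.

  At an n-th root of unity of smaller order d > 1 only a simple zero is needed. There the left-hand
  sum splits into blocks of length d, each a multiple of one and the same block sum, which vanishes
  by the same antisymmetry.
*)
theory Submission
  imports Defs
begin

section \<open>Watson's transformation\<close>

text \<open>Watson's transformation needs a terminating series, and no numerator factor of the
  undeformed sum vanishes. Setting \<open>a = x\<close> or \<open>b = 1 / x\<close> creates the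
  factor \<open>1 - q ^ (2*i+1) / x\<close>, which is zero at \<open>i = N\<close>; this is why
  three corners of the square are computable and the wanted fourth one is not. Each transformed
  corner carries a factor \<open>[n]\<close> that already has a zero, so T is followed only to order
  three while L needs order four. Watson's constant is \<open>q\<close> to the power
  \<open>- N\<close> on the side \<open>b = 1\<close>, and a product depending on \<open>a\<close>
  on the side \<open>b = 1 / x\<close>. At \<open>a = 1\<close> the two agree in value at a
  primitive root, and the change of the product from \<open>a = 1\<close> to \<open>a = x\<close>
  produces the correction term. The roots of unity are complex while the field has rational
  coefficients, so factors \<open>q - z\<close> cannot be split off inside it. Orders of vanishing
  are therefore expressed as absence of a pole after division by a power of
  \<open>1 - q ^ n\<close>, and the linear factors are reassembled over the complex numbers.\<close>

lemma q_pochhammer_0 [simp]: "q_pochhammer x p 0 = 1"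
  by (simp add: q_pochhammer_def)

lemma q_pochhammer_Suc: "q_pochhammer x p (Suc k) = q_pochhammer x p k * (1 - x * p ^ k)"
  by (simp add: q_pochhammer_def)

lemma q_pochhammer_add:
  "q_pochhammer x p (m + k) = q_pochhammer x p m * q_pochhammer (x * p ^ m) p k"
  by (induction k) (simp_all add: q_pochhammer_Suc power_add mult.assoc)

lemma q_pochhammer_nonzero_mono:
  fixes x p :: "'a::idom"
  assumes "q_pochhammer x p m \<noteq> 0" and "k \<le> m"
  shows "q_pochhammer x p k \<noteq> 0"
  using assms q_pochhammer_add[of x p k "m - k"] by auto

text \<open>The recurrences compare sums of different length: the top index has no partner in the
  shorter sum, so it falls outside the telescoping pattern and must cancel what the telescope
  leaves.\<close>

lemma sum_telescope_last:
  fixes D G :: "nat \<Rightarrow> 'a::ab_group_add"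
  assumes "\<And>k. k \<le> m \<Longrightarrow> D k = G (Suc k) - G k"
    and "G 0 = 0" and "D (Suc m) = - G (Suc m)"
  shows "sum D {..Suc m} = 0"
proof -
  have "sum D {..<Suc k} = G (Suc k)" if "k \<le> m" for k
    using that by (induction k) (use assms in simp_all)
  then show ?thesis using assms(3) by (simp add: lessThan_Suc_atMost)
qed

text \<open>
  Both summations below are proved by the Wilf--Zeilberger method; the certificates were found by
  comparing coefficients of powers of \<open>z = p ^ k\<close>, where \<open>k\<close> is the summation index.
\<close>

lemma q_saalschuetz_certificate:
  fixes p g A B z w :: "'a::field"
  assumes "p \<noteq> 0" "1 - p * w \<noteq> 0"
  shows "(1 - p*z*w) * (1 - g*A*B*z*w) * ((1 - g*w) / (1 - p*w)) - (1 - g*B*z*w) * (1 - g*A*z*w)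
    = - w * (g * ((1 - A*z) * (1 - B*z))) + p*w * ((1 - z) * (1 - g*A*B*z/p) * ((1 - g*w) / (1 - p*w)))"
  using assms by (simp add: divide_simps) (simp add: algebra_simps)

text \<open>The q-Pfaff-Saalschuetz sum of a balanced 3phi2; the symbols of length
  \<open>m - j\<close> carry the terminating parameter and the second lower one. Consecutive right
  sides have ratio \<open>b / a\<close>, so it suffices that \<open>a\<close> times the summand for
  \<open>Suc m\<close> minus \<open>b\<close> times the one for \<open>m\<close> telescopes in
  \<open>j\<close>.\<close>

lemma q_saalschuetz:
  fixes p g A B :: "'a::field"
  assumes "p \<noteq> 0" and "q_pochhammer p p m \<noteq> 0" and "q_pochhammer (g * A * B) p m \<noteq> 0"
  shows "(\<Sum>j\<le>m. q_pochhammer A p j * q_pochhammer B p j * q_pochhammer g p (m - j) * g ^ j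
        / (q_pochhammer p p j * q_pochhammer (g * A * B) p j * q_pochhammer p p (m - j)))
    = q_pochhammer (g * B) p m * q_pochhammer (g * A) p m
        / (q_pochhammer p p m * q_pochhammer (g * A * B) p m)"
  using assms(2,3)
proof (induction m)
  case 0
  show ?case by simp
next
  case (Suc m)
  let ?C = "g * A * B"
  define K where "K j = q_pochhammer A p j * q_pochhammer B p j * g ^ j
    / (q_pochhammer p p j * q_pochhammer ?C p j)" for j
  define u where "u i j = K j * (q_pochhammer g p (i - j) / q_pochhammer p p (i - j))" for i j
  have u: "u i j = q_pochhammer A p j * q_pochhammer B p j * q_pochhammer g p (i - j) * g ^ j
        / (q_pochhammer p p j * q_pochhammer ?C p j * q_pochhammer p p (i - j))" for i j
    by (simp add: u_def K_def)
  have nz: "1 - p * p ^ m \<noteq> 0" "1 - ?C * p ^ m \<noteq> 0" "q_pochhammer p p m \<noteq> 0" "q_pochhammer ?C p m \<noteq> 0"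
    using Suc.prems by (auto simp: q_pochhammer_Suc)
  have IH: "sum (u m) {..m} = q_pochhammer (g * B) p m * q_pochhammer (g * A) p m
      / (q_pochhammer p p m * q_pochhammer ?C p m)"
    using Suc.IH nz unfolding u by simp
  define a where "a = (1 - p * p ^ m) * (1 - ?C * p ^ m)"
  define b where "b = (1 - g * B * p ^ m) * (1 - g * A * p ^ m)"
  \<comment> \<open>Subtraction is truncated at 0, so \<open>u m (Suc m)\<close> need not be zero;
    the conditional removes it.\<close>
  define D where "D j = a * u (Suc m) j - (if j \<le> m then b * u m j else 0)" for j
  define G where "G j = - (p ^ (Suc m - j) * (1 - p ^ j) * (1 - ?C * p ^ j / p)) * u (Suc m) j" for j
  have "sum D {..Suc m} = 0"
  proof (rule sum_telescope_last[where G = G])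
    fix j assume "j \<le> m"
    then obtain l where m: "m = j + l" using le_Suc_ex by blast
    define z w where "z = p ^ j" and "w = p ^ l"
    have nz': "1 - p * w \<noteq> 0" "1 - p * z \<noteq> 0" "1 - ?C * z \<noteq> 0"
      using q_pochhammer_nonzero_mono[OF Suc.prems(1), of "Suc l"]
        q_pochhammer_nonzero_mono[OF Suc.prems(1), of "Suc j"]
        q_pochhammer_nonzero_mono[OF Suc.prems(2), of "Suc j"]
      by (auto simp: m q_pochhammer_Suc z_def w_def)
    have um: "u m j = K j * (q_pochhammer g p l / q_pochhammer p p l)"
      by (simp add: u_def m)
    have u1: "u (Suc m) j = u m j * ((1 - g * w) / (1 - p * w))"
      by (simp add: um) (simp add: u_def m q_pochhammer_Suc w_def Suc_diff_le)
    have KS: "K (Suc j) = K j * (g * ((1 - A * z) * (1 - B * z))) / ((1 - p * z) * (1 - ?C * z))"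
      by (simp add: K_def q_pochhammer_Suc z_def mult_ac)
    have G1: "G (Suc j) = - w * (g * ((1 - A*z) * (1 - B*z))) * u m j"
    proof -
      have 1: "?C * (p * z) / p = ?C * z" "p ^ Suc j = p * z" using assms(1) by (simp_all add: z_def)
      have 2: "u (Suc m) (Suc j) = K (Suc j) * (q_pochhammer g p l / q_pochhammer p p l)" "p ^ (Suc m - Suc j) = w"
        by (simp_all add: u_def m w_def)
      have cancel: "- (w * D * E) * (K j * X / (D * E) * Y) = - w * X * (K j * Y)"
        if "D \<noteq> 0" "E \<noteq> 0" for D E X Y using that by simp
      show ?thesis unfolding G_def 1 2 KS um by (rule cancel) (use nz' in auto)
    qed
    have G0: "G j = - p * w * ((1 - z) * (1 - ?C * z / p) * ((1 - g * w) / (1 - p * w))) * u m j"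
      unfolding G_def u1 by (simp add: m Suc_diff_le z_def w_def)
    have ab: "a = (1 - p*z*w) * (1 - ?C*z*w)" "b = (1 - g*B*z*w) * (1 - g*A*z*w)"
      by (simp_all add: a_def b_def m z_def w_def power_add mult.assoc)
    have "D j = (a * ((1 - g * w) / (1 - p * w)) - b) * u m j"
      using \<open>j \<le> m\<close> by (simp add: D_def u1 algebra_simps)
    also have "\<dots> = (- w * (g * ((1 - A*z) * (1 - B*z))) + p*w * ((1 - z) * (1 - ?C*z/p) * ((1 - g*w) / (1 - p*w)))) * u m j"
      unfolding ab q_saalschuetz_certificate[OF assms(1) nz'(1)] ..
    also have "\<dots> = G (Suc j) - G j"
      unfolding G1 G0 by (simp only: ring_distribs)  simp
    finally show "D j = G (Suc j) - G j" .
  next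
    show "G 0 = 0" by (simp add: G_def)
    show "D (Suc m) = - G (Suc m)"
      using assms(1) by (simp add: D_def G_def a_def)
  qed
  also have "sum D {..Suc m} = a * sum (u (Suc m)) {..Suc m} - b * sum (u m) {..m}"
    unfolding D_def sum_subtractf sum_distrib_left by simp
  finally have "a * sum (u (Suc m)) {..Suc m} = b * sum (u m) {..m}" by simp
  then have "sum (u (Suc m)) {..Suc m} = b * sum (u m) {..m} / a"
    using nz by (metis a_def no_zero_divisors nonzero_mult_div_cancel_left)
  then show ?case unfolding u[symmetric] IH
    by (simp add: a_def b_def q_pochhammer_Suc mult_ac)
qed

section \<open>A limiting Bailey pair and Watson's transformation\<close>

text \<open>
  The limit of the classical Bailey pair in which one of its two free parameters tends to infinity;
  the other is \<open>b\<close>, and \<open>c\<close> stands for \<open>a p / b\<close>.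
\<close>

definition bailey_alpha :: "'a::field \<Rightarrow> 'a \<Rightarrow> 'a \<Rightarrow> 'a \<Rightarrow> nat \<Rightarrow> 'a" where
  "bailey_alpha p a b c s = q_pochhammer a p s * q_pochhammer b p s
     / (q_pochhammer p p s * q_pochhammer c p s)
     * ((1 - a * p ^ (2 * s)) / (1 - a)) * p ^ (s * s) * (c / p) ^ s"

lemma bailey_certificate:
  fixes p a b c z w :: "'a::field"
  assumes "p \<noteq> 0" "1 - p * w \<noteq> 0" "1 - a*p*z*z*w \<noteq> 0" "b * c = a * p"
  shows "(1 - p*z*w) * (1 - c*z*w) * ((1 - a*z*z) / ((1 - p*w) * (1 - a*p*z*z*w))) - (1 - a*z*z)
    = - w * ((1 - a*z) * (1 - b*z) * z*z*c) / (1 - a*p*z*z*w) + p*w * ((1 - z) * (1 - c*z/p)) / (1 - p*w)"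
proof -
  have clear: "X * (Y / (D1 * D2)) - Y = - U / D2 + V / D1"
    if "p * (X * Y - Y * (D1 * D2)) = p * (- U) * D1 + p * V * D2" "D1 \<noteq> 0" "D2 \<noteq> 0" for X Y U V D1 D2 :: 'a
  proof -
    have "X * Y - Y * (D1 * D2) = - U * D1 + V * D2"
      using that(1) assms(1) by (metis distrib_left mult.assoc mult_cancel_left)
    then have "X * Y = Y * (D1 * D2) - U * D1 + V * D2" by (simp add: algebra_simps)
    then show ?thesis using that(2,3)
      by (simp only: times_divide_eq_right) (simp add: add_divide_distrib diff_divide_distrib)
  qed
  have V: "p*w * ((1 - z) * (1 - c*z/p)) = w * ((1 - z) * (p - c*z))"
    using assms(1) by (simp add: field_simps)
  have "p * ((1 - p*z*w) * (1 - c*z*w) * (1 - a*z*z) - (1 - a*z*z) * ((1 - p*w) * (1 - a*p*z*z*w)))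
    = p * (- (w * ((1 - a*z) * (1 - b*z) * z*z*c))) * (1 - p*w)
      + p * (w * ((1 - z) * (p - c*z))) * (1 - a*p*z*z*w)"
    using assms(4) by algebra
  from clear[OF this assms(2,3)] show ?thesis unfolding V by simp
qed

text \<open>The right side is the second member of the pair, whose further parameter factors tend to
  1 in the limit. Passing from \<open>r\<close> to \<open>Suc r\<close> divides it by
  \<open>d\<close>, and this recurrence for the sum is again shown by telescoping.\<close>

lemma bailey_pair:
  fixes p a b c :: "'a::field"
  assumes "p \<noteq> 0" "a \<noteq> 1" "b * c = a * p"
    and "q_pochhammer p p r \<noteq> 0" "q_pochhammer c p r \<noteq> 0" "q_pochhammer (a * p) p (r + r) \<noteq> 0"
  shows "(\<Sum>s\<le>r. bailey_alpha p a b c s / (q_pochhammer p p (r - s) * q_pochhammer (a * p) p (r + s)))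
    = 1 / (q_pochhammer p p r * q_pochhammer c p r)"
  using assms(4-6)
proof (induction r)
  case 0
  show ?case using assms(2) by (simp add: bailey_alpha_def)
next
  case (Suc r)
  define K where "K s = q_pochhammer a p s * q_pochhammer b p s
     / (q_pochhammer p p s * q_pochhammer c p s) / (1 - a) * p ^ (s * s) * (c / p) ^ s" for s
  have al: "bailey_alpha p a b c s = (1 - a * p ^ (2 * s)) * K s" for s
    by (simp add: bailey_alpha_def K_def)
  define u where "u r s = bailey_alpha p a b c s / (q_pochhammer p p (r - s) * q_pochhammer (a * p) p (r + s))" for r s
  have nz: "1 - p * p ^ r \<noteq> 0" "1 - c * p ^ r \<noteq> 0" "q_pochhammer p p r \<noteq> 0" "q_pochhammer c p r \<noteq> 0"
    using Suc.prems by (auto simp: q_pochhammer_Suc)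
  have nz2: "q_pochhammer (a * p) p (r + r) \<noteq> 0"
    by (rule q_pochhammer_nonzero_mono[OF Suc.prems(3)]) simp
  have IH: "sum (u r) {..r} = 1 / (q_pochhammer p p r * q_pochhammer c p r)"
    using Suc.IH nz nz2 unfolding u_def by simp
  define d where "d = (1 - p * p ^ r) * (1 - c * p ^ r)"
  define D where "D s = d * u (Suc r) s - (if s \<le> r then u r s else 0)" for s
  \<comment> \<open>Compared with \<open>u (Suc r) s\<close>, the certificate drops the
    very-well-poised factor \<open>1 - a * p ^ (2 * s)\<close>, kept out of \<open>K\<close> for
    this reason, and the last factor of the symbol of length \<open>Suc r + s\<close>.\<close>
  define G where "G s = - (p ^ (Suc r - s) * (1 - p ^ s) * (1 - c * p ^ s / p)) * K s
      / (q_pochhammer p p (Suc r - s) * q_pochhammer (a * p) p (r + s))" for s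
  have "sum D {..Suc r} = 0"
  proof (rule sum_telescope_last[where G = G])
    fix s assume "s \<le> r"
    then obtain l where r: "r = s + l" using le_Suc_ex by blast
    define z w where "z = p ^ s" and "w = p ^ l"
    have "q_pochhammer (a * p) p (Suc (r + s)) \<noteq> 0"
      by (rule q_pochhammer_nonzero_mono[OF Suc.prems(3)]) (use r in simp)
    then have nz': "1 - p * w \<noteq> 0" "1 - p * z \<noteq> 0" "1 - c * z \<noteq> 0" "1 - a*p*z*z*w \<noteq> 0"
      using q_pochhammer_nonzero_mono[OF Suc.prems(1), of "Suc l"]
        q_pochhammer_nonzero_mono[OF Suc.prems(1), of "Suc s"]
        q_pochhammer_nonzero_mono[OF Suc.prems(2), of "Suc s"]
      by (auto simp: r q_pochhammer_Suc z_def w_def power_add mult_ac)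
    define k where "k = K s / (q_pochhammer p p l * q_pochhammer (a * p) p (r + s))"
    have z2: "p ^ (2 * s) = z * z" by (simp add: z_def mult_2 power_add)
    have urs: "u r s = (1 - a*z*z) * k"
      by (simp add: u_def al k_def z2 mult.assoc) (simp add: r)
    have P: "q_pochhammer (a * p) p (Suc (r + s)) = q_pochhammer (a * p) p (r + s) * (1 - a*p*z*z*w)"
      by (simp add: q_pochhammer_Suc r z_def w_def power_add mult_ac)
    have P2: "q_pochhammer p p (Suc r - s) = q_pochhammer p p l * (1 - p * w)"
      by (simp add: r Suc_diff_le q_pochhammer_Suc w_def)
    have u1: "u (Suc r) s = ((1 - a*z*z) / ((1 - p*w) * (1 - a*p*z*z*w))) * k"
      unfolding u_def add_Suc P P2 al k_def z2 by (simp add: mult_ac)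
    have KS: "K (Suc s) = K s * ((1 - a*z) * (1 - b*z) * z*z*c) / ((1 - p * z) * (1 - c * z))"
      using assms(1) by (simp add: K_def q_pochhammer_Suc z_def power_add mult_ac)
    have G1: "G (Suc s) = - w * ((1 - a*z) * (1 - b*z) * z*z*c) / (1 - a*p*z*z*w) * k"
    proof -
      have 1: "c * p ^ Suc s / p = c * z" "p ^ Suc s = p * z" using assms(1) by (simp_all add: z_def)
      have 2: "p ^ l = w" "Suc r - Suc s = l" by (simp_all add: r w_def)
      show ?thesis unfolding G_def add_Suc_right P 1 2 KS k_def using nz'(2,3) assms(1)
        by (simp add: mult_ac)
    qed
    have G0: "G s = - (p*w * ((1 - z) * (1 - c*z/p)) / (1 - p*w)) * k"
      unfolding G_def P2 k_def by (simp add: r Suc_diff_le z_def w_def mult_ac)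
    have d: "d = (1 - p*z*w) * (1 - c*z*w)"
      by (simp add: d_def r z_def w_def power_add mult.assoc)
    have "D s = (d * ((1 - a*z*z) / ((1 - p*w) * (1 - a*p*z*z*w))) - (1 - a*z*z)) * k"
      using \<open>s \<le> r\<close> by (simp only: D_def u1 urs if_True ring_distribs mult.assoc)
    also have "\<dots> = (- w * ((1 - a*z) * (1 - b*z) * z*z*c) / (1 - a*p*z*z*w) + p*w * ((1 - z) * (1 - c*z/p)) / (1 - p*w)) * k"
      unfolding d bailey_certificate[OF assms(1) nz'(1) nz'(4) assms(3)] ..
    also have "\<dots> = G (Suc s) - G s"
      unfolding G1 G0 by (simp only: distrib_right) simp
    finally show "D s = G (Suc s) - G s" .
  next
    show "G 0 = 0" by (simp add: G_def)
    \<comment> \<open>At \<open>s = Suc r\<close> the very-well-poised factor is the last factor of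
      the symbol of length \<open>2 * Suc r\<close> and cancels against it.\<close>
    have "q_pochhammer (a * p) p (Suc (Suc r + r)) \<noteq> 0"
      by (rule q_pochhammer_nonzero_mono[OF Suc.prems(3)]) simp
    moreover have "q_pochhammer (a * p) p (Suc (Suc r + r)) = q_pochhammer (a * p) p (Suc r + r) * (1 - a * p ^ (2 * Suc r))"
      by (simp add: q_pochhammer_Suc mult_2 mult_2_right mult_ac)
    ultimately show "D (Suc r) = - G (Suc r)"
      using assms(1) by (simp add: D_def G_def d_def u_def al)
  qed
  also have "sum D {..Suc r} = d * sum (u (Suc r)) {..Suc r} - sum (u r) {..r}"
    unfolding D_def sum_subtractf sum_distrib_left by simp
  finally have "sum (u (Suc r)) {..Suc r} = sum (u r) {..r} / d"
    using nz by (metis d_def eq_iff_diff_eq_0 no_zero_divisors nonzero_mult_div_cancel_left)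
  then show ?case unfolding u_def[symmetric] IH
    by (simp add: d_def q_pochhammer_Suc mult_ac)
qed

text \<open>
  The factors usually written with base point \<open>p\<close> to the power \<open>- N\<close> appear here as
  symbols of length \<open>N - r\<close>, which keeps all denominators polynomial. Expanding the
  left-hand side by \<open>bailey_pair\<close> and exchanging the sums leaves a q-Saalschuetz sum.
\<close>

lemma watson_transformation:
  fixes p a b c d e g :: "'a::field"
  assumes "p \<noteq> 0" "a \<noteq> 1" "b * c = a * p" "g * d * e = a * p" "d \<noteq> 0" "e \<noteq> 0"
    and nz: "q_pochhammer p p N \<noteq> 0" "q_pochhammer c p N \<noteq> 0" "q_pochhammer (a * p) p (N + N) \<noteq> 0"
      "q_pochhammer (g * d) p N \<noteq> 0" "q_pochhammer (g * e) p N \<noteq> 0"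
  shows "(\<Sum>r\<le>N. q_pochhammer d p r * q_pochhammer e p r * q_pochhammer g p (N - r) * g ^ r
        / (q_pochhammer p p (N - r) * (q_pochhammer p p r * q_pochhammer c p r)))
    = q_pochhammer (g * e) p N * q_pochhammer (g * d) p N *
      (\<Sum>s\<le>N. q_pochhammer d p s * q_pochhammer e p s * g ^ s * bailey_alpha p a b c s
        / (q_pochhammer (g * e) p s * q_pochhammer (g * d) p s
           * (q_pochhammer p p (N - s) * q_pochhammer (a * p) p (N + s))))"
proof -
  let ?w = "\<lambda>r. q_pochhammer d p r * q_pochhammer e p r * q_pochhammer g p (N - r) * g ^ r
        / q_pochhammer p p (N - r)"
  let ?v = "\<lambda>r s. ?w r / (q_pochhammer p p (r - s) * q_pochhammer (a * p) p (r + s))"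
  have inner: "(\<Sum>r = s..N. ?v r s) =
      q_pochhammer (g * e) p N * q_pochhammer (g * d) p N * (q_pochhammer d p s * q_pochhammer e p s * g ^ s
        / (q_pochhammer (g * e) p s * q_pochhammer (g * d) p s
           * (q_pochhammer p p (N - s) * q_pochhammer (a * p) p (N + s))))" if "s \<le> N" for s
  proof -
    define m where "m = N - s"
    have N: "N = s + m" using that by (simp add: m_def)
    define z where "z = p ^ s"
    \<comment> \<open>Shifting the summation by \<open>s\<close> multiplies \<open>d\<close> and
      \<open>e\<close> by \<open>p ^ s\<close> and keeps \<open>g\<close>, so the part of the symbol
      of \<open>a * p\<close> beyond length \<open>2 * s\<close> is the lower symbol of a balanced
      sum again.\<close>
    have gC: "g * (d * z) * (e * z) = a * p * p ^ (s + s)"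
      using assms(4) by (simp add: z_def power_add mult_ac)
    have ap: "q_pochhammer (a * p) p (s + s + j) = q_pochhammer (a * p) p (s + s) * q_pochhammer (g * (d * z) * (e * z)) p j" for j
      unfolding gC by (rule q_pochhammer_add)
    have "q_pochhammer (a * p) p (s + s + m) \<noteq> 0"
      by (rule q_pochhammer_nonzero_mono[OF nz(3)]) (simp add: N)
    then have nzC: "q_pochhammer (g * (d * z) * (e * z)) p m \<noteq> 0" "q_pochhammer (a * p) p (s + s) \<noteq> 0"
      by (auto simp: ap)
    have nzp: "q_pochhammer p p m \<noteq> 0"
      by (rule q_pochhammer_nonzero_mono[OF nz(1)]) (simp add: N)
    have nzs: "q_pochhammer (g * d) p s \<noteq> 0" "q_pochhammer (g * e) p s \<noteq> 0"
      using q_pochhammer_nonzero_mono[OF nz(4), of s] q_pochhammer_nonzero_mono[OF nz(5), of s]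
      by (auto simp: N)
    have "(\<Sum>r = s..N. ?v r s) = (\<Sum>j\<le>m. ?v (s + j) s)"
      by (rule sum.reindex_bij_witness[of _ "\<lambda>j. s + j" "\<lambda>r. r - s"]) (auto simp: N)
    also have "\<dots> = (\<Sum>j\<le>m. q_pochhammer d p s * q_pochhammer e p s * g ^ s / q_pochhammer (a * p) p (s + s) *
        (q_pochhammer (d * z) p j * q_pochhammer (e * z) p j * q_pochhammer g p (m - j) * g ^ j
        / (q_pochhammer p p j * q_pochhammer (g * (d * z) * (e * z)) p j * q_pochhammer p p (m - j))))"
    proof (intro sum.cong refl)
      fix j assume "j \<in> {..m}"
      have i: "s + j + s = s + s + j" by simp
      show "?v (s + j) s = q_pochhammer d p s * q_pochhammer e p s * g ^ s / q_pochhammer (a * p) p (s + s) *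
        (q_pochhammer (d * z) p j * q_pochhammer (e * z) p j * q_pochhammer g p (m - j) * g ^ j
        / (q_pochhammer p p j * q_pochhammer (g * (d * z) * (e * z)) p j * q_pochhammer p p (m - j)))"
        unfolding i ap q_pochhammer_add[of _ _ s j] z_def[symmetric] power_add
        by (simp add: N mult_ac)
    qed
    also have "\<dots> = q_pochhammer d p s * q_pochhammer e p s * g ^ s / q_pochhammer (a * p) p (s + s) *
       (q_pochhammer (g * (e * z)) p m * q_pochhammer (g * (d * z)) p m
        / (q_pochhammer p p m * q_pochhammer (g * (d * z) * (e * z)) p m))"
      unfolding sum_distrib_left[symmetric] q_saalschuetz[OF assms(1) nzp nzC(1)] ..
    also have "\<dots> = q_pochhammer d p s * q_pochhammer e p s * g ^ s *
       (q_pochhammer (g * (e * z)) p m * q_pochhammer (g * (d * z)) p m)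
        / (q_pochhammer p p m * q_pochhammer (a * p) p (s + s + m))"
      by (simp add: ap mult_ac)
    also have "s + s + m = N + s" by (simp add: N)
    also have "q_pochhammer (g * (e * z)) p m = q_pochhammer (g * e) p N / q_pochhammer (g * e) p s"
      using nzs by (simp add: N q_pochhammer_add z_def mult.assoc)
    also have "q_pochhammer (g * (d * z)) p m = q_pochhammer (g * d) p N / q_pochhammer (g * d) p s"
      using nzs by (simp add: N q_pochhammer_add z_def mult.assoc)
    finally show ?thesis by (simp add: m_def mult_ac)
  qed
  have "(\<Sum>r\<le>N. q_pochhammer d p r * q_pochhammer e p r * q_pochhammer g p (N - r) * g ^ r
        / (q_pochhammer p p (N - r) * (q_pochhammer p p r * q_pochhammer c p r)))
      = (\<Sum>r\<le>N. ?w r * (1 / (q_pochhammer p p r * q_pochhammer c p r)))" by simp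
  also have "\<dots> = (\<Sum>r\<le>N. \<Sum>s\<le>r. bailey_alpha p a b c s * ?v r s)"
  proof (intro sum.cong refl)
    fix r assume "r \<in> {..N}"
    then have r: "r \<le> N" by simp
    show "?w r * (1 / (q_pochhammer p p r * q_pochhammer c p r)) = (\<Sum>s\<le>r. bailey_alpha p a b c s * ?v r s)"
    proof -
      have nzr: "q_pochhammer (a * p) p (r + r) \<noteq> 0"
        by (rule q_pochhammer_nonzero_mono[OF nz(3)]) (use r in simp)
      show ?thesis
        unfolding bailey_pair[OF assms(1-3) q_pochhammer_nonzero_mono[OF nz(1) r]
            q_pochhammer_nonzero_mono[OF nz(2) r] nzr, symmetric] sum_distrib_left
        by (intro sum.cong refl) (simp add: mult_ac)
    qed
  qed
  also have "\<dots> = (\<Sum>s\<le>N. \<Sum>r = s..N. bailey_alpha p a b c s * ?v r s)"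
    unfolding sum.Sigma[OF finite_atMost ballI[OF finite_atMost]]
      sum.Sigma[OF finite_atMost ballI[OF finite_atLeastAtMost]]
    by (rule sum.reindex_bij_witness[of _ prod.swap prod.swap]) auto
  also have "\<dots> = (\<Sum>s\<le>N. bailey_alpha p a b c s * (q_pochhammer (g * e) p N * q_pochhammer (g * d) p N * (q_pochhammer d p s * q_pochhammer e p s * g ^ s
        / (q_pochhammer (g * e) p s * q_pochhammer (g * d) p s
           * (q_pochhammer p p (N - s) * q_pochhammer (a * p) p (N + s))))))"
    unfolding sum_distrib_left[symmetric] using inner by (intro sum.cong refl) simp
  finally show ?thesis by (simp add: sum_distrib_left mult_ac)
qed

section \<open>The two specialisations of the transformation\<close>

text \<open>Peeling from the top turns the symbols of length \<open>N - k\<close> in the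
  transformation into one constant symbol of length \<open>N\<close> and a product over
  \<open>i < k\<close>, the shape of the deformed sums.\<close>

lemma q_pochhammer_reverse:
  assumes "k \<le> N"
  shows "q_pochhammer u p N = q_pochhammer u p (N - k) * (\<Prod>i<k. 1 - u * p ^ (N - Suc i))"
  using assms
proof (induction k)
  case (Suc k)
  then have "N - k = Suc (N - Suc k)" by simp
  then show ?case using Suc by (simp add: q_pochhammer_Suc mult_ac)
qed simp

text \<open>
  \<open>wp_sum\<close> is the very-well-poised left-hand sum and \<open>bal_sum\<close> the balanced right-hand sum;
  the parameters \<open>a\<close> and \<open>b\<close> enter through the factors given below, and the sums of the
  theorem are those with \<open>a = b = 1\<close>.
\<close>

definition weight :: "'a::field \<Rightarrow> nat \<Rightarrow> 'a" where
  "weight q k = (1 - q ^ (4 * k + 1)) / (1 - q) * q ^ (k ^ 2 + k) *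
     (\<Prod>i<k. (1 - q ^ (2*i+1)) * (1 + q ^ (2*i+1)) / ((1 - q ^ (2*i+2)) * (1 + q ^ (2*i+2))))"

definition wp_sum :: "'a::field \<Rightarrow> nat \<Rightarrow> (nat \<Rightarrow> 'a) \<Rightarrow> (nat \<Rightarrow> 'a) \<Rightarrow> 'a" where
  "wp_sum q N A B = (\<Sum>k\<le>N. weight q k * (\<Prod>i<k. A i) * (\<Prod>i<k. B i))"

definition bal_sum :: "'a::field \<Rightarrow> nat \<Rightarrow> (nat \<Rightarrow> 'a) \<Rightarrow> (nat \<Rightarrow> 'a) \<Rightarrow> 'a" where
  "bal_sum q N E C = (\<Sum>k\<le>N. q ^ (2*k) / (\<Prod>i<k. (1 - q ^ (2*i+2)) * (1 + q ^ (2*i+2)))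
     * (\<Prod>i<k. E i) * (\<Prod>i<k. C i))"

definition wp_num where "wp_num q a i = (1 - a * q ^ (2*i+1)) * (1 - q ^ (2*i+1) / a)"
definition wp_den where "wp_den q a i = (1 - a * q ^ (2*i+2)) * (1 - q ^ (2*i+2) / a)"
text \<open>The argument of the limiting very-well-poised series contains \<open>1 / b\<close>; it
  is absorbed into the denominator, factor by factor.\<close>

definition wp_single where "wp_single q b i = (1 - b * q ^ (2*i+1)) / (b - q ^ (2*i+2))"
text \<open>With base point \<open>q\<close> and upper parameters \<open>a * q\<close>,
  \<open>q / a\<close>, \<open>b * q\<close>, Watson's lower parameter is their product divided by
  \<open>q\<close>, that is \<open>b * q^2\<close>.\<close>

definition bal_single where "bal_single q b i = (1 - b * q ^ (2*i+1)) / (1 - b * q ^ (2*i+2))"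

lemma prod_odd_powers: "(\<Prod>i<k. q ^ (2*i+1)) = (q :: 'a::comm_monoid_mult) ^ (k ^ 2)"
proof (induction k)
  case (Suc k)
  have "(Suc k)\<^sup>2 = k\<^sup>2 + (2*k+1)" by (simp add: power2_eq_square)
  then show ?case using Suc by (simp only: prod.lessThan_Suc power_add)
qed simp

context
  fixes q :: "'a::field" and N :: nat and x :: 'a
  assumes q0: "q \<noteq> 0" and q_power: "\<And>m. m > 0 \<Longrightarrow> q ^ m \<noteq> 1" and x_def: "x = q ^ (2 * N + 1)"
begin

lemma q_power_minus: "q ^ m \<noteq> - 1" if "m > 0"
proof
  assume "q ^ m = - 1"
  then have "q ^ (m + m) = 1" unfolding power_add by simp
  then show False using q_power[of "m + m"] that by simp
qed

lemma q_power_eq_iff: "q ^ i = q ^ j \<longleftrightarrow> i = j"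
proof (induction i j rule: linorder_wlog)
  case (le i j)
  show ?case
  proof
    assume "q ^ i = q ^ j"
    then have "q ^ i * q ^ (j - i) = q ^ i * 1" using le by (metis le_add_diff_inverse mult.right_neutral power_add)
    then have "q ^ (j - i) = 1" using q0 by simp
    then show "i = j" using q_power[of "j - i"] le by (cases "j - i = 0") auto
  qed simp
qed auto

text \<open>Base \<open>q^2\<close>, base point \<open>q\<close>, free parameter \<open>- q\<close>,
  hence \<open>c = - q^2\<close>: the pair \<open>q\<close>, \<open>- q\<close> makes up
  \<open>(q^2;q^4)_k\<close>, and the pair \<open>q^2\<close>, \<open>- q^2\<close> makes up
  \<open>(q^4;q^4)_k\<close>. The terminating parameter, \<open>q^2\<close> to the power
  \<open>- N\<close>, is \<open>q / x\<close>.\<close>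

lemma watson_q2:
  assumes gde: "g * d * e = q ^ 3" "d \<noteq> 0" "e \<noteq> 0"
    and nz: "q_pochhammer (g * d) (q^2) N \<noteq> 0" "q_pochhammer (g * e) (q^2) N \<noteq> 0"
    "\<And>i. i < N \<Longrightarrow> g * x / (q * q ^ (2*i+2)) \<noteq> 1"
  shows "q_pochhammer g (q^2) N / q_pochhammer (q^2) (q^2) N *
      bal_sum q N (\<lambda>i. (1 - d * q ^ (2*i)) * (1 - e * q ^ (2*i)))
        (\<lambda>i. g / q^2 * (1 - x / q ^ (2*i+1)) / (1 - g * x / (q * q ^ (2*i+2))))
    = q_pochhammer (g * e) (q^2) N * q_pochhammer (g * d) (q^2) N
        / (q_pochhammer (q^2) (q^2) N * q_pochhammer (q^3) (q^2) N) *
      wp_sum q N (\<lambda>i. (1 - d * q ^ (2*i)) * (1 - e * q ^ (2*i)) / ((1 - g * e * q ^ (2*i)) * (1 - g * d * q ^ (2*i))))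
        (\<lambda>i. g / q * (x - q ^ (2*i+1)) / (1 - x * q ^ (2*i+2)))"
proof -
  define p where "p = q ^ 2"
  have pi: "p ^ i = q ^ (2*i)" for i by (simp add: p_def power_mult)
  have qp: "q_pochhammer u p k = (\<Prod>i<k. 1 - u * q ^ (2*i))" for u k
    by (simp add: q_pochhammer_def pi)
  have pq: "p * q ^ (2*i) = q ^ (2*i+2)" "q * q ^ (2*i) = q ^ (2*i+1)" for i
    by (simp_all add: p_def power2_eq_square)
  have ne: "q ^ (2*i+2) \<noteq> 1" "q ^ (2*i+2) \<noteq> - 1" "q ^ (2*i+3) \<noteq> 1" "q ^ 2 * q ^ (2*i) \<noteq> 1"
      "q ^ 2 * q ^ (2*i) \<noteq> -1" "q ^ 3 * q ^ (2*i) \<noteq> 1" for i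
    using q_power[of "2*i+2"] q_power[of "2*i+3"] q_power_minus[of "2*i+2"] by (simp_all flip: power_add add: add_ac)
  have nzp: "q_pochhammer p p k \<noteq> 0" "q_pochhammer (- p) p k \<noteq> 0" "q_pochhammer (q ^ 3) p k \<noteq> 0" for k
    unfolding qp using ne by (auto simp: p_def eq_neg_iff_add_eq_0 add.commute)
  have q3: "q * p = q ^ 3" by (simp add: p_def eval_nat_numeral)
  have q1: "q \<noteq> 1" using q_power[of 1] by simp
  have "p \<noteq> 0" "q \<noteq> 1" "- q * - p = q * p" "g * d * e = q * p" using q0 q1 gde q3 by (simp_all add: p_def)
  note W = watson_transformation[OF this gde(2,3), of N]
  have xy: "p ^ (N - i) = x / q ^ (2*i+1)" if "i \<le> N" for i
  proof -
    have "q ^ (2*(N-i)) * q ^ (2*i+1) = x" unfolding x_def power_add[symmetric] using that by (simp add: algebra_simps)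
    then show ?thesis using q0 by (simp add: pi field_simps)
  qed
  have pN: "q_pochhammer p p N = q_pochhammer p p (N - k) * (\<Prod>i<k. 1 - x / q ^ (2*i+1))" if "k \<le> N" for k
  proof -
    have "p * p ^ (N - Suc i) = x / q ^ (2*i+1)" if "i < k" for i
      using xy[of i] \<open>i < k\<close> \<open>k \<le> N\<close> power_Suc[of p "N - Suc i"] by (simp del: power_Suc add: Suc_diff_Suc)
    then show ?thesis using q_pochhammer_reverse[OF that, of p p] by simp
  qed
  have xy': "p ^ (N - Suc i) = x / (q * q ^ (2*i+2))" if "i < N" for i
    using xy[of "Suc i"] that by (simp add: mult_ac)
  have gN: "q_pochhammer g p N = q_pochhammer g p (N - k) * (\<Prod>i<k. 1 - g * x / (q * q ^ (2*i+2)))" if "k \<le> N" for k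
    unfolding q_pochhammer_reverse[OF that, of g p]
    by (intro arg_cong2[where f = times] prod.cong refl) (use that xy' in simp)
  have q3N: "q_pochhammer (q ^ 3) p (N + k) = q_pochhammer (q ^ 3) p N * (\<Prod>i<k. 1 - x * q ^ (2*i+2))" for k
  proof -
    have "q ^ 3 * p ^ N * p ^ i = x * q ^ (2*i+2)" for i
      unfolding x_def pi mult.assoc power_add[symmetric] by (rule arg_cong[where f = "(^) q"]) simp
    then show ?thesis by (simp add: q_pochhammer_add q_pochhammer_def[of "q ^ 3 * p ^ N"])
  qed
  have bal: "q_pochhammer d p r * q_pochhammer e p r * q_pochhammer g p (N - r) * g ^ r
        / (q_pochhammer p p (N - r) * (q_pochhammer p p r * q_pochhammer (- p) p r))
     = q_pochhammer g p N / q_pochhammer p p N * (q ^ (2*r) / (\<Prod>i<r. (1 - q ^ (2*i+2)) * (1 + q ^ (2*i+2)))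
     * (\<Prod>i<r. (1 - d * q ^ (2*i)) * (1 - e * q ^ (2*i))) * (\<Prod>i<r. g / q^2 * (1 - x / q ^ (2*i+1)) / (1 - g * x / (q * q ^ (2*i+2)))))"
    if r: "r \<le> N" for r
  proof -
    have n1: "(\<Prod>i<r. 1 - x / q ^ (2*i+1)) \<noteq> 0"
      using nzp(1)[of N] pN[OF r] by auto
    have n2: "(\<Prod>i<r. 1 - g * x / (q * q ^ (2*i+2))) \<noteq> 0" using nz(3) r
      by (metis (no_types, lifting) eq_iff_diff_eq_0 finite_lessThan lessThan_iff order_less_le_trans prod_zero_iff)
    have e1: "(\<Prod>i<r. (1 - q ^ (2*i+2)) * (1 + q ^ (2*i+2))) = q_pochhammer p p r * q_pochhammer (- p) p r"
      by (simp only: qp prod.distrib pq mult_minus_left diff_minus_eq_add)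
    have e2: "(\<Prod>i<r. (1 - d * q ^ (2*i)) * (1 - e * q ^ (2*i))) = q_pochhammer d p r * q_pochhammer e p r"
      by (simp add: qp prod.distrib)
    have e3: "(\<Prod>i<r. g / q^2 * (1 - x / q ^ (2*i+1)) / (1 - g * x / (q * q ^ (2*i+2))))
      = g ^ r / q ^ (2*r) * (\<Prod>i<r. 1 - x / q ^ (2*i+1)) / (\<Prod>i<r. 1 - g * x / (q * q ^ (2*i+2)))"
      by (simp add: prod.distrib prod_dividef power_divide power_mult del: power_Suc)
    show ?thesis
      unfolding e1 e2 e3 pN[OF r] gN[OF r] using n1 n2 q0 by (simp add: mult_ac)
  qed
  have wp: "q_pochhammer d p s * q_pochhammer e p s * g ^ s * bailey_alpha p q (- q) (- p) s
        / (q_pochhammer (g * e) p s * q_pochhammer (g * d) p s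
           * (q_pochhammer p p (N - s) * q_pochhammer (q * p) p (N + s)))
    = 1 / (q_pochhammer p p N * q_pochhammer (q^3) p N) * (weight q s
        * (\<Prod>i<s. (1 - d * q ^ (2*i)) * (1 - e * q ^ (2*i)) / ((1 - g * e * q ^ (2*i)) * (1 - g * d * q ^ (2*i))))
        * (\<Prod>i<s. g / q * (x - q ^ (2*i+1)) / (1 - x * q ^ (2*i+2))))"
    if s: "s \<le> N" for s
  proof -
    have n1: "(\<Prod>i<s. 1 - x / q ^ (2*i+1)) \<noteq> 0"
      using nzp(1)[of N] pN[OF s] by auto
    have e1: "(\<Prod>i<s. (1 - d * q ^ (2*i)) * (1 - e * q ^ (2*i)) / ((1 - g * e * q ^ (2*i)) * (1 - g * d * q ^ (2*i))))
      = q_pochhammer d p s * q_pochhammer e p s / (q_pochhammer (g * e) p s * q_pochhammer (g * d) p s)"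
      by (simp add: qp prod.distrib prod_dividef mult.assoc)
    have e2: "(\<Prod>i<s. (1 - q ^ (2*i+1)) * (1 + q ^ (2*i+1)) / ((1 - q ^ (2*i+2)) * (1 + q ^ (2*i+2))))
      = q_pochhammer q p s * q_pochhammer (- q) p s / (q_pochhammer p p s * q_pochhammer (- p) p s)"
      by (simp only: qp prod.distrib prod_dividef pq mult_minus_left diff_minus_eq_add)
    \<comment> \<open>The extracted \<open>q ^ (s^2)\<close> is half of \<open>p ^ (s * s)\<close>
      in \<open>bailey_alpha\<close>; the other half stays in \<open>weight\<close>. The sign
      cancels that of \<open>(c / p) ^ s\<close>.\<close>
    have "(\<Prod>i<s. x - q ^ (2*i+1)) = (\<Prod>i<s. - (q ^ (2*i+1) * (1 - x / q ^ (2*i+1))))"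
      using q0 by (simp add: right_diff_distrib)
    also have "\<dots> = (- 1) ^ s * q ^ (s^2) * (\<Prod>i<s. 1 - x / q ^ (2*i+1))"
      unfolding prod_odd_powers[symmetric]
      by (simp only: prod.distrib prod_uminus card_lessThan mult.assoc)
    finally have e3: "(\<Prod>i<s. g / q * (x - q ^ (2*i+1)) / (1 - x * q ^ (2*i+2)))
      = g ^ s / q ^ s * ((- 1) ^ s * q ^ (s^2) * (\<Prod>i<s. 1 - x / q ^ (2*i+1))) / (\<Prod>i<s. 1 - x * q ^ (2*i+2))"
      by (simp only: prod.distrib prod_dividef prod_constant card_lessThan power_divide)
    have e4: "(- p / p) ^ s = (- 1) ^ s" using q0 by (simp add: p_def)
    have e5: "p ^ (s * s) = q ^ (s^2) * q ^ (s^2)" by (simp add: pi mult_2 power_add power2_eq_square)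
    have e6: "q * p ^ (2 * s) = q ^ (4 * s + 1)" by (simp add: pi)
    have e7: "q ^ (s^2 + s) = q ^ (s^2) * q ^ s" by (simp add: power_add)
    show ?thesis
      unfolding e1 e3 weight_def bailey_alpha_def e2 e4 e5 e6 e7 q3 q3N pN[OF s] using n1 q0
      by (simp add: mult_ac)
  qed
  have "q_pochhammer g p N / q_pochhammer p p N *
      bal_sum q N (\<lambda>i. (1 - d * q ^ (2*i)) * (1 - e * q ^ (2*i)))
        (\<lambda>i. g / q^2 * (1 - x / q ^ (2*i+1)) / (1 - g * x / (q * q ^ (2*i+2))))
    = (\<Sum>r\<le>N. q_pochhammer d p r * q_pochhammer e p r * q_pochhammer g p (N - r) * g ^ r
        / (q_pochhammer p p (N - r) * (q_pochhammer p p r * q_pochhammer (- p) p r)))"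
    unfolding bal_sum_def sum_distrib_left using bal by (intro sum.cong refl) simp
  also have "\<dots> = q_pochhammer (g * e) p N * q_pochhammer (g * d) p N *
      (\<Sum>s\<le>N. q_pochhammer d p s * q_pochhammer e p s * g ^ s * bailey_alpha p q (- q) (- p) s
        / (q_pochhammer (g * e) p s * q_pochhammer (g * d) p s
           * (q_pochhammer p p (N - s) * q_pochhammer (q * p) p (N + s))))"
    by (rule W) (use nzp nzp(3)[folded q3] nz(1,2) in \<open>simp_all add: p_def\<close>)
  also have "\<dots> = q_pochhammer (g * e) p N * q_pochhammer (g * d) p N * (1 / (q_pochhammer p p N * q_pochhammer (q^3) p N) *
      wp_sum q N (\<lambda>i. (1 - d * q ^ (2*i)) * (1 - e * q ^ (2*i)) / ((1 - g * e * q ^ (2*i)) * (1 - g * d * q ^ (2*i))))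
        (\<lambda>i. g / q * (x - q ^ (2*i+1)) / (1 - x * q ^ (2*i+2))))"
    unfolding wp_sum_def sum_distrib_left[of "1 / _"]
    by (intro arg_cong2[where f = times] sum.cong refl wp) simp
  finally show ?thesis unfolding p_def by (simp only: times_divide_eq_left times_divide_eq_right mult.right_neutral mult_1_left)
qed

lemma even_odd_power_simps:
  "(q^2) ^ i = q ^ (2*i)" "q * q ^ (2*i) = q ^ (2*i+1)" "q * q * q ^ (2*i) = q ^ (2*i+2)"
  "q^2 * q ^ (2*i) = q ^ (2*i+2)"
  by (simp_all add: power2_eq_square power_mult)

lemma q_pochhammer_square_eq:
  "q_pochhammer (u * q) (q^2) k = (\<Prod>i<k. 1 - u * q ^ (2*i+1))"
  "q_pochhammer (u * q^2) (q^2) k = (\<Prod>i<k. 1 - u * q ^ (2*i+2))"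
  by (simp_all add: q_pochhammer_def even_odd_power_simps(1) mult.assoc even_odd_power_simps(2,4) del: power_Suc add_2_eq_Suc')

lemma x_neq_even_power: "x \<noteq> q ^ (2*i+2)"
  unfolding x_def q_power_eq_iff by presburger

lemma q_pochhammer_nonzero:
  "q_pochhammer q (q^2) k \<noteq> 0" "q_pochhammer (q^2) (q^2) k \<noteq> 0"
proof -
  have "q ^ (2*i+1) \<noteq> 1" "q ^ (2*i+2) \<noteq> 1" for i
    using q_power[of "2*i+1"] q_power[of "2*i+2"] by simp_all
  then show "q_pochhammer q (q^2) k \<noteq> 0" "q_pochhammer (q^2) (q^2) k \<noteq> 0"
    using q_pochhammer_square_eq[of 1 k] by (simp_all del: power_Suc add_2_eq_Suc')
qed

lemma q_pochhammer_q3: "q_pochhammer (q ^ 3) (q^2) N = q_pochhammer q (q^2) N * ((1 - x) / (1 - q))"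
proof -
  have "q_pochhammer q (q^2) (Suc N) = q_pochhammer q (q^2) N * (1 - x)"
    unfolding q_pochhammer_Suc by (simp add: even_odd_power_simps(1) x_def)
  moreover have "q_pochhammer q (q^2) (1 + N) = (1 - q) * q_pochhammer (q ^ 3) (q^2) N"
    unfolding q_pochhammer_add by (simp add: q_pochhammer_def eval_nat_numeral)
  ultimately have "q_pochhammer (q ^ 3) (q^2) N * (1 - q) = q_pochhammer q (q^2) N * (1 - x)"
    by (simp add: mult.commute)
  then show ?thesis using q_power[of 1] by (simp add: eq_divide_eq)
qed

lemma q_number_nonzero: "(1 - x) / (1 - q) \<noteq> 0"
  using q_power[of 1] q_power[of "2*N+1"] by (simp add: x_def del: power_Suc)

text \<open>With \<open>b = 1 / x\<close> the single factor carries the terminating parameter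
  \<open>q / x\<close>, which leaves \<open>a\<close> free: \<open>d = a * q\<close>,
  \<open>e = q / a\<close>, \<open>g = q\<close>.\<close>

lemma wp_sum_inverse:
  assumes a: "a \<noteq> 0" and den: "\<And>i. i < N \<Longrightarrow> wp_den q a i \<noteq> 0"
  shows "wp_sum q N (\<lambda>i. wp_num q a i / wp_den q a i) (wp_single q (1 / x))
    = (1 - x) / (1 - q) * (\<Prod>i<N. (1 - q ^ (2*i+1)) ^ 2 / wp_den q a i)
      * bal_sum q N (wp_num q a) (bal_single q (1 / x))"
proof -
  have x0: "x \<noteq> 0" using q0 by (simp add: x_def)
  note pi = even_odd_power_simps(1) and qq = even_odd_power_simps(2-4)
  have den_eq: "wp_den q a i = (1 - q * (q / a) * q ^ (2*i)) * (1 - q * (a * q) * q ^ (2*i))" for i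
    unfolding wp_den_def qq(2)[symmetric] by (simp add: mult_ac)
  have num_eq: "wp_num q a i = (1 - a * q * q ^ (2*i)) * (1 - q / a * q ^ (2*i))" for i
    unfolding wp_num_def qq(1)[symmetric] by (simp add: mult_ac)
  have n2: "q_pochhammer (q * (a * q)) (q^2) N \<noteq> 0" "q_pochhammer (q * (q / a)) (q^2) N \<noteq> 0"
    using den unfolding q_pochhammer_def pi den_eq by auto
  have n3: "q * x / (q * q ^ (2*i+2)) \<noteq> 1" for i
    using x_neq_even_power[of i] q0 by (simp del: power_Suc add_2_eq_Suc')
  have gde: "q * (a * q) * (q / a) = q ^ 3" using a by (simp add: eval_nat_numeral)
  have W: "q_pochhammer q (q^2) N / q_pochhammer (q^2) (q^2) N * bal_sum q N (wp_num q a) (bal_single q (1 / x))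
    = q_pochhammer (q * (q / a)) (q^2) N * q_pochhammer (q * (a * q)) (q^2) N
        / (q_pochhammer (q^2) (q^2) N * q_pochhammer (q^3) (q^2) N) *
      wp_sum q N (\<lambda>i. wp_num q a i / wp_den q a i) (wp_single q (1 / x))"
  proof -
    have b: "bal_single q (1 / x) = (\<lambda>i. q / q^2 * (1 - x / q ^ (2*i+1)) / (1 - q * x / (q * q ^ (2*i+2))))"
    proof
      fix i
      define y where "y = q ^ (2*i+1)"
      have y': "q ^ (2*i+2) = q * y" by (simp add: y_def)
      have "y \<noteq> 0" "q * y \<noteq> x" using q0 x_neq_even_power[of i] by (auto simp: y_def)
      then show "bal_single q (1 / x) i = q / q^2 * (1 - x / q ^ (2*i+1)) / (1 - q * x / (q * q ^ (2*i+2)))"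
        unfolding bal_single_def y' y_def[symmetric] using x0 q0
        by (simp add: divide_simps power2_eq_square) (simp add: algebra_simps)?
    qed
    have w: "wp_single q (1 / x) = (\<lambda>i. q / q * (x - q ^ (2*i+1)) / (1 - x * q ^ (2*i+2)))"
      using x0 q0 by (auto simp: wp_single_def fun_eq_iff divide_simps mult_ac)
    show ?thesis unfolding b w num_eq[abs_def] den_eq
      using watson_q2[OF gde _ _ n2 n3] a q0 by simp
  qed
  have solve: "L = c * (X ^ 2 / (Y * Z)) * B" if "X / P * B = Y * Z / (P * (X * c)) * L" "P \<noteq> 0" "X \<noteq> 0" "c \<noteq> 0" "Y \<noteq> 0" "Z \<noteq> 0"
    for L c X Y Z B P :: 'a
    using that by (simp add: field_simps power2_eq_square)
  have prod: "(\<Prod>i<N. (1 - q ^ (2*i+1)) ^ 2 / wp_den q a i)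
      = q_pochhammer q (q^2) N ^ 2 / (q_pochhammer (q * (q / a)) (q^2) N * q_pochhammer (q * (a * q)) (q^2) N)"
    unfolding q_pochhammer_def pi den_eq qq(1) by (simp add: prod_dividef prod.distrib prod_power_distrib)
  show ?thesis
    unfolding prod
    by (rule solve[OF W[unfolded q_pochhammer_q3] q_pochhammer_nonzero(2,1) q_number_nonzero n2(2,1)])
qed

text \<open>Here the terminating parameter \<open>q / x\<close> is one half of the pair belonging to
  \<open>a = x\<close>, so the single factor can keep \<open>b = 1\<close>:
  \<open>d = x * q\<close>, \<open>e = q\<close>, \<open>g = q / x\<close>. Watson's constant then
  collapses to a power of \<open>q\<close>.\<close>

lemma wp_sum_one:
  "wp_sum q N (\<lambda>i. wp_num q x i / wp_den q x i) (wp_single q 1)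
    = (1 - x) / (1 - q) / q ^ N * bal_sum q N (wp_num q x) (bal_single q 1)"
proof -
  have x0: "x \<noteq> 0" using q0 by (simp add: x_def)
  have gd: "q / x * (x * q) = q^2" "q / x * q = 1 / x * q^2" using x0 by (simp_all add: power2_eq_square)
  have gde: "q / x * (x * q) * q = q ^ 3" using x0 by (simp add: eval_nat_numeral)
  have one: "1 - 1 / x * q ^ (2*i+2) \<noteq> 0" for i
    using x_neq_even_power[of i] x0 by (simp del: power_Suc add_2_eq_Suc')
  have n2: "q_pochhammer (1 / x * q^2) (q^2) N \<noteq> 0"
    unfolding q_pochhammer_square_eq prod_zero_iff[OF finite_lessThan] using one by auto
  have n3: "q / x * x / (q * q ^ (2*i+2)) \<noteq> 1" for i
    using x0 q0 q_power[of "2*i+2"] by (simp del: power_Suc add_2_eq_Suc')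
  \<comment> \<open>Since \<open>x = q ^ (2*N+1)\<close>, reversing the index turns the symbols with
    \<open>1 / x\<close> into those without, odd exponents becoming even and conversely.\<close>
  have rev: "q_pochhammer (1 / x * q) (q^2) N * q_pochhammer q (q^2) N * q ^ N
    = q_pochhammer (1 / x * q^2) (q^2) N * q_pochhammer (q^2) (q^2) N"
  proof -
    have y: "1 - 1 / x * q ^ (2*(N - Suc i)+1) = (q ^ (2*i+2) - 1) / q ^ (2*i+2)"
      "1 - 1 / x * q ^ (2*(N - Suc i)+2) = (q ^ (2*i+1) - 1) / q ^ (2*i+1)" if "i < N" for i
    proof -
      have "2*(N - Suc i)+1 + (2*i+2) = 2*N+1" "2*(N - Suc i)+2 + (2*i+1) = 2*N+1"
        using that by simp_all
      then have "q ^ (2*(N - Suc i)+1) * q ^ (2*i+2) = x" "q ^ (2*(N - Suc i)+2) * q ^ (2*i+1) = x"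
        unfolding x_def power_add[symmetric] by (simp_all only:)
      then show "1 - 1 / x * q ^ (2*(N - Suc i)+1) = (q ^ (2*i+2) - 1) / q ^ (2*i+2)"
        "1 - 1 / x * q ^ (2*(N - Suc i)+2) = (q ^ (2*i+1) - 1) / q ^ (2*i+1)"
        using x0 q0 by (simp_all add: divide_simps del: power_Suc add_2_eq_Suc')
          (simp_all add: algebra_simps)?
    qed
    have "q_pochhammer (1 / x * q) (q^2) N = (\<Prod>i<N. (q ^ (2*i+2) - 1) / q ^ (2*i+2))"
      unfolding q_pochhammer_square_eq
      by (subst prod.nat_diff_reindex[symmetric]) (intro prod.cong refl y, simp)
    moreover have "q_pochhammer (1 / x * q^2) (q^2) N = (\<Prod>i<N. (q ^ (2*i+1) - 1) / q ^ (2*i+1))"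
      unfolding q_pochhammer_square_eq
      by (subst prod.nat_diff_reindex[symmetric]) (intro prod.cong refl y, simp)
    moreover have "q_pochhammer q (q^2) N = (\<Prod>i<N. 1 - q ^ (2*i+1))" "q_pochhammer (q^2) (q^2) N = (\<Prod>i<N. 1 - q ^ (2*i+2))"
      using q_pochhammer_square_eq[of 1 N] by simp_all
    moreover have "q ^ N = (\<Prod>i<N. q)" by simp
    ultimately show ?thesis
      using q0 by (simp only: prod.distrib[symmetric])
       (intro prod.cong refl, simp add: divide_simps algebra_simps)
  qed
  have wp: "wp_sum q N (\<lambda>i. (1 - x * q * q ^ (2*i)) * (1 - q * q ^ (2*i)) / ((1 - q / x * q * q ^ (2*i)) * (1 - q / x * (x * q) * q ^ (2*i))))
        (\<lambda>i. q / x / q * (x - q ^ (2*i+1)) / (1 - x * q ^ (2*i+2)))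
      = wp_sum q N (\<lambda>i. wp_num q x i / wp_den q x i) (wp_single q 1)"
  proof -
    have "(1 - x * q * q ^ (2*i)) * (1 - q * q ^ (2*i)) / ((1 - q / x * q * q ^ (2*i)) * (1 - q / x * (x * q) * q ^ (2*i)))
       * (q / x / q * (x - q ^ (2*i+1)) / (1 - x * q ^ (2*i+2)))
      = wp_num q x i / wp_den q x i * wp_single q 1 i" for i
    proof -
    define y where "y = q ^ (2*i+1)"
    have y: "q ^ (2*i+2) = q * y" "q ^ (2*i) = y / q" "q ^ (2*i+1) = y" using q0 by (simp_all add: y_def)
      have e: "q / x / q * (x - y) = 1 - y / x" using q0 x0 by (simp add: diff_divide_distrib)
      show ?thesis unfolding wp_num_def wp_den_def wp_single_def y e using q0 x0 by (simp add: mult_ac)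
    qed
    then show ?thesis unfolding wp_sum_def mult.assoc[of "weight q _"] prod.distrib[symmetric] by simp
  qed
  have bal: "bal_sum q N (\<lambda>i. (1 - x * q * q ^ (2*i)) * (1 - q * q ^ (2*i)))
        (\<lambda>i. q / x / q^2 * (1 - x / q ^ (2*i+1)) / (1 - q / x * x / (q * q ^ (2*i+2))))
      = bal_sum q N (wp_num q x) (bal_single q 1)"
  proof -
    have "(1 - x * q * q ^ (2*i)) * (1 - q * q ^ (2*i))
       * (q / x / q^2 * (1 - x / q ^ (2*i+1)) / (1 - q / x * x / (q * q ^ (2*i+2))))
      = wp_num q x i * bal_single q 1 i" for i
    proof -
    define y where "y = q ^ (2*i+1)"
    have y: "q ^ (2*i+2) = q * y" "q ^ (2*i) = y / q" "q ^ (2*i+1) = y" using q0 by (simp_all add: y_def)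
    have "y \<noteq> 0" "q * y \<noteq> 1" using q0 q_power[of "2*i+2"] by (simp_all add: y_def)
    then have "1 / x / q * (1 - x / y) / (1 - 1 / (q * y)) = (1 - y / x) / (1 - q * y)"
      using q0 x0 by (simp add: divide_simps) (simp add: algebra_simps)?
    then show ?thesis
      unfolding wp_num_def bal_single_def y using q0 x0
      by (simp add: power2_eq_square mult_ac)
    qed
    then show ?thesis
      unfolding bal_sum_def mult.assoc[of "_ / prod _ _"] prod.distrib[symmetric] by simp
  qed
  have W: "q_pochhammer (1 / x * q) (q^2) N / q_pochhammer (q^2) (q^2) N * bal_sum q N (wp_num q x) (bal_single q 1)
    = q_pochhammer (1 / x * q^2) (q^2) N * q_pochhammer (q^2) (q^2) N
        / (q_pochhammer (q^2) (q^2) N * q_pochhammer (q^3) (q^2) N) *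
      wp_sum q N (\<lambda>i. wp_num q x i / wp_den q x i) (wp_single q 1)"
  proof -
    have "x * q \<noteq> 0" "q_pochhammer (q / x * (x * q)) (q^2) N \<noteq> 0" "q_pochhammer (q / x * q) (q^2) N \<noteq> 0"
      unfolding gd using x0 q0 q_pochhammer_nonzero(2) n2 by simp_all
    from watson_q2[OF gde this(1) q0 this(2,3) n3] show ?thesis
      unfolding bal wp unfolding gd by simp
  qed
  have solve: "L = c / qN * B" if "X / P * B = Y * P / (P * (Z * c)) * L" "X * Z * qN = Y * P" "P \<noteq> 0" "Z \<noteq> 0" "c \<noteq> 0" "Y \<noteq> 0" "qN \<noteq> 0"
    for L c X Y Z B P qN :: 'a
  proof -
    have X: "X = Y * P / (Z * qN)" using that(2,4,7) by (simp add: eq_divide_eq mult.assoc)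
    have "L = (X / P * B) * (P * (Z * c)) / (Y * P)" unfolding that(1) using that(3-) by simp
    also have "\<dots> = c / qN * B" unfolding X using that(3-) by simp
    finally show ?thesis .
  qed
  show ?thesis
    by (rule solve[OF W[unfolded q_pochhammer_q3] rev q_pochhammer_nonzero(2,1) q_number_nonzero n2]) (use q0 in simp)
qed

end

section \<open>Identities at a root of unity\<close>

text \<open>The full sum equals its own negative, hence is zero; so the first \<open>N - k\<close>
  terms give minus the last \<open>k\<close>, which are in turn minus the first
  \<open>k\<close>.\<close>

lemma sum_antisymmetric_reflect:
  fixes g :: "nat \<Rightarrow> complex"
  assumes "\<And>i. i < N \<Longrightarrow> g (N - Suc i) = - g i" and "k \<le> N"
  shows "(\<Sum>i<N-k. g i) = (\<Sum>i<k. g i)"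
proof -
  have refl: "(\<Sum>i<N-k. g i) + (\<Sum>i<k. g (N - Suc i)) = sum g {..<N}" if "k \<le> N" for k
    using that
  proof (induction k)
    case (Suc k)
    then have "N - k = Suc (N - Suc k)" by simp
    then show ?case using Suc by (simp add: add_ac)
  qed simp
  have "sum g {..<N} = - sum g {..<N}"
    by (subst sum.nat_diff_reindex[symmetric]) (simp add: assms(1) sum_negf)
  then have "sum g {..<N} = 0" by simp
  moreover have "(\<Sum>i<k. g (N - Suc i)) = - (\<Sum>i<k. g i)"
    using assms by (simp add: sum_negf)
  ultimately show ?thesis using refl[OF assms(2)] by simp
qed

text \<open>Dropping the factor at \<open>N - Suc i\<close> from the full product amounts to
  multiplying by \<open>c\<close> times its mirror image \<open>r i\<close>.\<close>

lemma prod_reflect: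
  fixes r :: "nat \<Rightarrow> 'a::field"
  assumes "\<And>i. i < N \<Longrightarrow> r i * r (N - Suc i) * c = 1" and "k \<le> N"
  shows "(\<Prod>i<N-k. r i) = (\<Prod>i<N. r i) * c ^ k * (\<Prod>i<k. r i)"
  using assms(2)
proof (induction k)
  case (Suc k)
  then have "N - k = Suc (N - Suc k)" by simp
  then have "(\<Prod>i<N - Suc k. r i) * r (N - Suc k) = (\<Prod>i<N. r i) * c ^ k * (\<Prod>i<k. r i)"
    using Suc by simp
  then have "(\<Prod>i<N - Suc k. r i) * (r k * r (N - Suc k) * c) = (\<Prod>i<N. r i) * c ^ Suc k * (\<Prod>i<Suc k. r i)"
    by (simp add: mult_ac)
  then show ?case using assms(1)[of k] Suc.prems by simp
qed simp

lemma sum_antisymmetric_zero: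
  fixes F :: "nat \<Rightarrow> complex"
  assumes "\<And>k. k \<le> N \<Longrightarrow> F (N - k) = - F k"
  shows "(\<Sum>k\<le>N. F k) = 0"
proof -
  have "(\<Sum>k\<le>N. F k) = (\<Sum>k\<le>N. F (N - k))"
    by (rule sum.reindex_bij_witness[of _ "\<lambda>k. N - k" "\<lambda>k. N - k"]) auto
  also have "\<dots> = - (\<Sum>k\<le>N. F k)" using assms by (simp add: sum_negf)
  finally show ?thesis by simp
qed

lemma power_power_commute: "((a :: 'a::monoid_mult) ^ m) ^ k = (a ^ k) ^ m"
  by (metis mult.commute power_mult)

lemma prod_even_powers: "(\<Prod>i<k. q ^ (2*i+2)) = (q :: 'a::comm_monoid_mult) ^ (k ^ 2 + k)"
proof (induction k)
  case (Suc k)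
  have "(Suc k)\<^sup>2 + Suc k = k\<^sup>2 + k + (2*k+2)" by (simp add: power2_eq_square)
  then show ?case using Suc by (simp only: prod.lessThan_Suc power_add)
qed simp

text \<open>This is \<open>1 - z\<close> times the value at \<open>q = z\<close> of the
  \<open>k\<close>-th left-hand summand, for \<open>k\<close> below the order of
  \<open>z\<close>.\<close>

definition root_term :: "complex \<Rightarrow> nat \<Rightarrow> complex" where
  "root_term z k = (1 - z ^ (4*k+1)) * z ^ (k^2 + k) *
     (\<Prod>i<k. ((1 - z ^ (2*i+1)) / (1 - z ^ (2*i+2))) ^ 4 * ((1 + z ^ (2*i+1)) / (1 + z ^ (2*i+2))))"

context
  fixes z :: complex and N :: nat
  assumes z_power: "z ^ (2*N+1) = 1" and z_prim: "\<And>m. 0 < m \<Longrightarrow> m < 2*N+1 \<Longrightarrow> z ^ m \<noteq> 1"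
begin

lemma z_nonzero: "z \<noteq> 0"
  using z_power by auto

lemma z_power_eq_1_iff: "z ^ m = 1 \<longleftrightarrow> (2*N+1) dvd m"
proof -
  have "z ^ m = z ^ ((2*N+1) * (m div (2*N+1)) + m mod (2*N+1))"
    by (simp only: mult_div_mod_eq)
  also have "\<dots> = z ^ (m mod (2*N+1))" by (subst power_add, subst power_mult, subst z_power) simp
  finally have "z ^ m = z ^ (m mod (2*N+1))" .
  moreover have "m mod (2*N+1) < 2*N+1" by simp
  ultimately show ?thesis using z_prim[of "m mod (2*N+1)"]
    by (metis bot_nat_0.not_eq_extremum dvd_eq_mod_eq_0 power_0)
qed

lemma z_power_minus: "z ^ m \<noteq> - 1"
proof
  assume "z ^ m = - 1"
  then have "(z ^ m) ^ (2*N+1) = - 1" by simp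
  moreover have "(z ^ m) ^ (2*N+1) = (z ^ (2*N+1)) ^ m" by (rule power_power_commute)
  ultimately show False unfolding z_power by simp
qed

lemma z_odd_even_nonzero:
  assumes "i < N"
  shows "1 - z ^ (2*i+1) \<noteq> 0" "1 - z ^ (2*i+2) \<noteq> 0" "1 + z ^ (2*i+1) \<noteq> 0" "1 + z ^ (2*i+2) \<noteq> 0"
  using z_prim[of "2*i+1"] z_prim[of "2*i+2"] assms z_power_minus[of "2*i+1"] z_power_minus[of "2*i+2"]
  by (auto simp: eq_neg_iff_add_eq_0 add.commute)

lemma z_reflect:
  assumes "i < N"
  shows "z ^ (2*(N - Suc i)+1) = 1 / z ^ (2*i+2)" "z ^ (2*(N - Suc i)+2) = 1 / z ^ (2*i+1)"
proof -
  have "2*(N - Suc i)+1 + (2*i+2) = 2*N+1" "2*(N - Suc i)+2 + (2*i+1) = 2*N+1"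
    using assms by simp_all
  then have "z ^ (2*(N - Suc i)+1) * z ^ (2*i+2) = 1" "z ^ (2*(N - Suc i)+2) * z ^ (2*i+1) = 1"
    unfolding power_add[symmetric] using z_power by (simp_all only:)
  then show "z ^ (2*(N - Suc i)+1) = 1 / z ^ (2*i+2)" "z ^ (2*(N - Suc i)+2) = 1 / z ^ (2*i+1)"
    using z_nonzero by (simp_all only: nonzero_eq_divide_eq power_not_zero not_False_eq_True)
qed

lemma prod_ratio_minus:
  "(\<Prod>i<N. (1 - z ^ (2*i+1)) / (1 - z ^ (2*i+2))) * z ^ (N^2 + N) = (-1) ^ N"
proof -
  have "(\<Prod>i<N. 1 - z ^ (2*i+1)) = (\<Prod>i<N. 1 - z ^ (2*(N - Suc i)+1))"
    by (rule prod.nat_diff_reindex[symmetric])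
  also have "\<dots> = (\<Prod>i<N. - ((1 - z ^ (2*i+2)) / z ^ (2*i+2)))"
    using z_nonzero by (intro prod.cong refl) (simp only: z_reflect lessThan_iff, simp add: diff_divide_distrib)
  also have "\<dots> = (-1) ^ N * ((\<Prod>i<N. 1 - z ^ (2*i+2)) / z ^ (N^2 + N))"
    by (simp only: prod_uminus card_lessThan prod_dividef prod_even_powers)
  finally show ?thesis using z_odd_even_nonzero(2) z_nonzero unfolding prod_dividef by simp
qed

lemma prod_ratio_plus:
  "(\<Prod>i<N. (1 + z ^ (2*i+1)) / (1 + z ^ (2*i+2))) * z ^ (N^2 + N) = 1"
proof -
  have "(\<Prod>i<N. 1 + z ^ (2*i+1)) = (\<Prod>i<N. 1 + z ^ (2*(N - Suc i)+1))"
    by (rule prod.nat_diff_reindex[symmetric])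
  also have "\<dots> = (\<Prod>i<N. (1 + z ^ (2*i+2)) / z ^ (2*i+2))"
    using z_nonzero by (intro prod.cong refl) (simp only: z_reflect lessThan_iff, simp add: add_divide_distrib)
  also have "\<dots> = (\<Prod>i<N. 1 + z ^ (2*i+2)) / z ^ (N^2 + N)"
    by (simp only: prod_dividef prod_even_powers)
  finally show ?thesis using z_odd_even_nonzero(4) z_nonzero unfolding prod_dividef by simp
qed

text \<open>Squaring removes the sign in \<open>prod_ratio_minus\<close>, and
  \<open>2 * (N^2 + N)\<close> is \<open>N\<close> modulo \<open>2*N+1\<close>. Besides fixing the
  total product in the next reflection, this is why Watson's two constants agree at \<open>z\<close>
  when \<open>a = 1\<close>.\<close>

lemma prod_ratio_square:
  "(\<Prod>i<N. (1 - z ^ (2*i+1)) / (1 - z ^ (2*i+2))) ^ 2 * z ^ N = 1"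
proof -
  have "z ^ (N^2 + N) * z ^ (N^2 + N) = z ^ ((2*N+1) * N + N)"
    unfolding power_add[symmetric] by (rule arg_cong[where f = "(^) z"]) (simp add: power2_eq_square algebra_simps)
  also have "\<dots> = z ^ N" by (subst power_add, subst power_mult, subst z_power) simp
  finally have "z ^ N = z ^ (N^2 + N) * z ^ (N^2 + N)" by simp
  then have "(\<Prod>i<N. (1 - z ^ (2*i+1)) / (1 - z ^ (2*i+2))) ^ 2 * z ^ N
     = ((\<Prod>i<N. (1 - z ^ (2*i+1)) / (1 - z ^ (2*i+2))) * z ^ (N^2 + N)) ^ 2"
    by (simp only: power2_eq_square mult_ac)
  also have "\<dots> = 1" unfolding prod_ratio_minus by (simp flip: power_mult)
  finally show ?thesis .
qed

text \<open>Mirror factors of the product multiply to \<open>z\<close> to the power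
  \<open>- 4\<close>, and the whole product over \<open>i < N\<close> is \<open>z\<close>. As
  \<open>z ^ (4*N+2) = 1\<close>, these powers turn \<open>1 - z ^ (4*(N-k)+1)\<close> into minus
  \<open>1 - z ^ (4*k+1)\<close>.\<close>

lemma root_term_reflect:
  assumes k: "k \<le> N"
  shows "root_term z (N - k) = - root_term z k"
proof -
  define r where "r i = ((1 - z ^ (2*i+1)) / (1 - z ^ (2*i+2))) ^ 4 * ((1 + z ^ (2*i+1)) / (1 + z ^ (2*i+2))) * z ^ (2*i+2)" for i
  have s: "root_term z k = (1 - z ^ (4*k+1)) * (\<Prod>i<k. r i)" for k
    unfolding root_term_def r_def prod.distrib prod_even_powers[symmetric] by (simp add: mult_ac)
  have rr: "r i * r (N - Suc i) * z ^ 4 = 1" if "i < N" for i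
  proof -
    define y where "y = z ^ (2*i+1)"
    have y': "z ^ (2*i+2) = z * y" by (simp add: y_def)
    have nz: "y \<noteq> 0" "1 - y \<noteq> 0" "1 - z * y \<noteq> 0" "1 + y \<noteq> 0" "1 + z * y \<noteq> 0" "z \<noteq> 0"
      using z_odd_even_nonzero[OF that] z_nonzero unfolding y' y_def[symmetric] by (auto simp: y_def)
    have e': "1 - 1 / (z * y) = - ((1 - z * y) / (z * y))" "1 - 1 / y = - ((1 - y) / y)"
        "1 + 1 / (z * y) = (1 + z * y) / (z * y)" "1 + 1 / y = (1 + y) / y"
      using nz(1,6) by (simp_all add: diff_divide_distrib add_divide_distrib)
    have cancel: "(A / (z * y)) / (B / y) = A / (B * z)" for A B using nz(1) by (simp add: mult.commute)
    have minus_cancel: "- a / - b = a / b" for a b :: complex by simp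
    have e: "(1 - 1 / (z * y)) / (1 - 1 / y) = (1 - z * y) / ((1 - y) * z)"
      "(1 + 1 / (z * y)) / (1 + 1 / y) = (1 + z * y) / ((1 + y) * z)"
      unfolding e' minus_cancel by (rule cancel)+
    show ?thesis unfolding r_def z_reflect[OF that] y' y_def[symmetric] e
      using nz by (simp add: power_mult_distrib power_divide eval_nat_numeral)
  qed
  have tot: "(\<Prod>i<N. r i) * z ^ (2*N) = 1"
  proof -
    define a b c where "a = (\<Prod>i<N. (1 - z ^ (2*i+1)) / (1 - z ^ (2*i+2)))"
      and "b = (\<Prod>i<N. (1 + z ^ (2*i+1)) / (1 + z ^ (2*i+2)))" and "c = z ^ (N^2 + N)"
    have R: "(\<Prod>i<N. r i) = a ^ 4 * b * c"
      unfolding r_def prod.distrib prod_even_powers a_def b_def c_def by (simp add: prod_power_distrib)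
    have bc: "b * c = 1" using prod_ratio_plus by (simp only: b_def c_def)
    have az: "a ^ 2 * z ^ N = 1" using prod_ratio_square by (simp only: a_def)
    have "(\<Prod>i<N. r i) * z ^ (2*N) = (a ^ 2 * z ^ N) ^ 2 * (b * c)"
      unfolding R by (simp add: power_mult_distrib mult_ac flip: power_mult)
    then show ?thesis unfolding bc az by simp
  qed
  have P: "(\<Prod>i<N-k. r i) = (\<Prod>i<N. r i) * (z ^ 4) ^ k * (\<Prod>i<k. r i)"
    by (rule prod_reflect) (simp_all only: rr k)
  have "z ^ (4 * (N - k) + 1) * (z ^ 4) ^ k * z = z ^ (2 * (2 * N + 1))"
    unfolding power_mult[symmetric] power_add[symmetric] power_Suc2[symmetric]
    by (rule arg_cong[where f = "(^) z"]) (use k in simp)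
  also have "\<dots> = 1" by (subst power_mult, subst power_power_commute, subst z_power) simp
  finally have "z ^ (4 * (N - k) + 1) * (z ^ 4) ^ k * z = 1" .
  moreover have "z ^ (2*N) * z = 1" using z_power by (simp add: mult.commute)
  then have "(\<Prod>i<N. r i) = z" using tot z_nonzero
    by (metis mult.commute mult_cancel_left mult_eq_0_iff zero_neq_one)
  ultimately have "(1 - z ^ (4 * (N - k) + 1)) * ((\<Prod>i<N. r i) * (z ^ 4) ^ k) = - (1 - z ^ (4*k+1))"
    by (simp add: algebra_simps flip: power_mult)
  then show ?thesis unfolding s P by (metis mult.assoc mult_minus_left)
qed

end

text \<open>A finite Fourier expansion: at nontrivial \<open>n\<close>-th roots of unity
  \<open>y / (1 - y)^2\<close> becomes a polynomial in \<open>y\<close>, so sums of it over such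
  roots reduce to geometric sums.\<close>

lemma root_of_unity_reciprocal_square:
  fixes y :: complex
  assumes "y ^ n = 1" "y \<noteq> 1"
  shows "(\<Sum>k<n. of_nat k * (of_nat n - of_nat k) * y ^ k) = 2 * of_nat n * (y / (1 - y)\<^sup>2)"
proof -
  \<comment> \<open>antidifference of the summand, up to a factor\<close>
  define H where "H m = y ^ m * ((1 - y)\<^sup>2 * of_nat m ^ 2 + (2 * y - of_nat n * (1 - y)) * (1 - y) * of_nat m
      + y * ((1 - y) * (1 - of_nat n) + 2 * y))" for m
  have partial: "(1 - y) ^ 3 * (\<Sum>k<m. of_nat k * (of_nat n - of_nat k) * y ^ k) = H m - H 0" for m
  proof (induction m)
    case (Suc m)
    have "H (Suc m) - H m = (1 - y) ^ 3 * (of_nat m * (of_nat n - of_nat m) * y ^ m)"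
      unfolding H_def power_Suc of_nat_Suc by algebra
    then show ?case using Suc by (simp add: algebra_simps)
  qed simp
  have "H n - H 0 = 2 * y * of_nat n * (1 - y)"
    unfolding H_def assms(1) by (simp add: power2_eq_square algebra_simps)
  with partial[of n] have "(1 - y) ^ 3 * (\<Sum>k<n. of_nat k * (of_nat n - of_nat k) * y ^ k) = 2 * y * of_nat n * (1 - y)"
    by simp
  moreover have "1 - y \<noteq> 0" using assms(2) by simp
  moreover have "S = 2 * of_nat n * (y / u\<^sup>2)" if "u ^ 3 * S = 2 * y * of_nat n * u" "u \<noteq> 0" for u S
    using that by (simp add: field_simps power2_eq_square power3_eq_cube)
  ultimately show ?thesis by blast
qed

text \<open>After the expansion above and an exchange of sums, each \<open>k\<close> with
  \<open>0 < k < n\<close> meets the sum of the \<open>k\<close>-th powers of the nontrivial roots,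
  which is \<open>- 1\<close>, while \<open>k = 0\<close> has weight zero.\<close>

lemma sum_reciprocal_squares:
  fixes w :: complex
  assumes "w ^ n = 1" "\<And>m. 0 < m \<Longrightarrow> m < n \<Longrightarrow> w ^ m \<noteq> 1" "n > 0"
  shows "(\<Sum>j=1..<n. w ^ j / (1 - w ^ j)\<^sup>2) = - ((of_nat n ^ 2 - 1) / 12)"
proof -
  have geo: "(\<Sum>j=1..<n. (w ^ j) ^ k) = - 1" if "0 < k" "k < n" for k
  proof -
    have "(\<Sum>j<n. (w ^ k) ^ j) = ((w ^ k) ^ n - 1) / (w ^ k - 1)"
      by (rule geometric_sum) (use assms(2) that in auto)
    also have "(w ^ k) ^ n = 1" using assms(1) by (subst power_power_commute) simp
    finally have "(\<Sum>j<n. (w ^ k) ^ j) = 0" by simp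
    moreover have "{..<n} = insert 0 {1..<n}" using assms(3) by auto
    ultimately show ?thesis
      by (simp add: add_eq_0_iff mult.commute flip: power_mult)
  qed
  have sq: "(\<Sum>k<m. of_nat k * (of_nat n - of_nat k)) = (of_nat n * of_nat m * (of_nat m - 1) / 2
      - of_nat m * (of_nat m - 1) * (2 * of_nat m - 1) / 6 :: complex)" for m
    by (induction m) (simp_all add: field_simps)
  have "2 * of_nat n * (\<Sum>j=1..<n. w ^ j / (1 - w ^ j)\<^sup>2) = (\<Sum>j=1..<n. \<Sum>k<n. of_nat k * (of_nat n - of_nat k) * (w ^ j) ^ k)"
    unfolding sum_distrib_left
  proof (intro sum.cong refl, subst root_of_unity_reciprocal_square)
    fix j assume "j \<in> {1..<n}"
    then show "w ^ j \<noteq> 1" using assms(2) by simp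
    show "(w ^ j) ^ n = 1" using assms(1) by (subst power_power_commute) simp
  qed simp
  also have "\<dots> = (\<Sum>k<n. of_nat k * (of_nat n - of_nat k) * (\<Sum>j=1..<n. (w ^ j) ^ k))"
    unfolding sum_distrib_left by (rule sum.swap)
  also have "\<dots> = (\<Sum>k<n. - (of_nat k * (of_nat n - of_nat k)))"
    using geo by (intro sum.cong refl) (case_tac "x = 0", simp_all)
  also have "\<dots> = 2 * of_nat n * (- ((of_nat n ^ 2 - 1) / 12))"
    unfolding sum_negf sq by (simp add: field_simps power2_eq_square power3_eq_cube)
  finally have *: "2 * of_nat n * (\<Sum>j=1..<n. w ^ j / (1 - w ^ j)\<^sup>2) = 2 * of_nat n * (- ((of_nat n ^ 2 - 1) / 12))" .
  have "2 * of_nat n \<noteq> (0 :: complex)" using assms(3) by simp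
  from mult_left_cancel[OF this, THEN iffD1, OF *] show ?thesis .
qed

text \<open>The order is odd, so \<open>z^2\<close> is primitive as well, and the exponents
  \<open>2, 4, ..., 2*N\<close> pick one root out of each inverse pair. The summand is invariant
  under inversion, so half of the full sum remains and \<open>12\<close> becomes
  \<open>24\<close>.\<close>

lemma sum_even_reciprocal_squares:
  fixes z :: complex
  assumes "z ^ (2*N+1) = 1" and "\<And>m. 0 < m \<Longrightarrow> m < 2*N+1 \<Longrightarrow> z ^ m \<noteq> 1"
  shows "(\<Sum>i<N. z ^ (2*i+2) / (1 - z ^ (2*i+2))\<^sup>2) = - ((of_nat (2*N+1) ^ 2 - 1) / 24)"
proof -
  define n where "n = 2*N+1"
  define w where "w = z ^ 2"
  define h where "h j = w ^ j / (1 - w ^ j)\<^sup>2" for j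
  have w: "w ^ n = 1" using assms(1)
    unfolding w_def n_def by (subst power_power_commute, subst assms(1)) simp
  have w': "w ^ m \<noteq> 1" if "0 < m" "m < n" for m
  proof
    assume "w ^ m = 1"
    then have "n dvd 2 * m" using z_power_eq_1_iff[OF assms] by (simp add: w_def n_def flip: power_mult)
    moreover have "coprime n 2" by (simp add: n_def)
    ultimately have "n dvd m" by (simp add: coprime_dvd_mult_right_iff)
    then show False using that by (auto dest: dvd_imp_le)
  qed
  have w0: "w \<noteq> 0" using z_nonzero[OF assms] by (simp add: w_def)
  have refl: "h (n - j) = h j" if "j < n" for j
  proof -
    have "w ^ (n - j) * w ^ j = 1" using w that by (simp flip: power_add)
    then have e: "w ^ (n - j) = 1 / w ^ j" using w0 by (simp add: nonzero_eq_divide_eq)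
    have "1 - 1 / w ^ j = - ((1 - w ^ j) / w ^ j)" using w0 by (simp add: diff_divide_distrib)
    then have "(1 - 1 / w ^ j)\<^sup>2 = (1 - w ^ j)\<^sup>2 / (w ^ j)\<^sup>2" by (simp add: power_divide)
    then show ?thesis unfolding h_def e using w0 by (simp add: power2_eq_square)
  qed
  have "{1..<n} = {1..<N+1} \<union> {N+1..<n}" by (auto simp: n_def)
  then have "sum h {1..<n} = sum h {1..<N+1} + sum h {N+1..<n}"
    by (simp add: sum.union_disjoint)
  also have "sum h {N+1..<n} = (\<Sum>j\<in>{1..<N+1}. h (n - j))"
    by (rule sum.reindex_bij_witness[of _ "\<lambda>j. n - j" "\<lambda>j. n - j"]) (auto simp: n_def)
  also have "\<dots> = sum h {1..<N+1}" by (intro sum.cong refl refl) (auto simp: n_def)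
  finally have "sum h {1..<N+1} = sum h {1..<n} / 2" by simp
  moreover have "sum h {1..<N+1} = (\<Sum>i<N. z ^ (2*i+2) / (1 - z ^ (2*i+2))\<^sup>2)"
  proof -
    have "sum h {1..<N+1} = (\<Sum>i<N. h (Suc i))"
      using sum.atLeast_Suc_lessThan_Suc_shift[of h 0 N] by (simp add: lessThan_atLeast0)
    moreover have "h (Suc i) = z ^ (2*i+2) / (1 - z ^ (2*i+2))\<^sup>2" for i
      unfolding h_def w_def power_mult[symmetric] by simp
    ultimately show ?thesis by (simp only:)
  qed
  moreover have "sum h {1..<n} = - ((of_nat n ^ 2 - 1) / 12)"
    unfolding h_def by (rule sum_reciprocal_squares[OF w w']) (simp_all add: n_def)
  ultimately have "(\<Sum>i<N. z ^ (2*i+2) / (1 - z ^ (2*i+2))\<^sup>2) = - ((of_nat n ^ 2 - 1) / 12) / 2"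
    by (simp only:)
  then show ?thesis unfolding n_def by (simp only: minus_divide_left[symmetric] divide_divide_eq_left) simp
qed

section \<open>Rational functions regular at a root of unity\<close>

abbreviation cpoly :: "rat poly \<Rightarrow> complex poly" where "cpoly \<equiv> map_poly of_rat"

lemma cpoly_diff: "cpoly (p - q) = cpoly p - cpoly q"
  by (intro poly_eqI) (simp add: coeff_map_poly of_rat_diff)

lemma cpoly_uminus: "cpoly (- p) = - cpoly p"
  by (intro poly_eqI) (simp add: coeff_map_poly of_rat_minus)

lemma cpoly_1 [simp]: "cpoly 1 = 1"
  by (simp add: one_pCons map_poly_pCons)

lemma cpoly_power: "cpoly (p ^ k) = cpoly p ^ k"
  by (induction k) (simp_all add: map_poly_of_rat_mult)

lemmas cpoly_simps = map_poly_of_rat_add map_poly_of_rat_mult cpoly_diff cpoly_uminus cpoly_power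

lemma cpoly_X [simp]: "cpoly [:0, 1:] = [:0, 1:]"
  by (simp add: map_poly_pCons)

lemma linear_power_dvd_cancel:
  fixes p d :: "'a::idom poly"
  assumes "[:- z, 1:] ^ e dvd p * d" and "poly d z \<noteq> 0"
  shows "[:- z, 1:] ^ e dvd p"
proof (cases "p = 0")
  case False
  have "d \<noteq> 0" using assms(2) by auto
  with False have "order z (p * d) = order z p"
    using assms(2) by (simp add: order_mult order_0I)
  then show ?thesis using assms(1) False \<open>d \<noteq> 0\<close> by (simp add: order_divides)
qed simp

lemma prod_linear_power_dvd:
  fixes p :: "'a::idom poly"
  assumes "finite Z" and "\<And>z. z \<in> Z \<Longrightarrow> [:- z, 1:] ^ e z dvd p"
  shows "(\<Prod>z\<in>Z. [:- z, 1:] ^ e z) dvd p"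
  using assms
proof (induction Z)
  case (insert z Z)
  then obtain r where r: "p = (\<Prod>z\<in>Z. [:- z, 1:] ^ e z) * r" by (auto elim: dvdE)
  have "poly (\<Prod>z\<in>Z. [:- z, 1:] ^ e z) z \<noteq> 0"
    using insert.hyps by (auto simp: poly_prod poly_power)
  moreover have "[:- z, 1:] ^ e z dvd r * (\<Prod>z\<in>Z. [:- z, 1:] ^ e z)"
    using insert.prems by (simp add: r mult.commute)
  ultimately have "[:- z, 1:] ^ e z dvd r" by (rule linear_power_dvd_cancel[rotated])
  then show ?case using insert.hyps by (simp add: r mult.commute mult_dvd_mono)
qed simp

text \<open>Rational division with remainder survives the embedding of coefficients, and a remainder
  divisible by the divisor vanishes by degree. This brings divisibility found at complex roots back
  to rational polynomials.\<close>

lemma cpoly_dvd_iff: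
  assumes "cpoly p dvd cpoly q"
  shows "p dvd q"
proof (cases "p = 0")
  case True
  then have "cpoly q = cpoly 0" using assms by simp
  then show ?thesis using True map_poly_of_rat_inj by fastforce
next
  case False
  have "cpoly q = cpoly (p * (q div p)) + cpoly (q mod p)"
    unfolding map_poly_of_rat_add[symmetric] by simp
  then have dvd: "cpoly p dvd cpoly (q mod p)"
    using assms by (metis dvd_add_right_iff dvd_triv_left map_poly_of_rat_mult)
  have deg: "degree (cpoly r) = degree r" for r by (rule degree_map_poly) simp
  have "q mod p = 0"
  proof (rule ccontr)
    assume nz: "q mod p \<noteq> 0"
    then have "cpoly (q mod p) \<noteq> 0" using map_poly_of_rat_inj[of "q mod p" 0] by auto
    then have "degree p \<le> degree (q mod p)" using dvd_imp_degree_le[OF dvd] by (simp add: deg)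
    moreover have "degree (q mod p) < degree p" using degree_mod_less[OF False, of q] nz by simp
    ultimately show False by simp
  qed
  then show ?thesis by auto
qed

text \<open>\<open>rval z f c\<close>: the rational function \<open>f\<close> has no pole at \<open>z\<close> and takes the value \<open>c\<close> there.\<close>

definition rval :: "complex \<Rightarrow> rat poly fract \<Rightarrow> complex \<Rightarrow> bool" where
  "rval z f c \<longleftrightarrow> (\<exists>p d. f * to_fract d = to_fract p \<and> poly (cpoly d) z \<noteq> 0
     \<and> poly (cpoly p) z = c * poly (cpoly d) z)"

definition regular :: "complex \<Rightarrow> rat poly fract \<Rightarrow> bool" where
  "regular z f \<longleftrightarrow> (\<exists>c. rval z f c)"

lemma regularI: "rval z f c \<Longrightarrow> regular z f"
  by (auto simp: regular_def)

lemma regularE: "regular z f \<Longrightarrow> (\<And>c. rval z f c \<Longrightarrow> thesis) \<Longrightarrow> thesis"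
  by (auto simp: regular_def)

lemma rval_to_fract: "rval z (to_fract p) (poly (cpoly p) z)"
  unfolding rval_def by (rule exI[of _ p], rule exI[of _ 1]) simp

lemma rval_0: "rval z 0 0" and rval_1: "rval z 1 1"
  using rval_to_fract[of z 0] rval_to_fract[of z 1] by simp_all

lemma rval_qvar: "rval z qvar z"
  using rval_to_fract[of z "[:0, 1:]"] by (simp add: qvar_def)

lemma rval_mult:
  assumes "rval z f a" "rval z g b"
  shows "rval z (f * g) (a * b)"
proof -
  obtain p d p' d' where f: "f * to_fract d = to_fract p" and g: "g * to_fract d' = to_fract p'"
    and val: "poly (cpoly d) z \<noteq> 0" "poly (cpoly p) z = a * poly (cpoly d) z"
      "poly (cpoly d') z \<noteq> 0" "poly (cpoly p') z = b * poly (cpoly d') z"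
    using assms unfolding rval_def by blast
  have "f * g * to_fract (d * d') = (f * to_fract d) * (g * to_fract d')" by simp
  also have "\<dots> = to_fract (p * p')" unfolding f g by simp
  finally show ?thesis unfolding rval_def using val
    by (intro exI[of _ "p * p'"] exI[of _ "d * d'"]) (simp add: cpoly_simps)
qed

lemma rval_add:
  assumes "rval z f a" "rval z g b"
  shows "rval z (f + g) (a + b)"
proof -
  obtain p d p' d' where f: "f * to_fract d = to_fract p" and g: "g * to_fract d' = to_fract p'"
    and val: "poly (cpoly d) z \<noteq> 0" "poly (cpoly p) z = a * poly (cpoly d) z"
      "poly (cpoly d') z \<noteq> 0" "poly (cpoly p') z = b * poly (cpoly d') z"
    using assms unfolding rval_def by blast
  have "(f + g) * to_fract (d * d') = (f * to_fract d) * to_fract d' + (g * to_fract d') * to_fract d"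
    by (simp add: algebra_simps)
  also have "\<dots> = to_fract (p * d' + p' * d)" unfolding f g by simp
  finally show ?thesis unfolding rval_def using val
    by (intro exI[of _ "p * d' + p' * d"] exI[of _ "d * d'"]) (simp add: cpoly_simps distrib_right)
qed

lemma rval_uminus: "rval z f a \<Longrightarrow> rval z (- f) (- a)"
  using rval_mult[OF rval_to_fract[of z "-1"], of f a] by (simp add: cpoly_uminus)

lemma rval_diff: "rval z f a \<Longrightarrow> rval z g b \<Longrightarrow> rval z (f - g) (a - b)"
  using rval_add[OF _ rval_uminus] by fastforce

lemma rval_power: "rval z f a \<Longrightarrow> rval z (f ^ k) (a ^ k)"
  by (induction k) (auto intro: rval_mult rval_1)

lemma rval_of_nat: "rval z (of_nat k) (of_nat k)"
  by (induction k) (auto intro: rval_add rval_0 rval_1)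

lemma rval_numeral: "rval z (numeral k) (numeral k)"
  using rval_of_nat[of z "numeral k"] by simp

lemma rval_inverse:
  assumes "rval z f a" "a \<noteq> 0"
  shows "rval z (inverse f) (inverse a)"
proof -
  obtain p d where pd: "f * to_fract d = to_fract p" "poly (cpoly d) z \<noteq> 0"
    "poly (cpoly p) z = a * poly (cpoly d) z"
    using assms unfolding rval_def by blast
  then have "p \<noteq> 0" using assms(2) by auto
  then have "f \<noteq> 0" using pd(1) by auto
  then have "inverse f * to_fract p = to_fract d" by (simp flip: pd(1))
  then show ?thesis unfolding rval_def using pd assms(2)
    by (intro exI[of _ d] exI[of _ p]) simp
qed

lemma rval_divide:
  assumes "rval z f a" "rval z g b" "b \<noteq> 0"
  shows "rval z (f / g) (a / b)"
  using rval_mult[OF assms(1) rval_inverse[OF assms(2,3)]] by (simp add: divide_inverse)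

lemma rval_sum:
  assumes "\<And>i. i \<in> A \<Longrightarrow> rval z (f i) (a i)"
  shows "rval z (sum f A) (sum a A)"
  using assms by (induction A rule: infinite_finite_induct) (auto intro: rval_add rval_0)

lemma rval_prod:
  assumes "\<And>i. i \<in> A \<Longrightarrow> rval z (f i) (a i)"
  shows "rval z (prod f A) (prod a A)"
  using assms by (induction A rule: infinite_finite_induct) (auto intro: rval_mult rval_1)

lemmas rval_intros = rval_add rval_mult rval_diff rval_uminus rval_power rval_of_nat rval_numeral
  rval_0 rval_1 rval_qvar rval_divide

lemma regular_closed:
  "regular z f \<Longrightarrow> regular z g \<Longrightarrow> regular z (f + g)"
  "regular z f \<Longrightarrow> regular z g \<Longrightarrow> regular z (f - g)"
  "regular z f \<Longrightarrow> regular z g \<Longrightarrow> regular z (f * g)"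
  "regular z f \<Longrightarrow> regular z (- f)"
  "regular z f \<Longrightarrow> regular z (f ^ k)"
  "regular z 0" "regular z 1" "regular z qvar" "regular z (of_nat k)" "regular z (numeral w)"
  unfolding regular_def by (blast intro: rval_intros)+

lemma regular_sum: "(\<And>i. i \<in> A \<Longrightarrow> regular z (f i)) \<Longrightarrow> regular z (sum f A)"
  by (induction A rule: infinite_finite_induct) (auto intro: regular_closed)

lemma regular_prod: "(\<And>i. i \<in> A \<Longrightarrow> regular z (f i)) \<Longrightarrow> regular z (prod f A)"
  by (induction A rule: infinite_finite_induct) (auto intro: regular_closed)

lemma to_fract_power: "to_fract (p ^ k) = to_fract p ^ k"
  by (induction k) simp_all

lemma qvar_power: "qvar ^ n = to_fract ([:0, 1:] ^ n)"
  by (simp only: qvar_def to_fract_power)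

lemma qvar_power_neq_1:
  assumes "n > 0"
  shows "qvar ^ n \<noteq> 1"
proof
  assume "qvar ^ n = 1"
  then have "[:0, 1 :: rat:] ^ n = 1" unfolding qvar_power by (metis to_fract_1 to_fract_eq_iff)
  then have "poly ([:0, 1 :: rat:] ^ n) 0 = 1" by simp
  then show False using assms by (simp add: poly_power power_0_left)
qed

lemma qvar_nonzero: "qvar \<noteq> 0"
  by (simp add: qvar_def)

text \<open>
  The zero of \<open>1 - q ^ n\<close> at \<open>z\<close> is simple, but \<open>z\<close> is not rational, so the common factor to be
  cancelled is the greatest common divisor of \<open>1 - q ^ n\<close> and the numerator.
\<close>

lemma regular_divide_root:
  assumes "rval z f 0" and "z ^ n = 1" and "n > 0"
  shows "regular z (f / (1 - qvar ^ n))"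
proof -
  obtain p d where pd: "f * to_fract d = to_fract p" "poly (cpoly d) z \<noteq> 0"
    "poly (cpoly p) z = 0"
    using assms(1) unfolding rval_def by auto
  define P where "P = (1 - [:0, 1:] ^ n :: rat poly)"
  have P: "to_fract P = 1 - qvar ^ n" by (simp add: P_def qvar_power)
  define g where "g = gcd p P"
  obtain p' where p': "p = g * p'" unfolding g_def by (meson dvdE gcd_dvd1)
  obtain h where h: "P = g * h" unfolding g_def by (meson dvdE gcd_dvd2)
  have cP: "cpoly P = 1 - monom 1 n"
    by (simp add: P_def cpoly_simps monom_altdef)
  have "g = fst (bezout_coefficients p P) * p + snd (bezout_coefficients p P) * P"
    unfolding g_def by (rule bezout_coefficients_fst_snd[symmetric])
  then have "cpoly g = cpoly (fst (bezout_coefficients p P)) * cpoly p + cpoly (snd (bezout_coefficients p P)) * cpoly P"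
    by (metis map_poly_of_rat_add map_poly_of_rat_mult)
  then have g0: "poly (cpoly g) z = 0"
    using pd(3) assms(2) by (simp add: cP poly_monom)
  have z0: "z \<noteq> 0" using assms(2,3) by (auto simp: power_0_left)
  have "pderiv (cpoly P) = - monom (of_nat n) (n - 1)"
    unfolding cP by (simp add: pderiv_diff pderiv_monom)
  then have "poly (pderiv (cpoly P)) z \<noteq> 0" using z0 assms(3) by (simp add: poly_monom)
  then have h0: "poly (cpoly h) z \<noteq> 0"
    unfolding h map_poly_of_rat_mult pderiv_mult using g0 by auto
  have P0: "to_fract P \<noteq> 0" unfolding P using qvar_power_neq_1[OF assms(3)] by simp
  have "f / (1 - qvar ^ n) * to_fract (d * h) = to_fract p'"
  proof -
    have "f / (1 - qvar ^ n) * to_fract (d * h) = (f * to_fract d) * to_fract h / to_fract P"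
      by (simp add: P)
    also have "\<dots> = to_fract p'" using P0 unfolding pd(1) p' h by (simp add: field_simps)
    finally show ?thesis .
  qed
  then have "rval z (f / (1 - qvar ^ n)) (poly (cpoly p') z / poly (cpoly (d * h)) z)"
    unfolding rval_def using pd(2) h0
    by (intro exI[of _ p'] exI[of _ "d * h"]) (simp add: cpoly_simps)
  then show ?thesis by (rule regularI)
qed

section \<open>From regularity at roots of unity to polynomial divisibility\<close>

lemma regular_divide_power_imp_dvd:
  assumes "regular z (f / (1 - qvar ^ n) ^ e)" and "z ^ n = 1" and "n > 0"
  shows "[:- z, 1:] ^ e dvd cpoly (fst (quot_of_fract f))"
proof -
  obtain p d where pd: "f / (1 - qvar ^ n) ^ e * to_fract d = to_fract p" "poly (cpoly d) z \<noteq> 0"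
    using assms(1) unfolding rval_def regular_def by auto
  define P where "P = (1 - [:0, 1:] ^ n :: rat poly)"
  have P: "to_fract P = 1 - qvar ^ n" by (simp add: P_def qvar_power)
  have P0: "1 - qvar ^ n \<noteq> 0" using qvar_power_neq_1[OF assms(3)] by simp
  define a b where "a = fst (quot_of_fract f)" and "b = snd (quot_of_fract f)"
  have f: "f = to_fract a / to_fract b" and b0: "to_fract b \<noteq> 0"
    by (simp_all add: a_def b_def flip: Fract_conv_to_fract)
  have "f * to_fract d = to_fract p * (1 - qvar ^ n) ^ e"
    using pd(1) P0 by (simp add: field_simps)
  then have "to_fract (a * d) = to_fract (P ^ e * (p * b))"
    using b0 by (simp add: f P to_fract_power field_simps)
  then have "a * d = P ^ e * (p * b)" by (simp only: to_fract_eq_iff)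
  then have "cpoly a * cpoly d = cpoly P ^ e * cpoly (p * b)"
    by (metis map_poly_of_rat_mult cpoly_power)
  moreover have "[:- z, 1:] dvd cpoly P"
    using assms(2) by (simp add: P_def cpoly_simps poly_eq_0_iff_dvd[symmetric] poly_power)
  ultimately have "[:- z, 1:] ^ e dvd cpoly a * cpoly d"
    by (simp add: dvd_power_same)
  then show ?thesis unfolding a_def[symmetric] using pd(2) by (rule linear_power_dvd_cancel)
qed

lemma prod_roots_unity:
  assumes "n > 0"
  shows "(\<Prod>z | z ^ n = 1. [:- z, 1:]) = (monom 1 n - 1 :: complex poly)"
proof -
  have "(\<Prod>z | z ^ n = 1. [:- z, 1:]) dvd (monom 1 n - 1 :: complex poly)"
    using prod_linear_power_dvd[of "{z. z ^ n = 1}" "\<lambda>_. 1" "monom 1 n - 1 :: complex poly"] assms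
    by (simp add: finite_roots_unity poly_eq_0_iff_dvd[symmetric] poly_monom)
  then obtain r where r: "monom 1 n - 1 = (\<Prod>z | z ^ n = 1. [:- z, 1:]) * (r :: complex poly)" by (elim dvdE)
  have deg: "degree (monom 1 n - 1 :: complex poly) = n"
    using assms by (subst diff_conv_add_uminus, subst degree_add_eq_left) (auto simp: degree_monom_eq)
  have lc: "lead_coeff (monom 1 n - 1 :: complex poly) = 1" using assms by (simp add: deg)
  have nz: "monom 1 n - 1 \<noteq> (0 :: complex poly)" using lc by force
  have degp: "degree (\<Prod>z | z ^ n = 1. [:- z, 1 :: complex:]) = n"
    using assms by (subst degree_prod_sum_eq) (auto simp: card_roots_unity_eq)
  have "degree r = 0" using nz deg degp unfolding r by (subst (asm) degree_mult_eq) auto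
  then obtain c where c: "r = [:c:]" by (elim degree_eq_zeroE)
  have "lead_coeff (\<Prod>z | z ^ n = 1. [:- z, 1 :: complex:]) = 1"
    by (simp add: lead_coeff_prod)
  then have "c = 1" using lc unfolding r lead_coeff_mult c by simp
  then show ?thesis using r c by simp
qed

text \<open>Over the complex numbers the modulus splits into linear factors, with multiplicity
  \<open>k + 1\<close> at the primitive \<open>n\<close>-th roots and \<open>1\<close> at the others
  except \<open>1\<close>; divisibility is tested one root at a time.\<close>

lemma ratfun_cong_if_regular:
  assumes "n > 1"
    and prim: "\<And>z. primitive_root_unity n z \<Longrightarrow> regular z ((A - B) / (1 - qvar ^ n) ^ (k + 1))"
    and nonprim: "\<And>z. z ^ n = 1 \<Longrightarrow> z \<noteq> 1 \<Longrightarrow> \<not> primitive_root_unity n z \<Longrightarrow> regular z ((A - B) / (1 - qvar ^ n))"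
  shows "ratfun_cong A B (q_number [:0, 1:] n * cyclotomic n ^ k)"
proof -
  define Z where "Z = {z :: complex. z ^ n = 1 \<and> z \<noteq> 1}"
  have Zfin: "finite Z" using finite_roots_unity[of n, where 'a = complex] assms(1)
    by (auto simp: Z_def elim!: rev_finite_subset)
  have primZ: "{z. primitive_root_unity n z} \<subseteq> Z"
    using assms(1) by (auto simp: Z_def primitive_root_unity_def)
  define e where "e z = (if primitive_root_unity n z then k + 1 else 1)" for z
  \<comment> \<open>Restoring the root \<open>1\<close>, which \<open>[n]\<close> lacks, allows
    comparison with the factorisation of \<open>X ^ n - 1\<close>; the extra factor is cancelled
    afterwards.\<close>
  have "cpoly (q_number [:0, 1:] n) * [:- 1, 1:] = (\<Prod>z\<in>Z. [:- z, 1:]) * [:- 1, 1:]"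
  proof -
    have "q_number [:0, 1 :: rat:] n * (1 - [:0, 1:]) = 1 - [:0, 1:] ^ n"
      by (subst q_number_eq_sum) (simp_all add: one_pCons one_diff_power_eq[of "[:0, 1 :: rat:]" n, simplified one_pCons] mult.commute)
    then have "cpoly (q_number [:0, 1 :: rat:] n) * (1 - [:0, 1:]) = 1 - [:0, 1:] ^ n"
      by (metis cpoly_diff cpoly_1 cpoly_power cpoly_X map_poly_of_rat_mult)
    moreover have lin: "[:- 1, 1 :: complex:] = - (1 - [:0, 1:])" by (simp add: one_pCons)
    ultimately have "cpoly (q_number [:0, 1 :: rat:] n) * [:- 1, 1:] = monom 1 n - 1"
      unfolding lin mult_minus_right by (simp add: monom_altdef)
    also have "\<dots> = (\<Prod>z\<in>insert 1 Z. [:- z, 1:])"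
      unfolding prod_roots_unity[symmetric, OF order.strict_trans[OF zero_less_one assms(1)]]
      by (rule prod.cong) (auto simp: Z_def)
    also have "\<dots> = (\<Prod>z\<in>Z. [:- z, 1:]) * [:- 1, 1:]"
      using Zfin by (subst prod.insert) (auto simp: Z_def)
    finally show ?thesis .
  qed
  moreover have "[:- 1, 1 :: complex:] \<noteq> 0" by simp
  ultimately have "cpoly (q_number [:0, 1:] n) = (\<Prod>z\<in>Z. [:- z, 1:])"
    by (simp only: mult_cancel_right simp_thms)
  then have "cpoly (q_number [:0, 1:] n * cyclotomic n ^ k) = (\<Prod>z\<in>Z. [:- z, 1:]) * (\<Prod>z | primitive_root_unity n z. [:- z, 1:]) ^ k"
    using assms(1) by (simp add: cpoly_simps map_poly_cyclotomic)
  also have "(\<Prod>z | primitive_root_unity n z. [:- z, 1:]) ^ k = (\<Prod>z\<in>Z. if primitive_root_unity n z then [:- z, 1:] ^ k else 1)"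
    unfolding prod_power_distrib
    by (subst prod.inter_filter[symmetric, OF Zfin]) (rule prod.cong, use primZ in auto)
  also have "(\<Prod>z\<in>Z. [:- z, 1:]) * \<dots> = (\<Prod>z\<in>Z. [:- z, 1:] ^ e z)"
    unfolding prod.distrib[symmetric] by (intro prod.cong refl) (simp add: e_def)
  also have "\<dots> dvd cpoly (fst (quot_of_fract (A - B)))"
  proof (rule prod_linear_power_dvd[OF Zfin])
    fix z assume "z \<in> Z"
    then have z: "z ^ n = 1" "z \<noteq> 1" by (auto simp: Z_def)
    show "[:- z, 1:] ^ e z dvd cpoly (fst (quot_of_fract (A - B)))"
    proof (rule regular_divide_power_imp_dvd[OF _ z(1)])
      show "regular z ((A - B) / (1 - qvar ^ n) ^ e z)"
        using prim nonprim z by (auto simp: e_def)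
    qed (use assms(1) in simp)
  qed
  finally show ?thesis unfolding ratfun_cong_def by (rule cpoly_dvd_iff)
qed

section \<open>The sums at a root of unity\<close>

lemma rval_cong: "rval z f a \<Longrightarrow> a = b \<Longrightarrow> rval z f b"
  by simp

text \<open>A product rule: \<open>f i\<close> and \<open>g i\<close> share the value
  \<open>c i\<close>, and \<open>s i\<close> acts as the logarithmic derivative in the direction
  \<open>\<delta>\<close>.\<close>

lemma rval_prod_difference:
  fixes k :: nat
  assumes "\<And>i. i < k \<Longrightarrow> rval z (f i) (c i)" and "\<And>i. i < k \<Longrightarrow> rval z (g i) (c i)"
    and "\<And>i. i < k \<Longrightarrow> rval z ((f i - g i) / \<delta>) (c i * s i)"
  shows "rval z (((\<Prod>i<k. f i) - (\<Prod>i<k. g i)) / \<delta>) ((\<Prod>i<k. c i) * (\<Sum>i<k. s i))"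
  using assms
proof (induction k)
  case 0
  show ?case by (simp add: rval_0)
next
  case (Suc k)
  let ?F = "\<Prod>i<k. f i" and ?G = "\<Prod>i<k. g i" and ?C = "\<Prod>i<k. c i" and ?S = "\<Sum>i<k. s i"
  have "rval z ((?F - ?G) / \<delta> * f k + ?G * ((f k - g k) / \<delta>)) (?C * ?S * c k + ?C * (c k * s k))"
    by (intro rval_add rval_mult Suc.IH rval_prod) (use Suc.prems in auto)
  moreover have "(?F - ?G) / \<delta> * f k + ?G * ((f k - g k) / \<delta>) = (?F * f k - ?G * g k) / \<delta>"
    by (simp add: diff_divide_distrib algebra_simps)
  ultimately show ?case by (simp add: algebra_simps)
qed

definition ratio :: "nat \<Rightarrow> rat poly fract" where
  "ratio i = (1 - qvar ^ (2*i+1)) / (1 - qvar ^ (2*i+2))"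

definition ratio_plus :: "nat \<Rightarrow> rat poly fract" where
  "ratio_plus i = (1 + qvar ^ (2*i+1)) / (1 + qvar ^ (2*i+2))"

definition wp_term :: "nat \<Rightarrow> rat poly fract" where
  "wp_term k = weight qvar k * (\<Prod>i<k. wp_num qvar 1 i / wp_den qvar 1 i) * (\<Prod>i<k. wp_single qvar 1 i)"

text \<open>\<open>(q^2;q^4)_k\<close> splits into \<open>(q;q^2)_k\<close> and
  \<open>(- q;q^2)_k\<close>, which raises the visible third power to a fourth; this causes the
  fourfold zeros of the summands beyond \<open>N\<close>.\<close>

lemma wp_term_altdef:
  "wp_term k = (1 - qvar ^ (4*k+1)) / (1 - qvar) * qvar ^ (k^2 + k) * (\<Prod>i<k. ratio i) ^ 4 * (\<Prod>i<k. ratio_plus i)"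
proof -
  have "(\<Prod>i<k. (1 - qvar ^ (2*i+1)) * (1 + qvar ^ (2*i+1)) / ((1 - qvar ^ (2*i+2)) * (1 + qvar ^ (2*i+2))))
      = (\<Prod>i<k. ratio i) * (\<Prod>i<k. ratio_plus i)"
    unfolding ratio_def ratio_plus_def prod.distrib[symmetric] by simp
  moreover have "(\<Prod>i<k. wp_num qvar 1 i / wp_den qvar 1 i) = (\<Prod>i<k. ratio i) ^ 2"
    unfolding ratio_def wp_num_def wp_den_def prod_power_distrib by (simp add: power2_eq_square)
  moreover have "(\<Prod>i<k. wp_single qvar 1 i) = (\<Prod>i<k. ratio i)"
    unfolding ratio_def wp_single_def by simp
  ultimately show ?thesis unfolding wp_term_def weight_def by (simp add: eval_nat_numeral mult_ac)
qed

lemma sum_lessThan_add: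
  fixes f :: "nat \<Rightarrow> 'a::comm_monoid_add"
  shows "sum f {..<a + b} = sum f {..<a} + (\<Sum>v<b. f (a + v))"
  by (induction b) (simp_all add: add.assoc)

lemma prod_lessThan_add:
  fixes f :: "nat \<Rightarrow> 'a::comm_monoid_mult"
  shows "prod f {..<a + b} = prod f {..<a} * (\<Prod>v<b. f (a + v))"
  by (induction b) (simp_all add: mult.assoc)

lemma rval_nonzero: "rval z f c \<Longrightarrow> c \<noteq> 0 \<Longrightarrow> f \<noteq> 0"
  unfolding rval_def by auto

text \<open>Numerator and denominator are affine in \<open>t\<close>, so the division by
  \<open>t\<close> can be carried out exactly and the quotient evaluated where \<open>t\<close>
  vanishes. The next two lemmas do the same with \<open>1 - x\<close>.\<close>

lemma wp_ratio_difference: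
  fixes t u v :: "'a::field"
  assumes "(1 - v)^2 - v*t \<noteq> 0" "1 - v \<noteq> 0" "t \<noteq> 0"
  shows "(((1 - u)^2 - u*t) / ((1 - v)^2 - v*t) - (1 - u)^2 / (1 - v)^2) / t
    = (v*(1 - u)^2 - u*(1 - v)^2) / (((1 - v)^2 - v*t) * (1 - v)^2)"
proof -
  define D where "D = (1 - v)^2 - v*t"
  define E where "E = (1 - v)^2"
  have "((1 - u)^2 - u*t) * E - (1 - u)^2 * D = (v*(1 - u)^2 - u*E) * t"
    unfolding D_def E_def by algebra
  moreover have "D \<noteq> 0" "E \<noteq> 0" using assms by (simp_all add: D_def E_def)
  ultimately have "((1 - u)^2 - u*t) / D - (1 - u)^2 / E = (v*(1 - u)^2 - u*E) * t / (D * E)"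
    by (simp add: diff_frac_eq)
  then show ?thesis using assms(3) unfolding D_def E_def by simp
qed

lemma wp_single_difference:
  fixes x u v :: "'a::field"
  assumes "x \<noteq> 0" "1 - x*v \<noteq> 0" "1 - v \<noteq> 0" "1 - x \<noteq> 0"
  shows "((1 - 1/x*u) / (1/x - v) - (1 - 1*u) / (1 - v)) / (1 - x) = - (1 - u*v) / ((1 - x*v) * (1 - v))"
proof -
  have "(1 - 1/x*u) / (1/x - v) = (x - u) / (1 - x*v)"
    using assms(1) by (simp add: divide_simps mult.commute)
  moreover have "(x - u) * (1 - v) - (1 - u) * (1 - x*v) = - (1 - u*v) * (1 - x)" by algebra
  ultimately have "(1 - 1/x*u) / (1/x - v) - (1 - 1*u) / (1 - v) = - (1 - u*v) * (1 - x) / ((1 - x*v) * (1 - v))"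
    using assms(2,3) by (simp add: diff_frac_eq)
  then show ?thesis using assms(4) by simp
qed

lemma bal_single_difference:
  fixes x u v :: "'a::field"
  assumes "x \<noteq> 0" "x - v \<noteq> 0" "1 - v \<noteq> 0" "1 - x \<noteq> 0"
  shows "((1 - 1/x*u) / (1 - 1/x*v) - (1 - 1*u) / (1 - 1*v)) / (1 - x) = (v - u) / ((x - v) * (1 - v))"
proof -
  have "(1 - 1/x*u) / (1 - 1/x*v) = (x - u) / (x - v)"
    using assms(1) by (simp add: divide_simps mult.commute)
  moreover have "(x - u) * (1 - v) - (1 - u) * (x - v) = (v - u) * (1 - x)" by algebra
  ultimately have "(1 - 1/x*u) / (1 - 1/x*v) - (1 - 1*u) / (1 - 1*v) = (v - u) * (1 - x) / ((x - v) * (1 - v))"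
    using assms(2,3) by (simp add: diff_frac_eq)
  then show ?thesis using assms(4) by simp
qed

lemma mixed_difference:
  fixes w :: "'a::comm_ring_1"
  shows "w * a' * b' - w * a * b' - w * a' * b + w * a * b = w * (a' - a) * (b' - b)"
  by (simp add: algebra_simps)

text \<open>The parameters \<open>a\<close> and \<open>b\<close> act on separate factors of each
  summand, so a second difference is a product of two first differences, whose orders of vanishing
  add up.\<close>

lemma wp_sum_mixed_difference:
  "wp_sum q N A' B' - wp_sum q N A B' - wp_sum q N A' B + wp_sum q N A B
    = (\<Sum>k\<le>N. weight q k * ((\<Prod>i<k. A' i) - (\<Prod>i<k. A i)) * ((\<Prod>i<k. B' i) - (\<Prod>i<k. B i)))"
  unfolding wp_sum_def sum_subtractf[symmetric] sum.distrib[symmetric] mixed_difference ..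

lemma bal_sum_mixed_difference:
  "bal_sum q N A' B' - bal_sum q N A B' - bal_sum q N A' B + bal_sum q N A B
    = (\<Sum>k\<le>N. q ^ (2*k) / (\<Prod>i<k. (1 - q ^ (2*i+2)) * (1 + q ^ (2*i+2))) * ((\<Prod>i<k. A' i) - (\<Prod>i<k. A i)) * ((\<Prod>i<k. B' i) - (\<Prod>i<k. B i)))"
  unfolding bal_sum_def sum_subtractf[symmetric] sum.distrib[symmetric] mixed_difference ..

lemma bal_sum_difference:
  "bal_sum q N A' B - bal_sum q N A B
    = (\<Sum>k\<le>N. q ^ (2*k) / (\<Prod>i<k. (1 - q ^ (2*i+2)) * (1 + q ^ (2*i+2))) * ((\<Prod>i<k. A' i) - (\<Prod>i<k. A i)) * (\<Prod>i<k. B i))"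
  unfolding bal_sum_def sum_subtractf[symmetric] by (simp only: right_diff_distrib left_diff_distrib)

section \<open>Block structure of the sums at a root of unity of odd order\<close>

context
  fixes z :: complex and N n :: nat
  assumes z_power: "z ^ (2*N+1) = 1" and z_prim: "\<And>m. 0 < m \<Longrightarrow> m < 2*N+1 \<Longrightarrow> z ^ m \<noteq> 1"
    and N: "N > 0" and n_def: "n = 2*N+1"
begin

private lemma zn: "z ^ n = 1" and n_pos: "n > 0"
  using z_power by (simp_all add: n_def)

private lemma z_even_neq_1: "z ^ (2*i+2) \<noteq> 1" if "i < 2*N"
proof
  assume "z ^ (2*i+2) = 1"
  then have "2*N+1 dvd 2*i+2" using z_power_eq_1_iff[OF z_power z_prim, of "2*i+2"] by (simp only:)
  then have "n dvd 2 * (i+1)" by (simp add: n_def)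
  moreover have "coprime n 2" by (simp add: n_def)
  ultimately have "n dvd i + 1" using coprime_dvd_mult_right_iff by blast
  then show False using that by (auto dest: dvd_imp_le simp: n_def)
qed

private lemma z_periodic: "z ^ (a * n + b) = z ^ b"
  by (simp add: power_add mult.commute[of a] power_mult zn)

private lemma z_neq_1: "z \<noteq> 1"
  using z_prim[of 1] N by auto

private lemma rval_qvar_power: "rval z (qvar ^ (a * n + b)) (z ^ b)"
  using rval_power[OF rval_qvar, of z "a * n + b"] by (simp only: z_periodic)

text \<open>In this context \<open>n\<close> is the order of \<open>z\<close>, later also a proper
  divisor of the \<open>n\<close> of the theorem. Periodicity reduces block \<open>u\<close> to
  block \<open>0\<close>; the index \<open>i = 2*N\<close> is left out because its denominator
  vanishes at \<open>z\<close>.\<close>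

private lemma rval_ratio:
  assumes "i < 2*N"
  shows "rval z (ratio (u * n + i)) ((1 - z ^ (2*i+1)) / (1 - z ^ (2*i+2)))"
proof -
  have "2*(u*n+i)+1 = (2*u)*n + (2*i+1)" "2*(u*n+i)+2 = (2*u)*n + (2*i+2)" by simp_all
  then show ?thesis unfolding ratio_def using z_even_neq_1[OF assms]
    by (simp only:) (intro rval_intros rval_qvar_power, simp)
qed

private lemma rval_prod_ratio:
  assumes "v \<le> 2*N"
  shows "rval z (\<Prod>i<v. ratio (u * n + i)) (\<Prod>i<v. (1 - z ^ (2*i+1)) / (1 - z ^ (2*i+2)))"
  by (rule rval_prod, rule rval_ratio) (use assms in simp)

private lemma rval_ratio_plus:
  shows "rval z (ratio_plus (u * n + i)) ((1 + z ^ (2*i+1)) / (1 + z ^ (2*i+2)))"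
proof -
  have "2*(u*n+i)+1 = (2*u)*n + (2*i+1)" "2*(u*n+i)+2 = (2*u)*n + (2*i+2)" by simp_all
  moreover have "1 + z ^ (2*i+2) \<noteq> 0"
    using z_power_minus[OF z_power z_prim, of "2*i+2"] by (metis add_eq_0_iff)
  ultimately show ?thesis unfolding ratio_plus_def
    by (simp only:) (intro rval_intros rval_qvar_power)
qed

private lemma prod_ratio_vanish:
  assumes "N < v"
  shows "(\<Prod>i<v. (1 - z ^ (2*i+1)) / (1 - z ^ (2*i+2))) = 0"
  by (rule prod_zero) (use assms z_power in \<open>auto intro!: bexI[of _ N]\<close>)

private lemma regular_quotient:
  assumes "m > 0"
  shows "regular z ((1 - qvar ^ n) / (1 - qvar ^ (m * n)))"
proof -
  define s where "s = (\<Sum>j<m. (qvar ^ n) ^ j)"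
  have "rval z s (\<Sum>j<m. (z ^ n) ^ j)"
    unfolding s_def by (intro rval_sum rval_power rval_qvar)
  then have "rval z s (of_nat m)" by (simp add: zn)
  then have "rval z (1 / s) (1 / of_nat m)" using assms by (intro rval_intros) auto
  moreover have "1 - qvar ^ (m * n) = (1 - qvar ^ n) * s"
    unfolding s_def mult.commute[of m] power_mult by (rule one_diff_power_eq)
  then have "(1 - qvar ^ n) / (1 - qvar ^ (m * n)) = 1 / s"
    using qvar_power_neq_1[OF n_pos] by simp
  ultimately show ?thesis by (auto intro: regularI)
qed

text \<open>In each block the simple zero of the denominator at \<open>i = 2*N\<close> is
  compensated by the zero of the numerator at \<open>i = N\<close>.\<close>

private lemma regular_prod_ratio_multiple: "regular z (\<Prod>i<u*n. ratio i)"
proof (induction u)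
  case 0
  show ?case by (simp add: regular_closed)
next
  case (Suc u)
  define w where "w = (\<Prod>i<2*N. ratio (u*n+i))"
  have "rval z w 0"
    unfolding w_def by (rule rval_cong[OF rval_prod_ratio prod_ratio_vanish]) (use N in auto)
  then have w: "regular z (w / (1 - qvar ^ n))" by (rule regular_divide_root[OF _ zn n_pos])
  have "Suc u * n = u * n + Suc (2*N)" by (simp add: n_def)
  then have "(\<Prod>i<Suc u * n. ratio i) = (\<Prod>i<u*n. ratio i) * (w * ratio (u*n+2*N))"
    by (simp only: prod_lessThan_add w_def prod.lessThan_Suc)
  also have "2*(u*n+2*N)+2 = (2*u+2)*n" by (simp add: n_def algebra_simps)
  then have "w * ratio (u*n+2*N) = w / (1 - qvar ^ n) * ((1 - qvar ^ (2*(u*n+2*N)+1))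
      * ((1 - qvar ^ n) / (1 - qvar ^ ((2*u+2)*n))))"
    unfolding ratio_def using qvar_power_neq_1[OF n_pos] by (simp only:) simp
  finally show ?case using Suc w regular_quotient[of "2*u+2"]
    by (simp only:) (intro regular_closed, auto)
qed

lemma regular_prod_ratio: "regular z (\<Prod>i<k. ratio i)"
proof -
  have "k = (k div n) * n + k mod n" by simp
  then have "(\<Prod>i<k. ratio i) = (\<Prod>i<(k div n)*n. ratio i) * (\<Prod>i<k mod n. ratio ((k div n)*n+i))"
    using prod_lessThan_add by metis
  moreover have "k mod n \<le> 2*N" using n_pos mod_less_divisor[of n k] by (simp add: n_def)
  then have "regular z (\<Prod>i<k mod n. ratio ((k div n)*n+i))"
    by (intro regular_prod regularI[OF rval_ratio]) auto
  ultimately show ?thesis using regular_prod_ratio_multiple by (simp add: regular_closed)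
qed

lemma regular_prod_ratio_plus: "regular z (\<Prod>i<k. ratio_plus i)"
  using rval_ratio_plus[of 0] by (intro regular_prod regularI) simp

text \<open>The \<open>u\<close> complete blocks contribute a constant, and modulo \<open>n\<close>
  the exponents depend on \<open>v\<close> alone. The constant is chosen before \<open>v\<close>, so
  it can be pulled out of a block sum.\<close>

private lemma rval_wp_term:
  "\<exists>c. \<forall>v<n. rval z (wp_term (u*n+v)) (c * root_term z v)"
proof -
  obtain a b where ab: "rval z (\<Prod>i<u*n. ratio i) a" "rval z (\<Prod>i<u*n. ratio_plus i) b"
    using regular_prod_ratio regular_prod_ratio_plus by (meson regularE)
  have "rval z (wp_term (u*n+v)) (a ^ 4 * b / (1 - z) * root_term z v)" if "v < n" for v
  proof -
    have e: "4*(u*n+v)+1 = (4*u)*n + (4*v+1)" "(u*n+v)^2 + (u*n+v) = (u*u*n+2*u*v+u)*n + (v^2+v)"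
      by (simp_all add: power2_eq_square algebra_simps)
    have "rval z (wp_term (u*n+v)) ((1 - z ^ (4*v+1)) / (1 - z) * z ^ (v^2+v) *
        (a * (\<Prod>i<v. (1 - z ^ (2*i+1)) / (1 - z ^ (2*i+2)))) ^ 4 * (b * (\<Prod>i<v. (1 + z ^ (2*i+1)) / (1 + z ^ (2*i+2)))))"
      unfolding wp_term_altdef e prod_lessThan_add using that z_neq_1
      by (intro rval_intros rval_qvar_power rval_prod ab rval_ratio rval_ratio_plus) (auto simp: n_def)
    moreover have "root_term z v = (1 - z ^ (4*v+1)) * z ^ (v^2+v) *
        ((\<Prod>i<v. (1 - z ^ (2*i+1)) / (1 - z ^ (2*i+2))) ^ 4 * (\<Prod>i<v. (1 + z ^ (2*i+1)) / (1 + z ^ (2*i+2))))"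
      by (simp only: root_term_def prod.distrib prod_power_distrib)
    ultimately show ?thesis
      by (elim rval_cong) (simp only: power_mult_distrib times_divide_eq_left times_divide_eq_right mult_ac)
  qed
  then show ?thesis by blast
qed

private lemma sum_root_term_zero:
  assumes "N < w"
  shows "(\<Sum>v<w. root_term z v) = 0"
proof -
  have "(\<Sum>v<w. root_term z v) = (\<Sum>v\<le>N. root_term z v)"
  proof (rule sum.mono_neutral_right)
    have "root_term z v = 0" if "N < v" for v
      unfolding root_term_def prod.distrib prod_power_distrib[symmetric] prod_ratio_vanish[OF that] by simp
    then show "\<forall>v\<in>{..<w} - {..N}. root_term z v = 0" by auto
  qed (use assms in auto)
  also have "\<dots> = 0" by (rule sum_antisymmetric_zero) (rule root_term_reflect[OF z_power z_prim])
  finally show ?thesis .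
qed

text \<open>The two values of \<open>M\<close> in the theorem end the range either with a complete
  block, \<open>w = 0\<close>, or just past the middle of one. Terms of a block beyond the middle
  index \<open>N\<close> vanish at \<open>z\<close>, so every partial block longer than
  \<open>N\<close> sums to zero.\<close>

lemma rval_wp_block_sum:
  assumes "w = 0 \<or> N < w \<and> w \<le> n"
  shows "rval z (\<Sum>k<u*n+w. wp_term k) 0"
proof -
  have block: "rval z (\<Sum>v<w. wp_term (u*n+v)) 0" if "w = 0 \<or> N < w \<and> w \<le> n" for u w
  proof -
    obtain c where c: "\<And>v. v < n \<Longrightarrow> rval z (wp_term (u*n+v)) (c * root_term z v)"
      using rval_wp_term by blast
    have "rval z (\<Sum>v<w. wp_term (u*n+v)) (\<Sum>v<w. c * root_term z v)"
      by (rule rval_sum) (use that c in auto)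
    then show ?thesis using that sum_root_term_zero[of w] by (auto simp flip: sum_distrib_left)
  qed
  have "rval z (\<Sum>k<u*n. wp_term k) 0"
  proof (induction u)
    case (Suc u)
    have "Suc u * n = u * n + n" by simp
    then show ?case using rval_add[OF Suc block[of n u]] N by (simp only: sum_lessThan_add) (simp add: n_def)
  qed (simp add: rval_0)
  from rval_add[OF this block[OF assms, of u]] show ?thesis by (simp add: sum_lessThan_add)
qed

text \<open>The product of the ratios contains the zero at \<open>i = N\<close> and enters to the
  fourth power. Hence both choices of \<open>M\<close> give the same sum to order four at a
  primitive \<open>n\<close>-th root.\<close>

lemma regular_wp_term_tail:
  assumes "N < k" "k < n"
  shows "regular z (wp_term k / (1 - qvar ^ n) ^ 4)"
proof -
  have "rval z (\<Prod>i<k. ratio i) 0"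
    using rval_cong[OF rval_prod_ratio[of k 0] prod_ratio_vanish[of k]] assms by (simp add: n_def)
  then have r: "regular z ((\<Prod>i<k. ratio i) / (1 - qvar ^ n))"
    by (rule regular_divide_root[OF _ zn n_pos])
  have "rval z ((1 - qvar ^ (4*k+1)) / (1 - qvar)) ((1 - z ^ (4*k+1)) / (1 - z))"
    using z_neq_1 by (intro rval_intros) auto
  then have "regular z ((1 - qvar ^ (4*k+1)) / (1 - qvar) * qvar ^ (k^2 + k) * ((\<Prod>i<k. ratio i) / (1 - qvar ^ n)) ^ 4 * (\<Prod>i<k. ratio_plus i))"
    by (intro regular_closed regular_prod_ratio_plus r) (rule regularI)
  then show ?thesis unfolding wp_term_altdef by (simp add: power_divide)
qed

text \<open>Both factors \<open>(q^2;q^2)_k\<close> of the denominator, one of them hidden in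
  \<open>(q^4;q^4)_k\<close>, are paired with numerators \<open>(q;q^2)_k\<close> into regular
  products of ratios. The remaining denominators \<open>1 + q ^ (2*i+2)\<close> are nonzero at
  \<open>z\<close>, whose order is odd.\<close>

lemma regular_bal_sum: "regular z (bal_sum qvar K (wp_num qvar 1) (bal_single qvar 1))"
proof -
  have "regular z (1 / (1 + qvar ^ (2*i+2)))" for i
    by (rule regularI[where c = "1 / (1 + z ^ (2*i+2))"], intro rval_intros)
      (use z_power_minus[OF z_power z_prim, of "2*i+2"] in \<open>metis add_eq_0_iff\<close>)
  then have "regular z (qvar ^ (2*k) * (\<Prod>i<k. ratio i) ^ 2 * (\<Prod>i<k. (1 - qvar ^ (2*i+1)) * (1 / (1 + qvar ^ (2*i+2)))))" for k
    by (intro regular_closed regular_prod regular_prod_ratio)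
  moreover have "qvar ^ (2*k) / (\<Prod>i<k. (1 - qvar ^ (2*i+2)) * (1 + qvar ^ (2*i+2)))
      * (\<Prod>i<k. wp_num qvar 1 i) * (\<Prod>i<k. bal_single qvar 1 i)
    = qvar ^ (2*k) * (\<Prod>i<k. ratio i) ^ 2 * (\<Prod>i<k. (1 - qvar ^ (2*i+1)) * (1 / (1 + qvar ^ (2*i+2))))" for k
  proof -
    have "(\<Prod>i<k. wp_num qvar 1 i) = (\<Prod>i<k. 1 - qvar ^ (2*i+1)) ^ 2"
      "(\<Prod>i<k. bal_single qvar 1 i) = (\<Prod>i<k. 1 - qvar ^ (2*i+1)) / (\<Prod>i<k. 1 - qvar ^ (2*i+2))"
      "(\<Prod>i<k. ratio i) = (\<Prod>i<k. 1 - qvar ^ (2*i+1)) / (\<Prod>i<k. 1 - qvar ^ (2*i+2))"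
      "(\<Prod>i<k. (1 - qvar ^ (2*i+1)) * (1 / (1 + qvar ^ (2*i+2)))) = (\<Prod>i<k. 1 - qvar ^ (2*i+1)) / (\<Prod>i<k. 1 + qvar ^ (2*i+2))"
      unfolding wp_num_def bal_single_def ratio_def prod_dividef[symmetric] prod_power_distrib
      by (simp_all add: power2_eq_square)
    then show ?thesis unfolding prod.distrib by (simp only:) (simp add: power_divide power2_eq_square mult_ac)
  qed
  ultimately show ?thesis unfolding bal_sum_def by (intro regular_sum) simp
qed

section \<open>Expansion around \<open>a = b = 1\<close> at a primitive \<open>n\<close>-th
  root\<close>

context
  fixes x t :: "rat poly fract"
  assumes x_def: "x = qvar ^ n" and t_def: "t = (1 - x)^2 / x"
begin

private lemma x_nonzero: "x \<noteq> 0" and x_neq_1: "1 - x \<noteq> 0" and t_nonzero: "t \<noteq> 0"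
  using qvar_nonzero qvar_power_neq_1[OF n_pos] by (simp_all add: x_def t_def)

private lemma rval_x: "rval z x 1"
  using rval_power[OF rval_qvar, of z n] by (simp add: x_def zn)

private lemma rval_inverse_x: "rval z (1 / x) 1"
  using rval_divide[OF rval_1 rval_x] by simp

private lemma z_nz:
  assumes "i < N"
  shows "1 - z ^ (2*i+1) \<noteq> 0" "1 - z ^ (2*i+2) \<noteq> 0" "1 + z ^ (2*i+1) \<noteq> 0" "1 + z ^ (2*i+2) \<noteq> 0"
  using z_odd_even_nonzero[OF z_power _ assms] z_prim by blast+

private lemma z_refl:
  assumes "i < N"
  shows "z ^ (2*(N - Suc i)+1) = 1 / z ^ (2*i+2)" "z ^ (2*(N - Suc i)+2) = 1 / z ^ (2*i+1)"
  using z_reflect[OF z_power _ assms] z_prim by blast+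

private lemma root_term_refl: "k \<le> N \<Longrightarrow> root_term z (N - k) = - root_term z k"
  using root_term_reflect[OF z_power, of k] z_prim by blast

private lemma rval_wp_num: "rval z a 1 \<Longrightarrow> rval z (wp_num qvar a i) ((1 - z ^ (2*i+1))^2)"
  unfolding wp_num_def
  by (rule rval_cong[of _ _ "(1 - 1 * z ^ (2*i+1)) * (1 - z ^ (2*i+1) / 1)"], intro rval_intros) (auto simp: power2_eq_square)

private lemma rval_wp_den: "rval z a 1 \<Longrightarrow> rval z (wp_den qvar a i) ((1 - z ^ (2*i+2))^2)"
  unfolding wp_den_def
  by (rule rval_cong[of _ _ "(1 - 1 * z ^ (2*i+2)) * (1 - z ^ (2*i+2) / 1)"], intro rval_intros) (auto simp: power2_eq_square)

private lemma rval_wp_ratio: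
  "rval z a 1 \<Longrightarrow> i < N \<Longrightarrow> rval z (wp_num qvar a i / wp_den qvar a i) (((1 - z ^ (2*i+1)) / (1 - z ^ (2*i+2)))^2)"
  using rval_divide[OF rval_wp_num rval_wp_den, of a a i i] z_nz(2)[of i] by (simp add: power_divide)

private lemma rval_wp_single:
  "rval z b 1 \<Longrightarrow> i < N \<Longrightarrow> rval z (wp_single qvar b i) ((1 - z ^ (2*i+1)) / (1 - z ^ (2*i+2)))"
  unfolding wp_single_def
  by (rule rval_cong[of _ _ "(1 - 1 * z ^ (2*i+1)) / (1 - z ^ (2*i+2))"], intro rval_intros)
    (use z_nz(2)[of i] in auto)

private lemma rval_bal_single:
  "rval z b 1 \<Longrightarrow> i < N \<Longrightarrow> rval z (bal_single qvar b i) ((1 - z ^ (2*i+1)) / (1 - z ^ (2*i+2)))"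
  unfolding bal_single_def
  by (rule rval_cong[of _ _ "(1 - 1 * z ^ (2*i+1)) / (1 - 1 * z ^ (2*i+2))"], intro rval_intros)
    (use z_nz(2)[of i] in auto)

text \<open>Here \<open>t = x + 1 / x - 2\<close>: being symmetric in \<open>a\<close> and
  \<open>1 / a\<close>, the pairs depend on \<open>a = x\<close> only through \<open>t\<close>,
  which has a double zero at \<open>z\<close>.\<close>

private lemma wp_num_x: "wp_num qvar x i = (1 - qvar ^ (2*i+1))^2 - qvar ^ (2*i+1) * t"
  and wp_den_x: "wp_den qvar x i = (1 - qvar ^ (2*i+2))^2 - qvar ^ (2*i+2) * t"
proof -
  have "(1 - x * u) * (1 - u / x) = (1 - u)^2 - u * t" for u
    using x_nonzero unfolding t_def by (simp add: field_simps power2_eq_square)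
  then show "wp_num qvar x i = (1 - qvar ^ (2*i+1))^2 - qvar ^ (2*i+1) * t"
    "wp_den qvar x i = (1 - qvar ^ (2*i+2))^2 - qvar ^ (2*i+2) * t"
    unfolding wp_num_def wp_den_def by blast+
qed

private lemma wp_num_1: "wp_num qvar 1 i = (1 - qvar ^ (2*i+1))^2"
  and wp_den_1: "wp_den qvar 1 i = (1 - qvar ^ (2*i+2))^2"
  by (simp_all add: wp_num_def wp_den_def power2_eq_square)

private lemma wp_den_nonzero: "i < N \<Longrightarrow> wp_den qvar x i \<noteq> 0" "i < N \<Longrightarrow> wp_den qvar 1 i \<noteq> 0"
  using rval_nonzero[OF rval_wp_den[OF rval_x]] rval_nonzero[OF rval_wp_den[OF rval_1]] z_nz(2) by auto

private lemma qvar_even_nonzero: "i < N \<Longrightarrow> 1 - qvar ^ (2*i+2) \<noteq> 0"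
  using wp_den_nonzero(2) by (auto simp: wp_den_1)

text \<open>
  Logarithmic derivatives of the factors with respect to \<open>a + 1 / a\<close> and \<open>b\<close>, at
  \<open>q = z\<close> and \<open>a = b = 1\<close>.
\<close>

private definition wp_slope :: "nat \<Rightarrow> complex" where
  "wp_slope i = z ^ (2*i+2) / (1 - z ^ (2*i+2))^2 - z ^ (2*i+1) / (1 - z ^ (2*i+1))^2"

private definition single_slope :: "nat \<Rightarrow> complex" where
  "single_slope i = - (1 - z ^ (2*i+1) * z ^ (2*i+2)) / ((1 - z ^ (2*i+1)) * (1 - z ^ (2*i+2)))"

private lemma rval_wp_ratio_difference:
  assumes "i < N"
  shows "rval z ((wp_num qvar x i / wp_den qvar x i - wp_num qvar 1 i / wp_den qvar 1 i) / t)
    (((1 - z ^ (2*i+1)) / (1 - z ^ (2*i+2)))^2 * wp_slope i)"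
proof -
  have eq: "(wp_num qvar x i / wp_den qvar x i - wp_num qvar 1 i / wp_den qvar 1 i) / t
    = (qvar ^ (2*i+2) * (1 - qvar ^ (2*i+1))^2 - qvar ^ (2*i+1) * (1 - qvar ^ (2*i+2))^2) / (wp_den qvar x i * (1 - qvar ^ (2*i+2))^2)"
    unfolding wp_num_x wp_num_1 wp_den_1 wp_den_x
    by (rule wp_ratio_difference) (use wp_den_nonzero(1)[OF assms] qvar_even_nonzero[OF assms] t_nonzero in \<open>simp_all only: wp_den_x not_False_eq_True\<close>)
  have "rval z ((wp_num qvar x i / wp_den qvar x i - wp_num qvar 1 i / wp_den qvar 1 i) / t)
     ((z ^ (2*i+2) * (1 - z ^ (2*i+1))^2 - z ^ (2*i+1) * (1 - z ^ (2*i+2))^2) / ((1 - z ^ (2*i+2))^2 * (1 - z ^ (2*i+2))^2))"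
    unfolding eq using z_nz(2)[OF assms] by (intro rval_intros rval_wp_den rval_x) auto
  moreover have "(v * (1 - u)^2 - u * (1 - v)^2) / ((1 - v)^2 * (1 - v)^2) = ((1 - u) / (1 - v))^2 * (v / (1 - v)^2 - u / (1 - u)^2)"
    if "1 - u \<noteq> 0" "1 - v \<noteq> 0" for u v :: complex
  proof -
    define U V where "U = (1 - u)^2" and "V = (1 - v)^2"
    have "U \<noteq> 0" "V \<noteq> 0" using that by (simp_all add: U_def V_def)
    then have "(v * U - u * V) / (V * V) = U / V * (v / V - u / U)"
      by (simp add: field_simps)
    then show ?thesis by (simp add: U_def V_def power_divide)
  qed
  ultimately show ?thesis unfolding wp_slope_def using z_nz(1,2)[OF assms] by (simp only: not_False_eq_True)
qed

private lemma rval_wp_single_difference: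
  assumes "i < N"
  shows "rval z ((wp_single qvar (1 / x) i - wp_single qvar 1 i) / (1 - x))
    ((1 - z ^ (2*i+1)) / (1 - z ^ (2*i+2)) * single_slope i)"
proof -
  have r: "rval z (1 - x * qvar ^ (2*i+2)) (1 - z ^ (2*i+2))"
    by (rule rval_cong[of _ _ "1 - 1 * z ^ (2*i+2)"], intro rval_intros rval_x) simp
  have eq: "(wp_single qvar (1 / x) i - wp_single qvar 1 i) / (1 - x)
    = - (1 - qvar ^ (2*i+1) * qvar ^ (2*i+2)) / ((1 - x * qvar ^ (2*i+2)) * (1 - qvar ^ (2*i+2)))"
    unfolding wp_single_def
    by (rule wp_single_difference) (use x_nonzero x_neq_1 qvar_even_nonzero[OF assms] rval_nonzero[OF r z_nz(2)[OF assms]] in auto)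
  have "rval z ((wp_single qvar (1 / x) i - wp_single qvar 1 i) / (1 - x))
     (- (1 - z ^ (2*i+1) * z ^ (2*i+2)) / ((1 - z ^ (2*i+2)) * (1 - z ^ (2*i+2))))"
    unfolding eq using z_nz(2)[OF assms] by (intro rval_divide rval_mult r) (auto intro!: rval_intros)
  moreover have "A / (V * V) = U / V * (A / (U * V))" if "U \<noteq> 0" "V \<noteq> 0" for A U V :: complex
    using that by simp
  ultimately show ?thesis unfolding single_slope_def using z_nz(1,2)[OF assms] by (simp only: not_False_eq_True)
qed

private lemma rval_weight:
  assumes "k \<le> N"
  shows "rval z (weight qvar k) ((1 - z ^ (4*k+1)) / (1 - z) * z ^ (k^2 + k) *
     (\<Prod>i<k. (1 - z ^ (2*i+1)) * (1 + z ^ (2*i+1)) / ((1 - z ^ (2*i+2)) * (1 + z ^ (2*i+2)))))"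
  unfolding weight_def
  by (intro rval_mult rval_prod rval_divide; (intro rval_intros)?) (use z_neq_1 z_nz assms in auto)

text \<open>Reflection replaces the odd and even powers by each other's reciprocals. Inversion fixes
  \<open>u / (1 - u)^2\<close>, so the exchange negates \<open>wp_slope\<close>; for the symmetric
  \<open>single_slope\<close> it is inversion that changes the sign.\<close>

private lemma sum_slope_reflect:
  assumes "k \<le> N"
  shows "(\<Sum>i<N-k. wp_slope i) = (\<Sum>i<k. wp_slope i)" "(\<Sum>i<N-k. single_slope i) = (\<Sum>i<k. single_slope i)"
proof -
  have recip: "1/u / (1 - 1/u)^2 = u / (1 - u)^2" if "u \<noteq> 0" for u :: complex
  proof -
    have "1 - 1/u = - ((1 - u) / u)" using that by (simp add: diff_divide_distrib)
    then show ?thesis using that by (simp add: power_divide power2_eq_square)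
  qed
  have z0: "z ^ m \<noteq> 0" for m using z_nonzero[OF z_power] z_prim by simp
  show "(\<Sum>i<N-k. wp_slope i) = (\<Sum>i<k. wp_slope i)"
  proof (rule sum_antisymmetric_reflect[OF _ assms])
    fix i assume i: "i < N"
    show "wp_slope (N - Suc i) = - wp_slope i"
      unfolding wp_slope_def z_refl[OF i] recip[OF z0] by simp
  qed
  show "(\<Sum>i<N-k. single_slope i) = (\<Sum>i<k. single_slope i)"
  proof (rule sum_antisymmetric_reflect[OF _ assms])
    fix i assume i: "i < N"
    have "- (1 - 1/v * (1/u)) / ((1 - 1/v) * (1 - 1/u)) = - (- (1 - u*v) / ((1 - u) * (1 - v)))"
      if "u \<noteq> 0" "v \<noteq> 0" for u v :: complex
    proof -
      have "1 - 1/v = - ((1 - v) / v)" "1 - 1/u = - ((1 - u) / u)" "1 - 1/v * (1/u) = - ((1 - u*v) / (u*v))"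
        using that by (simp_all add: diff_divide_distrib mult.commute)
      then have "- (1 - 1/v * (1/u)) / ((1 - 1/v) * (1 - 1/u)) = (1 - u*v) / ((1 - u) * (1 - v))"
        using that by (simp add: mult.commute)
      then show ?thesis by (simp only: minus_divide_left minus_minus)
    qed
    then show "single_slope (N - Suc i) = - single_slope i"
      unfolding single_slope_def z_refl[OF i] using z0 by blast
  qed
qed

lemma regular_wp_mixed_difference:
  "regular z ((wp_sum qvar N (\<lambda>i. wp_num qvar x i / wp_den qvar x i) (wp_single qvar (1 / x))
      - wp_sum qvar N (\<lambda>i. wp_num qvar 1 i / wp_den qvar 1 i) (wp_single qvar (1 / x))
      - wp_sum qvar N (\<lambda>i. wp_num qvar x i / wp_den qvar x i) (wp_single qvar 1)
      + wp_sum qvar N (\<lambda>i. wp_num qvar 1 i / wp_den qvar 1 i) (wp_single qvar 1)) / (1 - x) ^ 4)"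
proof -
  let ?F = "\<lambda>k. ((\<Prod>i<k. wp_num qvar x i / wp_den qvar x i) - (\<Prod>i<k. wp_num qvar 1 i / wp_den qvar 1 i)) / t"
  let ?G = "\<lambda>k. ((\<Prod>i<k. wp_single qvar (1 / x) i) - (\<Prod>i<k. wp_single qvar 1 i)) / (1 - x)"
  let ?r = "\<lambda>i. (1 - z ^ (2*i+1)) / (1 - z ^ (2*i+2))"
  let ?w = "\<lambda>k. (1 - z ^ (4*k+1)) / (1 - z) * z ^ (k^2 + k) *
     (\<Prod>i<k. (1 - z ^ (2*i+1)) * (1 + z ^ (2*i+1)) / ((1 - z ^ (2*i+2)) * (1 + z ^ (2*i+2))))"
  \<comment> \<open>The mixed difference divided by \<open>t * (1 - x)\<close>, which has order
    three at \<open>z\<close>; the fourth zero has to come from \<open>S\<close> itself.\<close>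
  define S where "S = (\<Sum>k\<le>N. weight qvar k * ?F k * ?G k)"
  have F: "rval z (?F k) ((\<Prod>i<k. ?r i ^ 2) * (\<Sum>i<k. wp_slope i))" if "k \<le> N" for k
    by (rule rval_prod_difference; intro rval_wp_ratio rval_x rval_1 rval_wp_ratio_difference)
      (use that in auto)
  have G: "rval z (?G k) ((\<Prod>i<k. ?r i) * (\<Sum>i<k. single_slope i))" if "k \<le> N" for k
    by (rule rval_prod_difference; intro rval_wp_single rval_inverse_x rval_1 rval_wp_single_difference)
      (use that in auto)
  have "rval z S (\<Sum>k\<le>N. ?w k * ((\<Prod>i<k. ?r i ^ 2) * (\<Sum>i<k. wp_slope i)) * ((\<Prod>i<k. ?r i) * (\<Sum>i<k. single_slope i)))"
    unfolding S_def by (intro rval_sum rval_mult rval_weight F G) auto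
  moreover have "?w k * ((\<Prod>i<k. ?r i ^ 2) * (\<Sum>i<k. wp_slope i)) * ((\<Prod>i<k. ?r i) * (\<Sum>i<k. single_slope i))
    = root_term z k * (\<Sum>i<k. wp_slope i) * (\<Sum>i<k. single_slope i) / (1 - z)" for k
  proof -
    have regroup: "A * B / (C * D) * (A / C) ^ 2 * (A / C) = (A / C) ^ 4 * (B / D)" for A B C D :: complex
      by (simp add: eval_nat_numeral mult_ac)
    have "(\<Prod>i<k. (1 - z ^ (2*i+1)) * (1 + z ^ (2*i+1)) / ((1 - z ^ (2*i+2)) * (1 + z ^ (2*i+2)))) * (\<Prod>i<k. ?r i ^ 2) * (\<Prod>i<k. ?r i)
      = (\<Prod>i<k. ?r i ^ 4 * ((1 + z ^ (2*i+1)) / (1 + z ^ (2*i+2))))"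
      unfolding prod.distrib[symmetric] by (intro prod.cong refl regroup)
    then show ?thesis unfolding root_term_def by (simp add: mult_ac)
  qed
  moreover have "(\<Sum>k\<le>N. root_term z k * (\<Sum>i<k. wp_slope i) * (\<Sum>i<k. single_slope i) / (1 - z)) = 0"
    by (rule sum_antisymmetric_zero) (simp only: sum_slope_reflect root_term_refl mult_minus_left minus_divide_left)
  ultimately have "rval z S 0" by (simp only:)
  then have "regular z (S / (1 - qvar ^ n))" by (rule regular_divide_root[OF _ zn n_pos])
  then have "regular z (S / (1 - x) * (1 / x))"
    unfolding x_def[symmetric] by (intro regular_closed regularI[OF rval_inverse_x])
  moreover have "weight qvar k * ((\<Prod>i<k. wp_num qvar x i / wp_den qvar x i) - (\<Prod>i<k. wp_num qvar 1 i / wp_den qvar 1 i))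
     * ((\<Prod>i<k. wp_single qvar (1 / x) i) - (\<Prod>i<k. wp_single qvar 1 i)) = (t * (1 - x)) * (weight qvar k * ?F k * ?G k)" for k
    using t_nonzero x_neq_1 by simp
  then have "wp_sum qvar N (\<lambda>i. wp_num qvar x i / wp_den qvar x i) (wp_single qvar (1 / x))
      - wp_sum qvar N (\<lambda>i. wp_num qvar 1 i / wp_den qvar 1 i) (wp_single qvar (1 / x))
      - wp_sum qvar N (\<lambda>i. wp_num qvar x i / wp_den qvar x i) (wp_single qvar 1)
      + wp_sum qvar N (\<lambda>i. wp_num qvar 1 i / wp_den qvar 1 i) (wp_single qvar 1) = t * (1 - x) * S"
    unfolding wp_sum_mixed_difference S_def sum_distrib_left by (simp only:)
  moreover have "t * (1 - x) * S / (1 - x) ^ 4 = S / (1 - x) * (1 / x)"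
    using x_neq_1 by (simp add: t_def eval_nat_numeral)
  ultimately show ?thesis by (simp only:)
qed

section \<open>The balanced sums and Watson's constant to the required order\<close>

private definition bal_weight :: "nat \<Rightarrow> complex" where
  "bal_weight k = z ^ (2*k) / (\<Prod>i<k. (1 - z ^ (2*i+2)) * (1 + z ^ (2*i+2)))"

private lemma rval_bal_weight:
  assumes "k \<le> N"
  shows "rval z (qvar ^ (2*k) / (\<Prod>i<k. (1 - qvar ^ (2*i+2)) * (1 + qvar ^ (2*i+2)))) (bal_weight k)"
proof -
  have "(\<Prod>i<k. (1 - z ^ (2*i+2)) * (1 + z ^ (2*i+2))) \<noteq> 0"
    unfolding prod_zero_iff[OF finite_lessThan] using z_nz(2,4) assms
    by (metis lessThan_iff no_zero_divisors order_less_le_trans)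
  then show ?thesis unfolding bal_weight_def
    by (intro rval_divide rval_prod) (intro rval_intros)+
qed

private lemma rval_bal_sum:
  assumes "rval z a 1" "rval z b 1"
  shows "rval z (bal_sum qvar N (wp_num qvar a) (bal_single qvar b))
    (\<Sum>k\<le>N. bal_weight k * (\<Prod>i<k. (1 - z ^ (2*i+1))^2) * (\<Prod>i<k. (1 - z ^ (2*i+1)) / (1 - z ^ (2*i+2))))"
  unfolding bal_sum_def
  by (intro rval_sum rval_mult rval_bal_weight rval_prod rval_wp_num rval_bal_single assms) auto

private lemma rval_wp_num_difference:
  assumes "i < N"
  shows "rval z ((wp_num qvar x i - wp_num qvar 1 i) / t) ((1 - z ^ (2*i+1))^2 * (- (z ^ (2*i+1) / (1 - z ^ (2*i+1))^2)))"
proof -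
  have eq: "(wp_num qvar x i - wp_num qvar 1 i) / t = - (qvar ^ (2*i+1))"
    unfolding wp_num_x wp_num_1 using t_nonzero by simp
  have "rval z ((wp_num qvar x i - wp_num qvar 1 i) / t) (- (z ^ (2*i+1)))"
    unfolding eq by (intro rval_intros)
  moreover have "- (z ^ (2*i+1)) = (1 - z ^ (2*i+1))^2 * (- (z ^ (2*i+1) / (1 - z ^ (2*i+1))^2))"
    using z_nz(1)[OF assms] by simp
  ultimately show ?thesis by (simp only:)
qed

private lemma rval_bal_single_difference:
  assumes "i < N"
  shows "rval z ((bal_single qvar (1 / x) i - bal_single qvar 1 i) / (1 - x))
    ((1 - z ^ (2*i+1)) / (1 - z ^ (2*i+2)) * ((z ^ (2*i+2) - z ^ (2*i+1)) / ((1 - z ^ (2*i+1)) * (1 - z ^ (2*i+2)))))"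
proof -
  have r: "rval z (x - qvar ^ (2*i+2)) (1 - z ^ (2*i+2))"
    by (intro rval_intros rval_x)
  have eq: "(bal_single qvar (1 / x) i - bal_single qvar 1 i) / (1 - x)
    = (qvar ^ (2*i+2) - qvar ^ (2*i+1)) / ((x - qvar ^ (2*i+2)) * (1 - qvar ^ (2*i+2)))"
    unfolding bal_single_def
    by (rule bal_single_difference) (use x_nonzero x_neq_1 qvar_even_nonzero[OF assms] rval_nonzero[OF r z_nz(2)[OF assms]] in auto)
  have "rval z ((bal_single qvar (1 / x) i - bal_single qvar 1 i) / (1 - x))
     ((z ^ (2*i+2) - z ^ (2*i+1)) / ((1 - z ^ (2*i+2)) * (1 - z ^ (2*i+2))))"
    unfolding eq using z_nz(2)[OF assms] by (intro rval_divide rval_mult r) (auto intro!: rval_intros)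
  moreover have "A / (V * V) = U / V * (A / (U * V))" if "U \<noteq> 0" "V \<noteq> 0" for A U V :: complex
    using that by simp
  ultimately show ?thesis using z_nz(1,2)[OF assms] by (simp only: not_False_eq_True)
qed

private lemma regular_prod_wp_num_difference:
  assumes "k \<le> N"
  shows "regular z (((\<Prod>i<k. wp_num qvar x i) - (\<Prod>i<k. wp_num qvar 1 i)) / t)"
  by (rule regularI[OF rval_prod_difference[where c = "\<lambda>i. (1 - z ^ (2*i+1))^2"
          and s = "\<lambda>i. - (z ^ (2*i+1) / (1 - z ^ (2*i+1))^2)"]];
      intro rval_wp_num rval_x rval_1 rval_wp_num_difference)
    (use assms in auto)

private lemma regular_prod_bal_single_difference:
  assumes "k \<le> N"
  shows "regular z (((\<Prod>i<k. bal_single qvar (1 / x) i) - (\<Prod>i<k. bal_single qvar 1 i)) / (1 - x))"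
  by (rule regularI[OF rval_prod_difference[where c = "\<lambda>i. (1 - z ^ (2*i+1)) / (1 - z ^ (2*i+2))"
          and s = "\<lambda>i. (z ^ (2*i+2) - z ^ (2*i+1)) / ((1 - z ^ (2*i+1)) * (1 - z ^ (2*i+2)))"]];
      intro rval_bal_single rval_inverse_x rval_1 rval_bal_single_difference)
    (use assms in auto)

text \<open>Order three comes directly from \<open>t * (1 - x)\<close>; in the congruence this
  difference is multiplied by \<open>[n]\<close>, which supplies the fourth zero.\<close>

private lemma regular_bal_mixed_difference:
  "regular z ((bal_sum qvar N (wp_num qvar x) (bal_single qvar (1 / x))
      - bal_sum qvar N (wp_num qvar 1) (bal_single qvar (1 / x))
      - bal_sum qvar N (wp_num qvar x) (bal_single qvar 1)
      + bal_sum qvar N (wp_num qvar 1) (bal_single qvar 1)) / (1 - x) ^ 3)"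
proof -
  define w where "w k = qvar ^ (2*k) / (\<Prod>i<k. (1 - qvar ^ (2*i+2)) * (1 + qvar ^ (2*i+2)))" for k
  define F where "F k = (\<Prod>i<k. wp_num qvar x i) - (\<Prod>i<k. wp_num qvar 1 i)" for k
  define G where "G k = (\<Prod>i<k. bal_single qvar (1 / x) i) - (\<Prod>i<k. bal_single qvar 1 i)" for k
  have "w k * F k * G k / (1 - x) ^ 3 = w k * (F k / t) * (G k / (1 - x)) * (1 / x)" for k
    using x_neq_1 x_nonzero by (simp add: t_def eval_nat_numeral)
  moreover have "regular z (w k * (F k / t) * (G k / (1 - x)) * (1 / x))" if "k \<le> N" for k
    unfolding w_def F_def G_def
    by (intro regular_closed regularI[OF rval_bal_weight] regular_prod_wp_num_difference
        regular_prod_bal_single_difference regularI[OF rval_inverse_x] that)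
  ultimately show ?thesis
    unfolding bal_sum_mixed_difference sum_divide_distrib w_def[symmetric] F_def[symmetric] G_def[symmetric]
    by (intro regular_sum) (simp only: atMost_iff)
qed

private lemma regular_bal_difference:
  "regular z ((bal_sum qvar N (wp_num qvar x) (bal_single qvar (1 / x))
      - bal_sum qvar N (wp_num qvar 1) (bal_single qvar (1 / x))) / (1 - x) ^ 2)"
proof -
  define w where "w k = qvar ^ (2*k) / (\<Prod>i<k. (1 - qvar ^ (2*i+2)) * (1 + qvar ^ (2*i+2)))" for k
  define F where "F k = (\<Prod>i<k. wp_num qvar x i) - (\<Prod>i<k. wp_num qvar 1 i)" for k
  have "w k * F k * G / (1 - x) ^ 2 = w k * (F k / t) * G * (1 / x)" for k G
    using x_neq_1 x_nonzero by (simp add: t_def)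
  moreover have "regular z (w k * (F k / t) * (\<Prod>i<k. bal_single qvar (1 / x) i) * (1 / x))" if "k \<le> N" for k
    unfolding w_def F_def
    by (intro regular_closed regularI[OF rval_bal_weight] regular_prod_wp_num_difference regular_prod
        regularI[OF rval_bal_single[OF rval_inverse_x]] regularI[OF rval_inverse_x] that) (use that in simp)
  ultimately show ?thesis
    unfolding bal_sum_difference sum_divide_distrib w_def[symmetric] F_def[symmetric]
    by (intro regular_sum) (simp only: atMost_iff)
qed

text \<open>Watson's constant in \<open>wp_sum_inverse\<close>, without the factor
  \<open>[n]\<close>.\<close>

private definition prefactor :: "rat poly fract \<Rightarrow> rat poly fract" where
  "prefactor a = (\<Prod>i<N. (1 - qvar ^ (2*i+1))^2 / wp_den qvar a i)"

private lemma rval_prefactor_1: "rval z (prefactor 1) (1 / z ^ N)"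
proof -
  have "rval z (prefactor 1) (\<Prod>i<N. (1 - z ^ (2*i+1))^2 / (1 - z ^ (2*i+2))^2)"
    unfolding prefactor_def
    by (intro rval_prod rval_divide rval_wp_den rval_1) (use z_nz(2) in \<open>auto intro!: rval_intros\<close>)
  moreover have "(\<Prod>i<N. (1 - z ^ (2*i+1))^2 / (1 - z ^ (2*i+2))^2) = 1 / z ^ N"
    using prod_ratio_square[OF z_power] z_prim z_power
    by (simp only: power_divide[symmetric] prod_power_distrib) (auto simp: divide_simps power_0_left)
  ultimately show ?thesis by simp
qed

text \<open>Here the constant of the theorem enters: at \<open>z\<close> the logarithmic derivative
  of \<open>1 / wp_den\<close> in \<open>t\<close> is \<open>v / (1 - v)^2\<close> with
  \<open>v = z ^ (2*i+2)\<close>.\<close>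

private lemma rval_prefactor_difference:
  "rval z ((prefactor x - prefactor 1) / t) (1 / z ^ N * (- ((of_nat n ^ 2 - 1) / 24)))"
proof -
  let ?c = "\<lambda>i. (1 - z ^ (2*i+1))^2 / (1 - z ^ (2*i+2))^2"
  have r: "rval z ((1 - qvar ^ (2*i+1))^2 / wp_den qvar a i) (?c i)" if "i < N" "rval z a 1" for i a
    by (intro rval_divide rval_wp_den that) (use z_nz(2)[OF that(1)] in \<open>auto intro!: rval_intros\<close>)
  have d: "rval z (((1 - qvar ^ (2*i+1))^2 / wp_den qvar x i - (1 - qvar ^ (2*i+1))^2 / wp_den qvar 1 i) / t)
     (?c i * (z ^ (2*i+2) / (1 - z ^ (2*i+2))^2))" if "i < N" for i
  proof -
    have "(U / D - U / E) / t = U / D * (v / E)" if "D = E - v * t" "D \<noteq> 0" "E \<noteq> 0" for U D E v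
    proof -
      have "U * E - U * D = t * (U * v)" unfolding that(1) by (simp add: algebra_simps)
      then show ?thesis using that(2,3) t_nonzero by (simp add: diff_frac_eq)
    qed
    from this[OF wp_den_x[of i, folded wp_den_1] wp_den_nonzero[OF that]]
    have eq: "((1 - qvar ^ (2*i+1))^2 / wp_den qvar x i - (1 - qvar ^ (2*i+1))^2 / wp_den qvar 1 i) / t
      = (1 - qvar ^ (2*i+1))^2 / wp_den qvar x i * (qvar ^ (2*i+2) / wp_den qvar 1 i)" .
    show ?thesis unfolding eq
      by (intro rval_mult r that rval_x rval_divide rval_wp_den rval_1 rval_power rval_qvar) (use z_nz(2)[OF that] in auto)
  qed
  have "rval z ((prefactor x - prefactor 1) / t) ((\<Prod>i<N. ?c i) * (\<Sum>i<N. z ^ (2*i+2) / (1 - z ^ (2*i+2))^2))"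
    unfolding prefactor_def by (rule rval_prod_difference; intro r d rval_x rval_1)
  moreover have "(\<Prod>i<N. ?c i) = 1 / z ^ N"
    using prod_ratio_square[OF z_power] z_prim z_power
    by (simp only: power_divide[symmetric] prod_power_distrib) (auto simp: divide_simps power_0_left)
  moreover have "(\<Sum>i<N. z ^ (2*i+2) / (1 - z ^ (2*i+2))^2) = - ((of_nat n ^ 2 - 1) / 24)"
    unfolding n_def by (rule sum_even_reciprocal_squares[OF z_power z_prim])
  ultimately show ?thesis by (simp only:)
qed

text \<open>Write \<open>P\<close> for \<open>prefactor\<close> and \<open>Q\<close> for
  \<open>q\<close> to the power \<open>- N\<close>. To order four, \<open>L 1 1\<close> is
  \<open>[n]\<close> times \<open>Q * T x 1 + P 1 * T 1 (1/x) - P x * T x (1/x)\<close>. Inside,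
  \<open>T x 1\<close> may be replaced by \<open>T x (1/x) - T 1 (1/x) + T 1 1\<close> to order
  three, which gives \<open>Q * T 1 1 - (P 1 - Q) * (T x (1/x) - T 1 (1/x)) - (P x - P 1) * T x
  (1/x)\<close>. The middle term has order one plus two, and the last one yields the
  correction.\<close>

lemma regular_wp_sum_congruence:
  "regular z ((wp_sum qvar N (\<lambda>i. wp_num qvar 1 i / wp_den qvar 1 i) (wp_single qvar 1)
      - (1 - x) / (1 - qvar) / qvar ^ N * (1 + (1 - x)^2 * ((of_nat n ^ 2 - 1) / 24))
        * bal_sum qvar N (wp_num qvar 1) (bal_single qvar 1)) / (1 - x) ^ 4)"
proof -
  define L where "L a b = wp_sum qvar N (\<lambda>i. wp_num qvar a i / wp_den qvar a i) (wp_single qvar b)" for a b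
  define T where "T a b = bal_sum qvar N (wp_num qvar a) (bal_single qvar b)" for a b
  define \<kappa> where "\<kappa> = ((of_nat n ^ 2 - 1) / 24 :: rat poly fract)"
  define Q where "Q = 1 / qvar ^ N"
  have xN: "x = qvar ^ (2*N+1)" by (simp only: x_def n_def)
  have Ln1: "L x 1 = (1 - x) / (1 - qvar) * (Q * T x 1)"
    unfolding L_def T_def Q_def by (subst wp_sum_one[OF qvar_nonzero qvar_power_neq_1 xN]) simp_all
  have L1n: "L a (1 / x) = (1 - x) / (1 - qvar) * (prefactor a * T a (1 / x))" if "a = 1 \<or> a = x" for a
    unfolding L_def T_def prefactor_def
    by (subst wp_sum_inverse[OF qvar_nonzero qvar_power_neq_1 xN])
      (use that x_nonzero wp_den_nonzero in \<open>auto simp: mult.assoc\<close>)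
  have Q: "rval z Q (1 / z ^ N)" unfolding Q_def
    by (intro rval_intros) (use z_nonzero[OF z_power] z_prim in auto)
  have \<kappa>: "rval z \<kappa> ((of_nat n ^ 2 - 1) / 24)" unfolding \<kappa>_def by (intro rval_intros) simp
  obtain \<tau> where \<tau>: "rval z (T x (1 / x)) \<tau>" "rval z (T 1 1) \<tau>"
    using rval_bal_sum rval_x rval_inverse_x rval_1 unfolding T_def by blast
  have "rval z (prefactor 1 - Q) 0" using rval_diff[OF rval_prefactor_1 Q] by simp
  then have 1: "regular z ((prefactor 1 - Q) / (1 - x))"
    unfolding x_def by (rule regular_divide_root[OF _ zn n_pos])
  \<comment> \<open>After division by \<open>(1 - x)^2\<close> the change of
    \<open>prefactor\<close> and the correction have opposite values at \<open>z\<close>, because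
    \<open>T x (1 / x)\<close> and \<open>T 1 1\<close> share the value \<open>\<tau>\<close>; this
    gives the third zero.\<close>
  have "rval z ((prefactor x - prefactor 1) / t * (1 / x) * T x (1 / x) + Q * \<kappa> * T 1 1)
      (1 / z ^ N * (- ((of_nat n ^ 2 - 1) / 24)) * 1 * \<tau> + 1 / z ^ N * ((of_nat n ^ 2 - 1) / 24) * \<tau>)"
    by (intro rval_add rval_mult rval_prefactor_difference rval_inverse_x \<tau> Q \<kappa>)
  then have "rval z ((prefactor x - prefactor 1) / t * (1 / x) * T x (1 / x) + Q * \<kappa> * T 1 1) 0"
    by (rule rval_cong) simp
  then have 2: "regular z (((prefactor x - prefactor 1) / t * (1 / x) * T x (1 / x) + Q * \<kappa> * T 1 1) / (1 - x))"
    unfolding x_def by (rule regular_divide_root[OF _ zn n_pos])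
  have 3: "regular z ((L x (1 / x) - L 1 (1 / x) - L x 1 + L 1 1) / (1 - x) ^ 4)"
    unfolding L_def by (rule regular_wp_mixed_difference)
  have 4: "regular z ((T x (1 / x) - T 1 (1 / x) - T x 1 + T 1 1) / (1 - x) ^ 3)"
    unfolding T_def by (rule regular_bal_mixed_difference)
  have 5: "regular z ((T x (1 / x) - T 1 (1 / x)) / (1 - x) ^ 2)"
    unfolding T_def by (rule regular_bal_difference)
  have 6: "regular z (1 / (1 - qvar))"
    by (rule regularI[where c = "1 / (1 - z)"], intro rval_intros) (use z_neq_1 in simp)
  define X where "X = (L x (1 / x) - L 1 (1 / x) - L x 1 + L 1 1) / (1 - x) ^ 4
    - 1 / (1 - qvar) * (Q * ((T x (1 / x) - T 1 (1 / x) - T x 1 + T 1 1) / (1 - x) ^ 3)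
      + (prefactor 1 - Q) / (1 - x) * ((T x (1 / x) - T 1 (1 / x)) / (1 - x) ^ 2)
      + ((prefactor x - prefactor 1) / t * (1 / x) * T x (1 / x) + Q * \<kappa> * T 1 1) / (1 - x))"
  have "regular z X" unfolding X_def
    by (intro regular_closed 1 2 3 4 5 6 regularI[OF Q])
  moreover have "(L 1 1 - (1 - x) / (1 - qvar) / qvar ^ N * (1 + (1 - x)^2 * \<kappa>) * T 1 1) / (1 - x) ^ 4 = X"
  proof -
    define p c where "p = 1 - x" and "c = 1 / (1 - qvar)"
    have p: "p \<noteq> 0" using x_neq_1 by (simp add: p_def)
    have t: "(A / t * (1 / x) * B + C) / p = (A * B + p^2 * C) / p ^ 3" for A B C
      unfolding t_def p_def[symmetric] using p x_nonzero by (simp add: field_simps eval_nat_numeral)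
    have "X * p ^ 4 = (L x (1 / x) - L 1 (1 / x) - L x 1 + L 1 1)
      - c * p * (Q * (T x (1 / x) - T 1 (1 / x) - T x 1 + T 1 1)
      + (prefactor 1 - Q) * (T x (1 / x) - T 1 (1 / x))
      + ((prefactor x - prefactor 1) * T x (1 / x) + p^2 * (Q * \<kappa> * T 1 1)))"
    proof -
      have "(M / p ^ 4 - c * (Q * (A / p ^ 3) + R / p * (B / p ^ 2) + C / p ^ 3)) * p ^ 4 = M - c * p * (Q * A + R * B + C)"
        for M A R B C using p by (simp add: field_simps eval_nat_numeral)
      then show ?thesis unfolding X_def p_def[symmetric] c_def[symmetric] t .
    qed
    also have "\<dots> = L 1 1 - c * p * Q * (1 + p^2 * \<kappa>) * T 1 1"
      unfolding Ln1 L1n[OF disjI1[OF refl]] L1n[OF disjI2[OF refl]] p_def[symmetric]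
      unfolding c_def by (simp add: algebra_simps)
    finally have "(L 1 1 - c * p * Q * (1 + p^2 * \<kappa>) * T 1 1) / p ^ 4 = X"
      using p by (simp add: divide_eq_eq)
    then show ?thesis unfolding p_def[symmetric] c_def Q_def by (simp add: mult_ac)
  qed
  ultimately show ?thesis unfolding L_def T_def \<kappa>_def by simp
qed

end

end

section \<open>The supercongruence\<close>

lemma q_pochhammer_qvar:
  "q_pochhammer qvar (qvar ^ 2) k = (\<Prod>i<k. 1 - qvar ^ (2*i+1))"
  "q_pochhammer (qvar ^ 2) (qvar ^ 2) k = (\<Prod>i<k. 1 - qvar ^ (2*i+2))"
  "q_pochhammer (qvar ^ 2) (qvar ^ 4) k = (\<Prod>i<k. (1 - qvar ^ (2*i+1)) * (1 + qvar ^ (2*i+1)))"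
  "q_pochhammer (qvar ^ 4) (qvar ^ 4) k = (\<Prod>i<k. (1 - qvar ^ (2*i+2)) * (1 + qvar ^ (2*i+2)))"
proof -
  have e: "qvar * (qvar ^ 2) ^ i = qvar ^ (2*i+1)" "qvar ^ 2 * (qvar ^ 2) ^ i = qvar ^ (2*i+2)"
    "qvar ^ 2 * (qvar ^ 4) ^ i = qvar ^ (2*i+1) * qvar ^ (2*i+1)"
    "qvar ^ 4 * (qvar ^ 4) ^ i = qvar ^ (2*i+2) * qvar ^ (2*i+2)" for i
    by (simp flip: power_mult, (simp only: power_mult[symmetric] power_add[symmetric], rule arg_cong[where f = "(^) qvar"], simp)+)
  have factor: "1 - u * u = (1 - u) * (1 + u)" for u :: "rat poly fract"
    by (simp add: algebra_simps)
  show "q_pochhammer qvar (qvar ^ 2) k = (\<Prod>i<k. 1 - qvar ^ (2*i+1))"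
    "q_pochhammer (qvar ^ 2) (qvar ^ 2) k = (\<Prod>i<k. 1 - qvar ^ (2*i+2))"
    "q_pochhammer (qvar ^ 2) (qvar ^ 4) k = (\<Prod>i<k. (1 - qvar ^ (2*i+1)) * (1 + qvar ^ (2*i+1)))"
    "q_pochhammer (qvar ^ 4) (qvar ^ 4) k = (\<Prod>i<k. (1 - qvar ^ (2*i+2)) * (1 + qvar ^ (2*i+2)))"
    unfolding q_pochhammer_def e factor by (rule refl)+
qed

lemma wp_term_eq:
  "q_number qvar (4 * k + 1)
        * (q_pochhammer qvar (qvar ^ 2) k ^ 3 * q_pochhammer (qvar ^ 2) (qvar ^ 4) k
           / (q_pochhammer (qvar ^ 2) (qvar ^ 2) k ^ 3 * q_pochhammer (qvar ^ 4) (qvar ^ 4) k))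
        * qvar ^ (k ^ 2 + k) = wp_term k"
proof -
  show ?thesis
    unfolding q_pochhammer_qvar wp_term_altdef ratio_def ratio_plus_def q_number_def prod.distrib prod_dividef
    by (simp add: power_divide eval_nat_numeral mult_ac)
qed

lemma bal_sum_eq:
  "(\<Sum>k = 0..N. q_pochhammer qvar (qvar ^ 2) k ^ 3
             / (q_pochhammer (qvar ^ 2) (qvar ^ 2) k * q_pochhammer (qvar ^ 4) (qvar ^ 4) k)
             * qvar ^ (2 * k)) = bal_sum qvar N (wp_num qvar 1) (bal_single qvar 1)"
proof -
  have b: "(\<Prod>i<k. wp_num qvar 1 i) = (\<Prod>i<k. 1 - qvar ^ (2*i+1)) ^ 2"
      "(\<Prod>i<k. bal_single qvar 1 i) = (\<Prod>i<k. 1 - qvar ^ (2*i+1)) / (\<Prod>i<k. 1 - qvar ^ (2*i+2))" for k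
      unfolding wp_num_def bal_single_def prod_dividef[symmetric] prod_power_distrib
      by (simp_all add: power2_eq_square)
  show ?thesis
    unfolding q_pochhammer_qvar bal_sum_def b atLeast0AtMost by (intro sum.cong refl) (simp add: eval_nat_numeral mult_ac)
qed

theorem corollary2p4:
  fixes n M :: nat
  assumes "odd n" and "M = (n - 1) div 2 \<or> M = n - 1"
  shows "ratfun_cong
     (\<Sum>k = 0..M. q_number qvar (4 * k + 1)
        * (q_pochhammer qvar (qvar ^ 2) k ^ 3 * q_pochhammer (qvar ^ 2) (qvar ^ 4) k
           / (q_pochhammer (qvar ^ 2) (qvar ^ 2) k ^ 3 * q_pochhammer (qvar ^ 4) (qvar ^ 4) k))
        * qvar ^ (k ^ 2 + k))
     (q_number qvar n * qvar powi ((1 - int n) div 2)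
        * (1 + q_number qvar n ^ 2 * ((of_nat n ^ 2 - 1) * (1 - qvar) ^ 2 / 24))
        * (\<Sum>k = 0..(n - 1) div 2.
             q_pochhammer qvar (qvar ^ 2) k ^ 3
             / (q_pochhammer (qvar ^ 2) (qvar ^ 2) k * q_pochhammer (qvar ^ 4) (qvar ^ 4) k)
             * qvar ^ (2 * k)))
     (q_number [:0, 1:] n * cyclotomic n ^ 3)"
    (is "ratfun_cong ?A ?B _")
proof -
  obtain N where n: "n = 2*N+1" using assms(1) by (elim oddE)
  have M: "M = N \<or> M = 2*N" using assms(2) by (simp add: n)
  define x where "x = qvar ^ n"
  define T where "T = bal_sum qvar N (wp_num qvar 1) (bal_single qvar 1)"
  have A: "?A = (\<Sum>k<M+1. wp_term k)"
    unfolding wp_term_eq by (simp add: atLeast0AtMost lessThan_Suc_atMost)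
  have "(1 - int n) div 2 = - int N" by (simp add: n)
  then have powi: "qvar powi ((1 - int n) div 2) = 1 / qvar ^ N"
    by (simp add: power_int_minus divide_inverse)
  have "q_number qvar n ^ 2 * ((of_nat n ^ 2 - 1) * (1 - qvar) ^ 2 / 24) = (1 - x)^2 * ((of_nat n ^ 2 - 1) / 24)"
    using qvar_neq_1 by (simp add: q_number_def x_def power_divide)
  then have B: "?B = (1 - x) / (1 - qvar) / qvar ^ N * (1 + (1 - x)^2 * ((of_nat n ^ 2 - 1) / 24)) * T"
    unfolding powi bal_sum_eq by (simp add: q_number_def x_def n T_def)
  show ?thesis
  proof (cases "N = 0")
    case True
    \<comment> \<open>For \<open>n = 1\<close> the modulus has its only root at \<open>1\<close>,
      where the denominators \<open>1 - q\<close> vanish, so the argument by roots does not apply;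
      but only \<open>k = 0\<close> occurs and both sides are \<open>1\<close>.\<close>
    have "?A = ?B" unfolding A B
      using True M qvar_neq_1 by (simp add: wp_term_def weight_def T_def bal_sum_def x_def n)
    then show ?thesis unfolding ratfun_cong_def by simp
  next
    case False
    show ?thesis
    proof (rule ratfun_cong_if_regular)
      show "n > 1" using False by (simp add: n)
    next
      fix z assume "primitive_root_unity n z"
      then have z: "z ^ (2*N+1) = 1" "\<And>m. 0 < m \<Longrightarrow> m < 2*N+1 \<Longrightarrow> z ^ m \<noteq> 1"
        by (auto simp: primitive_root_unity_def n)
      have split: "{..<M+1} = {..N} \<union> {N<..M}" using M by auto
      have "?A = (\<Sum>k\<le>N. wp_term k) + (\<Sum>k\<in>{N<..M}. wp_term k)"
        unfolding A split by (rule sum.union_disjoint) auto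
      also have "(\<Sum>k\<le>N. wp_term k) = wp_sum qvar N (\<lambda>i. wp_num qvar 1 i / wp_den qvar 1 i) (wp_single qvar 1)"
        by (simp add: wp_sum_def wp_term_def)
      finally have "(?A - ?B) / (1 - qvar ^ n) ^ (3 + 1)
        = (wp_sum qvar N (\<lambda>i. wp_num qvar 1 i / wp_den qvar 1 i) (wp_single qvar 1) - ?B) / (1 - x) ^ 4
          + (\<Sum>k\<in>{N<..M}. wp_term k / (1 - qvar ^ n) ^ 4)"
        by (simp add: x_def sum_divide_distrib add_divide_distrib diff_divide_distrib)
      moreover have "regular z (\<Sum>k\<in>{N<..M}. wp_term k / (1 - qvar ^ n) ^ 4)"
        by (intro regular_sum regular_wp_term_tail[OF z _ n]) (use M False in \<open>auto simp: n\<close>)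
      moreover have "regular z ((wp_sum qvar N (\<lambda>i. wp_num qvar 1 i / wp_den qvar 1 i) (wp_single qvar 1) - ?B) / (1 - x) ^ 4)"
        unfolding B T_def by (rule regular_wp_sum_congruence[OF z _ n x_def refl]) (use False in auto)
      ultimately show "regular z ((?A - ?B) / (1 - qvar ^ n) ^ (3 + 1))"
        by (simp only: regular_closed)
    next
      fix z :: complex
      assume zn: "z ^ n = 1" and z1: "z \<noteq> 1"
      then obtain d where d: "d dvd n" "primitive_root_unity d z"
        using roots_unity_eq_Union_primitive[of n] by (auto simp: n)
      obtain m where m: "n = d * m" using d(1) by (elim dvdE)
      have "odd d" "odd m" using assms(1) by (auto simp: m)
      then obtain D l where D: "d = 2*D+1" and l: "m = 2*l+1" by (elim oddE)
      have D0: "D > 0" using d(2) z1 by (cases "D = 0") (auto simp: primitive_root_unity_def D)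
      have z: "z ^ (2*D+1) = 1" "\<And>m. 0 < m \<Longrightarrow> m < 2*D+1 \<Longrightarrow> z ^ m \<noteq> 1"
        using d(2) by (auto simp: primitive_root_unity_def D)
      have rA: "rval z ?A 0"
      proof (cases "M = N")
        case True
        \<comment> \<open>From \<open>n = d * m\<close> with both factors odd: the half range
          consists of \<open>l\<close> complete blocks and \<open>D + 1\<close> further indices, the
          shortest nonempty partial block that \<open>rval_wp_block_sum\<close> admits.\<close>
        have "2 * N = 2 * (l * d + D)" using n m unfolding D l by (simp add: algebra_simps)
        then have "M + 1 = l * d + (D + 1)" using True by simp
        then show ?thesis unfolding A using rval_wp_block_sum[OF z D0 D, of "D + 1" l] D0 by (simp add: D)
      next
        case False
        then have "M + 1 = m * d + 0" using M n m by (simp add: mult.commute)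
        then show ?thesis unfolding A using rval_wp_block_sum[OF z D0 D, of 0 m] by simp
      qed
      have z0: "z \<noteq> 0" using z(1) by auto
      obtain c where c: "rval z T c"
        unfolding T_def using regular_bal_sum[OF z D0 D] by (rule regularE)
      have "rval z x 1" using rval_power[OF rval_qvar, of z n] by (simp add: x_def zn)
      have "rval z ?B ((1 - 1) / (1 - z) / z ^ N * (1 + (1 - 1)^2 * ((of_nat n ^ 2 - 1) / 24)) * c)"
        unfolding B using z0 z1 by (intro rval_intros \<open>rval z x 1\<close> c) auto
      from rval_diff[OF rA this] have "rval z (?A - ?B) 0" by simp
      then show "regular z ((?A - ?B) / (1 - qvar ^ n))"
        by (rule regular_divide_root[OF _ zn]) (simp add: n)
    qed
  qed
qed

end
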